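(* Let $T>0$ and let $Z$ be a spectrally positive Lévy process with càdlàg sample paths and $\mathbb{P}\{Z(0)=0\}=1$. Suppose that, for each $t>0$, $Z(t)$ has density function $u\mapsto f(u,t)$, and let $c_1,c_2$ be two given real constants such that $\delta:=c_1-c_2>0$. (i) If $x\ge y\ge0$, then $$\psi_Z(x,y)=\mathcal{L}(c_1,T,x).$$ (ii) If $0\le x<y<x+\delta T$, then, setting $\xi=(y-x)/\delta$, $$\psi_Z(x,y)=\mathcal{L}(c_2,\xi,y)+\int_0^\infty\mathcal{L}(c_1,T-\xi,z)\,f(y+c_2\xi-z,\xi)\,dz-\int_0^\infty z\,\mathcal{L}(c_1,T-\xi,z)\left(\int_0^\xi\frac{f(y+c_2s,s)}{\xi-s}\,f\bigl(c_2(\xi-s)-z,\ \xi-s\bigr)\,ds\right)dz.$$ (iii) If $y\ge x+\delta T$ and $x\ge0$, then $$\psi_Z(x,y)=\mathcal{L}(c_2,T,y).$$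
   Context: The simultaneous ruin probability on $[0,T]$ is $$\psi_Z(x,y)=\mathbb{P}\left\{\exists\, t\in[0,T]:\ Z(t)-c_1t>x,\ Z(t)-c_2t>y\right\}.$$ For $S>0$, $u\ge0$ and $c\in\mathbb{R}$, $$\mathcal{L}(c,S,u):=\mathbb{P}\{Z(S)-cS>u\}-\int_0^S\frac{\mathbb{E}\{\min(0,\,Z(S-s)-c(S-s))\}}{S-s}\,f(u+cs,s)\,ds.$$ Spectrally positive means that the process has no negative jumps.
   Formalization: The density f is taken jointly measurable and, for almost every t, equal to the lower right derivative of the distribution function of Z(t) wherever that is finite; for an arbitrary version of the density, e.g. one set to 0 on the line (x+c_1 s, s), the formulas fail. *)

theory Defs
  imports "HOL-Probability.Probability"
begin

text \<open>A process \<open>Z\<close> is indexed by all reals, but only its values at times \<open>t \<ge> 0\<close> are ever used.\<close>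

definition levy_process :: "'a measure \<Rightarrow> (real \<Rightarrow> 'a \<Rightarrow> real) \<Rightarrow> bool" where
  "levy_process M Z \<longleftrightarrow>
     prob_space M \<and>
     (\<forall>t\<ge>0. Z t \<in> borel_measurable M) \<and>
     (AE \<omega> in M. Z 0 \<omega> = 0) \<and>
     (\<forall>(t :: nat \<Rightarrow> real) n. 0 \<le> t 0 \<and> (\<forall>i<n. t i \<le> t (Suc i)) \<longrightarrow>
        prob_space.indep_vars M (\<lambda>_. borel) (\<lambda>i \<omega>. Z (t (Suc i)) \<omega> - Z (t i) \<omega>) {..<n}) \<and>
     (\<forall>s\<ge>0. \<forall>h\<ge>0. distr M borel (\<lambda>\<omega>. Z (s + h) \<omega> - Z s \<omega>) = distr M borel (Z h)) \<and>
     (\<forall>\<omega>\<in>space M. \<forall>t\<ge>0. continuous (at_right t) (\<lambda>s. Z s \<omega>)) \<and>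
     (\<forall>\<omega>\<in>space M. \<forall>t>0. \<exists>l. ((\<lambda>s. Z s \<omega>) \<longlongrightarrow> l) (at_left t))"

text \<open>Stochastic continuity is not listed in \<open>levy_process\<close>: it follows from the right-continuity
  of the paths and the stationarity of the increments.\<close>

definition spectrally_positive :: "'a measure \<Rightarrow> (real \<Rightarrow> 'a \<Rightarrow> real) \<Rightarrow> bool" where
  "spectrally_positive M Z \<longleftrightarrow>
     (AE \<omega> in M. \<forall>t>0. \<forall>l. ((\<lambda>s. Z s \<omega>) \<longlongrightarrow> l) (at_left t) \<longrightarrow> l \<le> Z t \<omega>)"

text \<open>\<open>f u t\<close> is the density of \<open>Z t\<close> at \<open>u\<close>. Joint measurability is what gives a meaning to the
  integrals over the time argument.\<close>

definition density_family ::
    "'a measure \<Rightarrow> (real \<Rightarrow> 'a \<Rightarrow> real) \<Rightarrow> (real \<Rightarrow> real \<Rightarrow> real) \<Rightarrow> bool" where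
  "density_family M Z f \<longleftrightarrow>
     set_borel_measurable borel (UNIV \<times> {0<..}) (\<lambda>(u, t). f u t) \<and>
     (\<forall>t>0. (\<forall>u. 0 \<le> f u t) \<and> distributed M lborel (Z t) (\<lambda>u. ennreal (f u t)))"

text \<open>A density of \<open>Z t\<close> is only determined up to a null set of arguments \<open>u\<close>, whereas the formulas
  evaluate \<open>f\<close> along lines \<open>s \<mapsto> (u + c * s, s)\<close>, and a modification of \<open>f\<close> on one such line leaves
  every \<open>f (\<cdot>, s)\<close> a density. The values on lines therefore have to be those of a fixed version. That
  version is the lower right derivative of the distribution function. It is a density whenever
  \<open>Z t\<close> has one, and it agrees with every continuous (or just right-continuous) density. No
  condition is put on \<open>f u t\<close> where this derivative is infinite (as for a gamma process at \<open>u = 0\<close>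
  and small \<open>t\<close>), and a null set of times \<open>t\<close> is exempt.\<close>

definition lower_right_density ::
    "'a measure \<Rightarrow> (real \<Rightarrow> 'a \<Rightarrow> real) \<Rightarrow> real \<Rightarrow> real \<Rightarrow> ereal" where
  "lower_right_density M Z u t =
     Liminf (at_right 0)
       (\<lambda>h. ereal (measure M {\<omega> \<in> space M. u < Z t \<omega> \<and> Z t \<omega> \<le> u + h} / h))"

definition pointwise_version ::
    "'a measure \<Rightarrow> (real \<Rightarrow> 'a \<Rightarrow> real) \<Rightarrow> (real \<Rightarrow> real \<Rightarrow> real) \<Rightarrow> bool" where
  "pointwise_version M Z f \<longleftrightarrow>
     (AE t in lborel. 0 < t \<longrightarrow>
        (\<forall>u. lower_right_density M Z u t < \<infinity> \<longrightarrow> ereal (f u t) = lower_right_density M Z u t))"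

definition ruin_prob ::
    "'a measure \<Rightarrow> (real \<Rightarrow> 'a \<Rightarrow> real) \<Rightarrow> real \<Rightarrow> real \<Rightarrow> real \<Rightarrow> real \<Rightarrow> real \<Rightarrow> real" where
  "ruin_prob M Z c1 c2 T x y =
     measure M {\<omega> \<in> space M. \<exists>t\<in>{0..T}. Z t \<omega> - c1 * t > x \<and> Z t \<omega> - c2 * t > y}"

definition crossing_formula ::
    "'a measure \<Rightarrow> (real \<Rightarrow> 'a \<Rightarrow> real) \<Rightarrow> (real \<Rightarrow> real \<Rightarrow> real) \<Rightarrow> real \<Rightarrow> real \<Rightarrow> real \<Rightarrow> real" where
  "crossing_formula M Z f c S u =
     measure M {\<omega> \<in> space M. Z S \<omega> - c * S > u} -
     (LBINT s:{0<..<S}.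
        (\<integral>\<omega>. min 0 (Z (S - s) \<omega> - c * (S - s)) \<partial>M) / (S - s) * f (u + c * s) s)"

end

theory Submission
  imports Defs
begin

text \<open>
  Write \<open>X t = Z t - c * t\<close>. For a random walk with partial sums \<open>S k\<close> and future maxima
  \<open>A k = max S j\<close> over \<open>k \<le> j \<le> n\<close>, averaging over the cyclic shifts of the last \<open>n - k\<close> steps
  shows that, conditionally on \<open>S k\<close> and \<open>S n\<close>, the decrement \<open>A k - A (k + 1)\<close> has mean
  \<open>(S k - S n)\<^sup>+ / (n - k)\<close>; no skip-freeness is needed. Sampling \<open>X\<close> on finer and finer grids, the
  absence of negative jumps makes the decrements small, so that the sum over \<open>k\<close> becomes an integral
  over the level \<open>v\<close> between \<open>X T\<close> and \<open>sup X\<close>: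
  \<open>E (\<integral> F v (v - X T) dv) = \<integral> E ((X s - X T)\<^sup>+ / (T - s) * F (X s) (X s - X T)) ds\<close>.
  This is the crossing formula averaged over levels, and no hitting times or strong Markov property
  enter.

  At a fixed level \<open>u\<close> one inequality follows from Fatou's lemma after averaging over
  \<open>(u, u + h]\<close>. For the converse, only paths after a small time \<open>\<epsilon>\<close> are considered: since \<open>X \<epsilon>\<close> has a
  density and is independent of the later increments, the averaged formula applies and yields the convolution
  \<open>E (f (u - X s) \<epsilon>)\<close> in place of \<open>f u (s + \<epsilon>)\<close>, and the lower right density dominates this convolution,
  again by Fatou's lemma.

  For two boundaries that crossing_weight at \<open>\<xi>\<close>, the process is restarted at \<open>\<xi>\<close>, and the same formula with
  the weight \<open>\<phi> (u - X \<xi>)\<close> gives the law of \<open>X \<xi>\<close> on the event of an earlier crossing.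
\<close>

subsection \<open>Paths without negative jumps\<close>

text \<open>Both inequalities at a fixed level rest on Fatou's lemma and need the density
  \<open>p\<close> to lie below the lower limits of the difference quotients of the distribution
  function. For the converse, the quotients at time \<open>s + \<epsilon>\<close> must also come
  arbitrarily close to \<open>p u (s + \<epsilon>)\<close> along some sequence. The lower right
  derivative has both properties; an arbitrary density need not. Where the derivative is infinite
  nothing is known about \<open>p\<close>. As the total weight of a crossing is at most 1, at a
  given level this affects only a null set of times, apart from those at which
  \<open>descent_rate\<close> vanishes. The small time \<epsilon> must avoid the exempt null set.
  Letting it shrink recovers the crossing event because the level is nonnegative and the path starts
  at 0, so no crossing takes place at time 0. The weight \<phi> is carried along from the beginning:
  for two boundaries \<open>\<phi> z\<close> is the probability that the restarted process crosses
  \<open>z\<close>. Such a tail offers right-continuity, hence the averages over levels to the right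
  of \<open>u\<close>.\<close>

definition no_neg_jump_path :: "(real \<Rightarrow> real) \<Rightarrow> bool" where
  "no_neg_jump_path x \<longleftrightarrow> x 0 = 0 \<and> (\<forall>t\<ge>0. continuous (at_right t) x) \<and>
     (\<forall>t>0. \<exists>l\<le>x t. (x \<longlongrightarrow> l) (at_left t))"

definition path_sup :: "(real \<Rightarrow> real) \<Rightarrow> real \<Rightarrow> real \<Rightarrow> real" where
  "path_sup x a b = (SUP t\<in>{a..b}. x t)"

definition grid_max :: "(real \<Rightarrow> real) \<Rightarrow> real \<Rightarrow> nat \<Rightarrow> nat \<Rightarrow> real" where
  "grid_max x T n k = Max ((\<lambda>j. x (real j * (T / real n))) ` {k..n})"

lemma no_neg_jump_path_right:
  assumes "no_neg_jump_path x" "0 \<le> t"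
  shows "(x \<longlongrightarrow> x t) (at_right t)"
  using assms by (simp add: no_neg_jump_path_def continuous_within)

lemma no_neg_jump_path_left:
  assumes "no_neg_jump_path x" "0 < t"
  obtains l where "l \<le> x t" "(x \<longlongrightarrow> l) (at_left t)"
  using assms by (metis no_neg_jump_path_def)

text \<open>To the left of \<open>r\<close> the path is close to its left limit \<open>l\<close>, to
  the right it is close to \<open>x r\<close>, and \<open>l \<le> x r\<close>. Going forward in time
  across \<open>r\<close> can therefore lose less than \<eta>, though it may gain any
  amount.\<close>

lemma no_neg_jump_path_local:
  assumes x: "no_neg_jump_path x" and eta: "\<eta> > 0" and r: "r \<ge> 0"
  shows "\<exists>e>0. \<forall>s t. 0 \<le> s \<longrightarrow> s \<le> t \<longrightarrow> s \<in> ball r e \<longrightarrow> t \<in> ball r e \<longrightarrow> x s < x t + \<eta>"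
proof -
  have "(x \<longlongrightarrow> x r) (at_right r)"
    using x r by (rule no_neg_jump_path_right)
  then have "\<forall>\<^sub>F t in at_right r. dist (x t) (x r) < \<eta>/2"
    using eta by (intro tendstoD) auto
  then obtain d1 where d1: "d1 > r" "\<And>t. r < t \<Longrightarrow> t < d1 \<Longrightarrow> \<bar>x t - x r\<bar> < \<eta>/2"
    unfolding eventually_at_right_field dist_real_def by blast
  have "\<exists>l d2. l \<le> x r \<and> d2 > 0 \<and> (\<forall>s. 0 \<le> s \<longrightarrow> s < r \<longrightarrow> r - d2 < s \<longrightarrow> \<bar>x s - l\<bar> < \<eta>/2)"
  proof (cases "r = 0")
    case True
    \<comment> \<open>No time precedes 0, so the bound to the left is vacuous and any radius
      serves.\<close>
    then show ?thesis by (intro exI[of _ "x r"] exI[of _ 1]) auto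
  next
    case False
    then obtain l where l: "l \<le> x r" "(x \<longlongrightarrow> l) (at_left r)"
      using no_neg_jump_path_left[OF x, of r] r by auto
    then have "\<forall>\<^sub>F t in at_left r. dist (x t) l < \<eta>/2"
      using eta by (intro tendstoD) auto
    then obtain b where "b < r" "\<And>s. b < s \<Longrightarrow> s < r \<Longrightarrow> \<bar>x s - l\<bar> < \<eta>/2"
      unfolding eventually_at_left_field dist_real_def by blast
    then show ?thesis using l by (intro exI[of _ l] exI[of _ "r - b"]) auto
  qed
  then obtain l d2 where l: "l \<le> x r" "d2 > 0"
    "\<And>s. 0 \<le> s \<Longrightarrow> s < r \<Longrightarrow> r - d2 < s \<Longrightarrow> \<bar>x s - l\<bar> < \<eta>/2" by blast
  have R: "\<bar>x t - x r\<bar> < \<eta>/2" if "r \<le> t" "t < d1" for t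
    using d1 that eta by (cases "t = r") auto
  show ?thesis
  proof (intro exI[of _ "min d2 (d1 - r)"] conjI allI impI)
    show "min d2 (d1 - r) > 0" using d1 l by auto
    fix s t assume *: "0 \<le> s" "s \<le> t" "s \<in> ball r (min d2 (d1 - r))" "t \<in> ball r (min d2 (d1 - r))"
    then have **: "r - d2 < s" "r - d2 < t" "s < d1" "t < d1"
      by (auto simp: dist_real_def)
    consider "t < r" | "s < r" "r \<le> t" | "r \<le> s" by linarith
    then show "x s < x t + \<eta>"
    proof cases
      case 1 then show ?thesis using l(3)[of s] l(3)[of t] * ** by linarith
    next
      case 2 then show ?thesis using l(1) l(3)[of s] R[of t] * ** by linarith
    next
      case 3 then show ?thesis using R[of s] R[of t] * ** by linarith
    qed
  qed
qed

text \<open>A Lebesgue number of the cover of \<open>{0..T}\<close> by the balls of the local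
  statement makes the radius uniform. The grid approximations use the absence of negative jumps only
  through this one-sided modulus.\<close>

lemma no_neg_jump_path_unif:
  assumes x: "no_neg_jump_path x" and eta: "\<eta> > 0"
  shows "\<exists>d>0. \<forall>s t. 0 \<le> s \<longrightarrow> s \<le> t \<longrightarrow> t \<le> T \<longrightarrow> t - s < d \<longrightarrow> x s < x t + \<eta>"
proof -
  obtain e where e: "\<And>r. r \<ge> 0 \<Longrightarrow> e r > 0"
    "\<And>r s t. r \<ge> 0 \<Longrightarrow> 0 \<le> s \<Longrightarrow> s \<le> t \<Longrightarrow> s \<in> ball r (e r) \<Longrightarrow> t \<in> ball r (e r) \<Longrightarrow> x s < x t + \<eta>"
    using no_neg_jump_path_local[OF x eta] by metis
  have "{0..T} \<subseteq> \<Union>((\<lambda>r. ball r (e r)) ` {0..T})"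
    using e(1) by force
  then obtain d where d: "d > 0" "\<And>s. s \<in> {0..T} \<Longrightarrow> \<exists>G\<in>(\<lambda>r. ball r (e r)) ` {0..T}. ball s d \<subseteq> G"
    using Heine_Borel_lemma[of "{0..T}" "(\<lambda>r. ball r (e r)) ` {0..T}"] by (metis (no_types, lifting) compact_Icc imageE open_ball)
  show ?thesis
  proof (intro exI[of _ d] conjI allI impI d)
    fix s t assume *: "0 \<le> s" "s \<le> t" "t \<le> T" "t - s < d"
    then obtain r where r: "r \<in> {0..T}" "ball s d \<subseteq> ball r (e r)"
      using d(2)[of s] by auto
    moreover have "s \<in> ball s d" "t \<in> ball s d" using * d by (auto simp: dist_real_def)
    ultimately have "s \<in> ball r (e r)" "t \<in> ball r (e r)" by blast+
    then show "x s < x t + \<eta>" using e(2)[of r s t] * r(1) by auto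
  qed
qed

text \<open>The grid point wanted is the right end of the cell of \<open>s\<close>; its index
  exceeds \<open>K\<close> because \<open>s\<close> lies beyond \<open>real K * h\<close>.\<close>

lemma grid_point:
  fixes s T h :: real
  assumes "0 < n" "0 < T" and h: "h = T / real n" and s: "0 \<le> s" "s \<le> T" and K: "real K * h \<le> s" "K < n"
  shows "\<exists>j\<in>{Suc K..n}. s \<le> real j * h \<and> real j * h - s \<le> h"
proof -
  have hp: "h > 0" and nh: "real n * h = T" using assms by auto
  define j where "j = nat \<lfloor>s/h\<rfloor>"
  have j: "real j * h \<le> s" "s < real (Suc j) * h"
  proof -
    have "real j = of_int \<lfloor>s/h\<rfloor>" using s hp by (simp add: j_def)
    then have "real j \<le> s/h" "s/h < real j + 1" by linarith+
    then show "real j * h \<le> s" "s < real (Suc j) * h"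
      using hp by (auto simp: field_simps)
  qed
  have "real K * h < real (Suc j) * h" using K j by linarith
  then have Kj: "K \<le> j" using hp by (simp add: mult_less_cancel_right)
  show ?thesis
  proof (cases "Suc j \<le> n")
    case True
    then show ?thesis using j Kj by (intro bexI[of _ "Suc j"]) (auto simp: algebra_simps)
  next
    \<comment> \<open>Only \<open>s = T\<close> leads here, and the last grid point is then
      \<open>s\<close> itself.\<close>
    case False
    then have "n \<le> j" by simp
    then have "real n * h \<le> real j * h" using hp by (intro mult_right_mono) auto
    then show ?thesis using nh s K j hp by (intro bexI[of _ n]) auto
  qed
qed

text \<open>Every time in \<open>{b..T}\<close> is followed within one mesh by a grid point, where
  the path is lower by less than \<eta>; so the grid misses at most \<eta> of the supremum. Starting
  the grid at \<open>Suc K\<close> keeps all its points in \<open>{b..T}\<close>.\<close>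

lemma grid_max_bounds:
  assumes d: "\<And>s t. 0 \<le> s \<Longrightarrow> s \<le> t \<Longrightarrow> t \<le> T \<Longrightarrow> t - s < d \<Longrightarrow> x s < x t + \<eta>"
    and n: "0 < n" "0 < T" "T / real n < d" and b: "0 \<le> b" "b < T"
    and K: "K < n" "real K * (T / real n) \<le> b" "b \<le> real (Suc K) * (T / real n)"
  shows "bdd_above (x ` {b..T})" "path_sup x b T \<le> grid_max x T n (Suc K) + \<eta>"
    "grid_max x T n (Suc K) \<le> path_sup x b T"
proof -
  define h where "h = T / real n"
  have hp: "h > 0" and nh: "real n * h = T" using n by (auto simp: h_def)
  have ub: "x s \<le> grid_max x T n (Suc K) + \<eta>" if s: "s \<in> {b..T}" for s
  proof -
    obtain j where j: "j \<in> {Suc K..n}" "s \<le> real j * h" "real j * h - s \<le> h"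
      using grid_point[OF n(1,2) h_def, of s K] s b K by (auto simp: h_def)
    have "real j * h \<le> real n * h" using j hp by (intro mult_right_mono) auto
    then have "x s < x (real j * h) + \<eta>" using s b j n nh by (intro d) (auto simp: h_def)
    also have "x (real j * h) \<le> grid_max x T n (Suc K)"
      unfolding grid_max_def using j by (intro Max_ge) (auto simp: h_def)
    finally show ?thesis by simp
  qed
  then show bdd: "bdd_above (x ` {b..T})" by (intro bdd_aboveI2)
  show "path_sup x b T \<le> grid_max x T n (Suc K) + \<eta>"
    unfolding path_sup_def using b ub by (intro cSUP_least) auto
  have "grid_max x T n (Suc K) \<in> (\<lambda>j. x (real j * h)) ` {Suc K..n}"
    unfolding grid_max_def h_def using K by (intro Max_in) auto
  then obtain j where j: "j \<in> {Suc K..n}" "grid_max x T n (Suc K) = x (real j * h)" by auto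
  have "real (Suc K) * h \<le> real j * h" "real j * h \<le> real n * h"
    using j hp by (auto intro!: mult_right_mono)
  then have "real j * h \<in> {b..T}" using nh K by (auto simp: h_def)
  then show "grid_max x T n (Suc K) \<le> path_sup x b T"
    unfolding path_sup_def j using bdd by (intro cSUP_upper) auto
qed

lemma floor_index:
  fixes T b :: real
  assumes "0 < n" "0 \<le> b" "b < T"
  defines "K \<equiv> nat \<lfloor>b * real n / T\<rfloor>"
  shows "K < n" "real K * (T / real n) \<le> b" "b < real (Suc K) * (T / real n)"
proof -
  have "real K = of_int \<lfloor>b * real n / T\<rfloor>" using assms by (simp add: K_def)
  then have *: "real K \<le> b * real n / T" "b * real n / T < real K + 1" by linarith+
  then show "real K * (T / real n) \<le> b" "b < real (Suc K) * (T / real n)"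
    using assms(1-3) by (auto simp: field_simps)
  have "b * real n / T < real n" using assms(1-3) by (simp add: field_simps)
  then show "K < n" using * by linarith
qed

lemma ex_small_mesh:
  assumes "(d::real) > 0"
  shows "\<exists>N. \<forall>n\<ge>N. 0 < n \<and> T / real n < d"
proof -
  have "(\<lambda>n. T / real n) \<longlonglongrightarrow> 0" by (rule lim_const_over_n)
  then have "\<forall>\<^sub>F n in sequentially. T / real n < d \<and> 0 < n"
    using assms by (intro eventually_conj order_tendstoD eventually_gt_at_top)
  then show ?thesis by (auto simp: eventually_sequentially)
qed

text \<open>Take \<eta> = 1: the path exceeds the maximum over a finite grid by at most 1.\<close>

lemma no_neg_jump_path_bdd:
  assumes x: "no_neg_jump_path x" and b: "0 \<le> b"
  shows "bdd_above (x ` {b..T})"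
proof (cases "b < T")
  case True
  obtain d where d: "d > 0" "\<And>s t. 0 \<le> s \<Longrightarrow> s \<le> t \<Longrightarrow> t \<le> T \<Longrightarrow> t - s < d \<Longrightarrow> x s < x t + 1"
    using no_neg_jump_path_unif[OF x, of 1 T] by auto
  obtain n where n: "0 < n" "T / real n < d" using ex_small_mesh[OF d(1), of T] by blast
  note K = floor_index[OF n(1) b True]
  show ?thesis
    by (rule grid_max_bounds(1)[OF d(2) n(1) _ n(2) b True K(1,2) less_imp_le[OF K(3)]])
      (use b True in auto)
next
  case False
  then have "{b..T} \<subseteq> {T}" by auto
  then have "finite {b..T}" by (rule finite_subset) auto
  then show ?thesis by auto
qed

text \<open>Apart from the limit itself, this exhibits the suprema as limits of finite maxima, which
  is the source of their measurability.\<close>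

lemma grid_max_LIMSEQ:
  assumes x: "no_neg_jump_path x" and b: "0 \<le> b" "b < T"
  shows "(\<lambda>n. grid_max x T n (Suc (nat \<lfloor>b * real n / T\<rfloor>))) \<longlonglongrightarrow> path_sup x b T"
proof (rule LIMSEQ_I)
  fix r :: real assume r: "r > 0"
  obtain d where d: "d > 0" "\<And>s t. 0 \<le> s \<Longrightarrow> s \<le> t \<Longrightarrow> t \<le> T \<Longrightarrow> t - s < d \<Longrightarrow> x s < x t + r/2"
    using no_neg_jump_path_unif[OF x, of "r/2" T] r by auto
  obtain N where N: "\<And>n. n \<ge> N \<Longrightarrow> 0 < n \<and> T / real n < d" using ex_small_mesh[OF d(1), of T] by blast
  show "\<exists>no. \<forall>n\<ge>no. norm (grid_max x T n (Suc (nat \<lfloor>b * real n / T\<rfloor>)) - path_sup x b T) < r"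
  proof (intro exI[of _ N] allI impI)
    fix n assume "n \<ge> N"
    then have n: "0 < n" "T / real n < d" using N by auto
    note K = floor_index[OF n(1) b]
    have T: "0 < T" using b by auto
    show "norm (grid_max x T n (Suc (nat \<lfloor>b * real n / T\<rfloor>)) - path_sup x b T) < r"
      using grid_max_bounds(2)[of T d x "r/2", OF d(2) n(1) T n(2) b K(1,2) less_imp_le[OF K(3)]]
        grid_max_bounds(3)[of T d x "r/2", OF d(2) n(1) T n(2) b K(1,2) less_imp_le[OF K(3)]] r by auto
  qed
qed

lemma path_sup_upper:
  assumes "no_neg_jump_path x" "0 \<le> a" "t \<in> {a..b}"
  shows "x t \<le> path_sup x a b"
  unfolding path_sup_def using no_neg_jump_path_bdd[of x a b] assms by (intro cSUP_upper) auto

lemma path_sup_gt_iff: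
  assumes "no_neg_jump_path x" "0 \<le> a" "a \<le> b"
  shows "v < path_sup x a b \<longleftrightarrow> (\<exists>t\<in>{a..b}. v < x t)"
  unfolding path_sup_def using no_neg_jump_path_bdd[of x a b] assms by (subst less_cSUP_iff) auto

lemma no_neg_jump_path_drift:
  assumes "no_neg_jump_path x"
  shows "no_neg_jump_path (\<lambda>t. x t - c * t)"
  unfolding no_neg_jump_path_def
proof (intro conjI allI impI)
  show "x 0 - c * 0 = 0" using assms by (simp add: no_neg_jump_path_def)
next
  fix t :: real assume "t \<ge> 0"
  then have "continuous (at_right t) x" using assms by (auto simp: no_neg_jump_path_def)
  then show "continuous (at_right t) (\<lambda>t. x t - c * t)" by (intro continuous_intros)
next
  fix t :: real assume "t > 0"
  then obtain l where l: "l \<le> x t" "(x \<longlongrightarrow> l) (at_left t)" using assms by (auto simp: no_neg_jump_path_def)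
  then have "((\<lambda>t. x t - c * t) \<longlongrightarrow> l - c * t) (at_left t)" by (intro tendsto_intros)
  then show "\<exists>l\<le>x t - c * t. ((\<lambda>t. x t - c * t) \<longlongrightarrow> l) (at_left t)"
    using l by (intro exI[of _ "l - c * t"]) auto
qed

lemma no_neg_jump_path_shift:
  assumes x: "no_neg_jump_path x" and a: "0 \<le> a"
  shows "no_neg_jump_path (\<lambda>t. x (a + t) - x a)"
  unfolding no_neg_jump_path_def
proof (intro conjI allI impI)
  fix t :: real assume t: "t \<ge> 0"
  have "(x \<longlongrightarrow> x (a + t)) (at_right (a + t))"
    using x t a by (auto simp: no_neg_jump_path_def continuous_within)
  then have "((\<lambda>s. x (s + a)) \<longlongrightarrow> x (a + t)) (at_right t)"
    by (simp add: filterlim_at_right_to_0[of x _ "a+t"] filterlim_at_right_to_0[of "\<lambda>s. x (s + a)" _ t] ac_simps)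
  then show "continuous (at_right t) (\<lambda>t. x (a + t) - x a)"
    by (auto simp: continuous_within add.commute intro!: tendsto_intros)
next
  fix t :: real assume t: "t > 0"
  then obtain l where l: "l \<le> x (a + t)" "(x \<longlongrightarrow> l) (at_left (a + t))"
    using no_neg_jump_path_left[OF x, of "a + t"] a by auto
  have "filterlim (\<lambda>s. a + s) (at_left (a + t)) (at_left t)"
    unfolding filterlim_at by (auto simp: eventually_at_filter intro!: tendsto_eq_intros)
  then have "((\<lambda>s. x (a + s)) \<longlongrightarrow> l) (at_left t)"
    using l(2) by (rule filterlim_compose[rotated])
  then have "((\<lambda>s. x (a + s) - x a) \<longlongrightarrow> l - x a) (at_left t)" by (intro tendsto_intros)
  then show "\<exists>l\<le>x (a + t) - x a. ((\<lambda>t. x (a + t) - x a) \<longlongrightarrow> l) (at_left t)"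
    using l by (intro exI[of _ "l - x a"]) auto
qed simp

lemma grid_max_rec:
  assumes "k < n"
  shows "grid_max x T n k = max (x (real k * (T / real n))) (grid_max x T n (Suc k))"
proof -
  have "{k..n} = insert k {Suc k..n}" using assms by auto
  then show ?thesis using assms by (simp add: grid_max_def)
qed

subsection \<open>The cyclic ballot identity for random walks\<close>

definition partial_sum :: "(nat \<Rightarrow> real) \<Rightarrow> nat \<Rightarrow> real" where
  "partial_sum x j = (\<Sum>i<j. x i)"

text \<open>This is the cycle lemma with the sizes of the decrements in place of their number. If
  \<open>P m \<ge> 0\<close>, the value \<open>P (r + m)\<close> one period later is at least
  \<open>P r\<close>, and no decrement is positive. If \<open>P m < 0\<close>, that later value lies
  below \<open>P r\<close> and does not affect the maximum from \<open>r\<close> on, so the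
  decrement is \<open>J r - J (Suc r)\<close> with \<open>J\<close> the maximum over one period; the
  sum telescopes and \<open>J m = J 0 + P m\<close>.\<close>

lemma cyclic_decrement_sum:
  fixes x :: "nat \<Rightarrow> real"
  assumes m: "0 < m"
  defines "P \<equiv> \<lambda>j. \<Sum>i<j. x (i mod m)"
  shows "(\<Sum>r<m. max 0 (P r - Max (P ` {Suc r..r + m}))) = max 0 (- P m)"
proof -
  have per: "P (r + m) = P r + P m" for r
    by (induction r) (auto simp: P_def)
  have upper: "P (r + m) \<le> Max (P ` {Suc r..r + m})" for r
    using m by (intro Max_ge) auto
  show ?thesis
  proof (cases "P m \<ge> 0")
    case True
    then have "max 0 (P r - Max (P ` {Suc r..r + m})) = 0" for r
      using per[of r] upper[of r] by auto
    then show ?thesis using True by simp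
  next
    case False
    define J where "J k = Max (P ` {k..<k + m})" for k
    have "max 0 (P r - Max (P ` {Suc r..r + m})) = J r - J (Suc r)" for r
    proof -
      have JS: "J (Suc r) = Max (P ` {Suc r..r + m})"
        unfolding J_def by (simp add: atLeastLessThanSuc_atLeastAtMost)
      have "max (P r) (J (Suc r)) = Max (insert (P r) (P ` {Suc r..r + m}))"
        using m by (simp add: JS Max_insert)
      also have "insert (P r) (P ` {Suc r..r + m}) = P ` {r..r+m}"
        by (auto simp: image_iff Bex_def not_less_eq_eq) (metis le_antisym not_less_eq_eq)
      also have "{r..r+m} = insert (r + m) {r..<r + m}" by auto
      also have "Max (P ` insert (r + m) {r..<r + m}) = max (P (r + m)) (J r)"
        using m by (simp add: J_def)
      also have "\<dots> = J r"
      proof -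
        have "P r \<le> J r" unfolding J_def using m by (intro Max_ge) auto
        then show ?thesis using per[of r] False by auto
      qed
      finally show ?thesis using JS by auto
    qed
    then have "(\<Sum>r<m. max 0 (P r - Max (P ` {Suc r..r + m}))) = (\<Sum>r<m. J r - J (Suc r))"
      by simp
    also have "\<dots> = J 0 - J m" by (induction m) auto
    also have "J m = J 0 + P m"
    proof -
      have "P ` {m..<m + m} = (\<lambda>y. P m + y) ` P ` {0..<m}"
      proof -
        have "{m..<m + m} = (\<lambda>j. j + m) ` {0..<m}" by simp
        then show ?thesis by (simp add: image_image per add.commute del: image_add_atLeastLessThan')
      qed
      then show ?thesis
        unfolding J_def using m by (simp add: mono_Max_commute[symmetric, of "\<lambda>y. P m + y"] mono_def)
    qed
    finally show ?thesis using False by simp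
  qed
qed

text \<open>Fixing the first \<open>k\<close> steps and rotating the others leaves the partial sums
  at \<open>k\<close> and \<open>n\<close> unchanged, and these are the only quantities that enter
  the test function.\<close>

definition rotate_tail :: "nat \<Rightarrow> nat \<Rightarrow> nat \<Rightarrow> nat \<Rightarrow> nat" where
  "rotate_tail k n r i = (if i < k then i else k + (i - k + r) mod (n - k))"

lemma rotate_tail_inj: "inj_on (rotate_tail k n r) {..<n}"
proof (rule inj_onI)
  fix i j assume ij: "i \<in> {..<n}" "j \<in> {..<n}" "rotate_tail k n r i = rotate_tail k n r j"
  show "i = j"
  proof (cases "i < k \<or> j < k")
    case True
    then show ?thesis using ij by (auto simp: rotate_tail_def split: if_splits)
  next
    case False
    then have "(i - k + r) mod (n - k) = (j - k + r) mod (n - k)" "i - k < n - k" "j - k < n - k"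
      using ij by (auto simp: rotate_tail_def)
    then obtain q1 q2 where "i - k + r + (n - k) * q1 = j - k + r + (n - k) * q2"
      unfolding nat_mod_eq_iff by blast
    then have "(i - k + (n - k) * q1) mod (n - k) = (j - k + (n - k) * q2) mod (n - k)" by simp
    then have "i - k = j - k" using \<open>i - k < n - k\<close> \<open>j - k < n - k\<close> by simp
    then show ?thesis using False by linarith
  qed
qed

lemma rotate_tail_into: "rotate_tail k n r \<in> {..<n} \<rightarrow> {..<n}"
proof
  fix i assume "i \<in> {..<n}"
  then show "rotate_tail k n r i \<in> {..<n}"
  proof (cases "i < k")
    case False
    then have "(i - k + r) mod (n - k) < n - k" using \<open>i \<in> {..<n}\<close> by (intro mod_less_divisor) auto
    then show ?thesis using False by (auto simp: rotate_tail_def)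
  qed (auto simp: rotate_tail_def)
qed

text \<open>The rotated tail reads the periodic extension of the original tail from position
  \<open>r\<close> on, so its partial sums are increments of \<open>P\<close> after
  \<open>r\<close>.\<close>

lemma rotate_tail_partial_sum:
  fixes x :: "nat \<Rightarrow> real"
  assumes "k < n"
  defines "P \<equiv> \<lambda>j. \<Sum>i<j. x (k + i mod (n - k))"
  shows "j \<le> k \<Longrightarrow> (\<Sum>i<j. x (rotate_tail k n r i)) = (\<Sum>i<j. x i)"
    and "(\<Sum>i<k + j. x (rotate_tail k n r i)) = (\<Sum>i<k. x i) + (P (r + j) - P r)"
proof -
  show 1: "(\<Sum>i<j. x (rotate_tail k n r i)) = (\<Sum>i<j. x i)" if "j \<le> k" for j
    using that by (intro sum.cong) (auto simp: rotate_tail_def)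
  show "(\<Sum>i<k + j. x (rotate_tail k n r i)) = (\<Sum>i<k. x i) + (P (r + j) - P r)"
  proof (induction j)
    case 0
    then show ?case using 1[of k] by simp
  next
    case (Suc j)
    then show ?case by (simp add: P_def rotate_tail_def add.commute)
  qed
qed

text \<open>Up to a constant, the rotated walks see the windows \<open>{Suc r..r + m}\<close> of one
  walk with periodic steps, to which the cycle lemma applies, while their values at \<open>k\<close>
  and \<open>n\<close> do not move.\<close>

lemma rotate_tail_decrement_sum:
  fixes x :: "nat \<Rightarrow> real"
  assumes k: "k < n"
  shows "(\<Sum>r<n - k. max 0 (partial_sum (\<lambda>i. x (rotate_tail k n r i)) k - Max (partial_sum (\<lambda>i. x (rotate_tail k n r i)) ` {Suc k..n})))
     = max 0 (partial_sum x k - partial_sum x n)"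
    and "partial_sum (\<lambda>i. x (rotate_tail k n r i)) k = partial_sum x k" "partial_sum (\<lambda>i. x (rotate_tail k n r i)) n = partial_sum x n"
proof -
  define m where "m = n - k"
  have m: "0 < m" "n = k + m" using k by (auto simp: m_def)
  define P where "P j = (\<Sum>i<j. x (k + i mod m))" for j
  have Sr: "partial_sum (\<lambda>i. x (rotate_tail k n r i)) (k + j) = partial_sum x k + (P (r + j) - P r)" for r j
    unfolding partial_sum_def P_def m_def by (rule rotate_tail_partial_sum(2)[OF k])
  show Sk: "partial_sum (\<lambda>i. x (rotate_tail k n r i)) k = partial_sum x k" for r
    unfolding partial_sum_def by (rule rotate_tail_partial_sum(1)[OF k order_refl])
  have per: "P (r + m) = P r + P m" for r
    by (induction r) (auto simp: P_def)
  have "P j = partial_sum x (k + j) - partial_sum x k" if "j \<le> m" for j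
    using that
  proof (induction j)
    case 0 then show ?case by (simp add: P_def)
  next
    case (Suc j)
    then have "P j = partial_sum x (k + j) - partial_sum x k" by simp
    then show ?case using Suc.prems by (simp add: P_def partial_sum_def)
  qed
  then have Pm: "P m = partial_sum x n - partial_sum x k" using m by simp
  show "partial_sum (\<lambda>i. x (rotate_tail k n r i)) n = partial_sum x n"
    using Sr[of r m] per[of r] Pm m by simp
  have "max 0 (partial_sum (\<lambda>i. x (rotate_tail k n r i)) k - Max (partial_sum (\<lambda>i. x (rotate_tail k n r i)) ` {Suc k..n}))
    = max 0 (P r - Max (P ` {Suc r..r + m}))" for r
  proof -
    have "{Suc k..n} = (+) k ` {Suc 0..m}" using m by simp
    then have "partial_sum (\<lambda>i. x (rotate_tail k n r i)) ` {Suc k..n} = (\<lambda>j. partial_sum x k + (P (r + j) - P r)) ` {Suc 0..m}"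
      by (simp add: image_image Sr del: image_add_atLeastAtMost)
    also have "\<dots> = (\<lambda>y. partial_sum x k - P r + y) ` P ` ((+) r ` {Suc 0..m})"
      unfolding image_image by (intro image_cong) (auto simp: algebra_simps)
    also have "(+) r ` {Suc 0..m} = {Suc r..r + m}" by simp
    finally have "Max (partial_sum (\<lambda>i. x (rotate_tail k n r i)) ` {Suc k..n}) = partial_sum x k - P r + Max (P ` {Suc r..r + m})"
      using m by (simp add: mono_Max_commute[symmetric, of "\<lambda>y. partial_sum x k - P r + y"] mono_def)
    then show ?thesis using Sk by simp
  qed
  then have "(\<Sum>r<n - k. max 0 (partial_sum (\<lambda>i. x (rotate_tail k n r i)) k - Max (partial_sum (\<lambda>i. x (rotate_tail k n r i)) ` {Suc k..n})))
    = (\<Sum>r<m. max 0 (P r - Max (P ` {Suc r..r + m})))" by (simp add: m_def)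
  also have "\<dots> = max 0 (- P m)"
    unfolding P_def using cyclic_decrement_sum[OF m(1), of "\<lambda>i. x (k + i)"] by simp
  finally show "(\<Sum>r<n - k. max 0 (partial_sum (\<lambda>i. x (rotate_tail k n r i)) k - Max (partial_sum (\<lambda>i. x (rotate_tail k n r i)) ` {Suc k..n})))
     = max 0 (partial_sum x k - partial_sum x n)" using Pm by simp
qed

lemma partial_sum_measurable [measurable]:
  "j \<le> n \<Longrightarrow> (\<lambda>x. partial_sum x j) \<in> borel_measurable (PiM {..<n} (\<lambda>_. borel))"
  unfolding partial_sum_def by (intro borel_measurable_sum measurable_component_singleton) auto

text \<open>Independent identically distributed steps are exchangeable, so each of the
  \<open>n - k\<close> rotations of the tail gives the same integral. When these are summed, the
  test function factors out and the decrements add up to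
  \<open>max 0 (partial_sum x k - partial_sum x n)\<close>.\<close>

lemma cyclic_ballot_identity:
  fixes \<mu> :: "real measure" and F :: "real \<times> real \<Rightarrow> ennreal"
  assumes \<mu>: "prob_space \<mu>" "sets \<mu> = sets borel" and k: "k < n"
    and F [measurable]: "F \<in> borel_measurable borel"
  shows "(\<integral>\<^sup>+x. ennreal (max 0 (partial_sum x k - Max (partial_sum x ` {Suc k..n}))) * F (partial_sum x k, partial_sum x k - partial_sum x n) \<partial>PiM {..<n} (\<lambda>_. \<mu>))
    = (\<integral>\<^sup>+x. ennreal (max 0 (partial_sum x k - partial_sum x n) / real (n - k)) * F (partial_sum x k, partial_sum x k - partial_sum x n) \<partial>PiM {..<n} (\<lambda>_. \<mu>))"
    (is "?L = ?R")
proof -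
  define N where "N = PiM {..<n} (\<lambda>_. \<mu>)"
  have sN: "sets N = sets (PiM {..<n} (\<lambda>_. borel))"
    unfolding N_def by (intro sets_PiM_cong) (auto simp: \<mu>)
  have [measurable]: "(\<lambda>x. partial_sum x j) \<in> borel_measurable N" if "j \<le> n" for j
    unfolding measurable_cong_sets[OF sN refl] by (rule partial_sum_measurable[OF that])
  have [measurable]: "(\<lambda>x. partial_sum x k) \<in> borel_measurable N" "(\<lambda>x. partial_sum x n) \<in> borel_measurable N"
    using k by (auto intro: \<open>\<And>j. j \<le> n \<Longrightarrow> (\<lambda>x. partial_sum x j) \<in> borel_measurable N\<close>)
  have [measurable]: "(\<lambda>x. Max (partial_sum x ` {Suc k..n})) \<in> borel_measurable N"
    by (rule borel_measurable_Max) auto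
  define H where "H x = ennreal (max 0 (partial_sum x k - Max (partial_sum x ` {Suc k..n}))) * F (partial_sum x k, partial_sum x k - partial_sum x n)" for x
  have H [measurable]: "H \<in> borel_measurable N" unfolding H_def by measurable
  \<comment> \<open>Reindexing acts on the product space through restricted functions, while the
    rotation lemma speaks about unrestricted ones; \<open>H\<close> reads only coordinates below
    \<open>n\<close>.\<close>
  have restr: "H (\<lambda>i\<in>{..<n}. x (rotate_tail k n r i)) = H (\<lambda>i. x (rotate_tail k n r i))" for x r
  proof -
    have *: "partial_sum (\<lambda>i\<in>{..<n}. x (rotate_tail k n r i)) j = partial_sum (\<lambda>i. x (rotate_tail k n r i)) j" if "j \<le> n" for j
      unfolding partial_sum_def using that by (intro sum.cong) auto
    then have "partial_sum (\<lambda>i\<in>{..<n}. x (rotate_tail k n r i)) ` {Suc k..n} = partial_sum (\<lambda>i. x (rotate_tail k n r i)) ` {Suc k..n}"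
      by (intro image_cong) auto
    with * show ?thesis unfolding H_def using k by simp
  qed
  have T [measurable]: "(\<lambda>x. \<lambda>i\<in>{..<n}. x (rotate_tail k n r i)) \<in> measurable N N" for r
    unfolding N_def using rotate_tail_into[of k n r] by (intro measurable_restrict measurable_component_singleton) auto
  have meas_rot: "(\<lambda>x. H (\<lambda>i. x (rotate_tail k n r i))) \<in> borel_measurable N" for r
    using measurable_compose[OF T H] by (simp add: restr)
  have inv: "(\<integral>\<^sup>+x. H x \<partial>N) = (\<integral>\<^sup>+x. H (\<lambda>i. x (rotate_tail k n r i)) \<partial>N)" for r
  proof -
    have D: "distr N N (\<lambda>x. \<lambda>i\<in>{..<n}. x (rotate_tail k n r i)) = N"
      unfolding N_def by (rule distr_PiM_reindex[of "{..<n}" "\<lambda>_. \<mu>"]) (auto simp: \<mu> rotate_tail_inj rotate_tail_into)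
    have "(\<integral>\<^sup>+x. H x \<partial>distr N N (\<lambda>x. \<lambda>i\<in>{..<n}. x (rotate_tail k n r i))) = (\<integral>\<^sup>+x. H (\<lambda>i. x (rotate_tail k n r i)) \<partial>N)"
      by (subst nn_integral_distr) (auto simp: restr)
    then show ?thesis by (simp only: D)
  qed
  have "of_nat (n - k) * (\<integral>\<^sup>+x. H x \<partial>N) = (\<Sum>r<n - k. \<integral>\<^sup>+x. H x \<partial>N)" by simp
  also have "\<dots> = (\<Sum>r<n - k. \<integral>\<^sup>+x. H (\<lambda>i. x (rotate_tail k n r i)) \<partial>N)"
    by (intro sum.cong refl inv)
  also have "\<dots> = (\<integral>\<^sup>+x. (\<Sum>r<n - k. H (\<lambda>i. x (rotate_tail k n r i))) \<partial>N)"
    by (intro nn_integral_sum[symmetric] meas_rot)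
  also have "\<dots> = (\<integral>\<^sup>+x. ennreal (max 0 (partial_sum x k - partial_sum x n)) * F (partial_sum x k, partial_sum x k - partial_sum x n) \<partial>N)"
  proof (intro nn_integral_cong)
    fix x
    note R = rotate_tail_decrement_sum[OF k, of x]
    have "(\<Sum>r<n - k. H (\<lambda>i. x (rotate_tail k n r i))) =
      (\<Sum>r<n - k. ennreal (max 0 (partial_sum (\<lambda>i. x (rotate_tail k n r i)) k - Max (partial_sum (\<lambda>i. x (rotate_tail k n r i)) ` {Suc k..n}))))
        * F (partial_sum x k, partial_sum x k - partial_sum x n)"
      unfolding H_def by (simp only: R(2,3) sum_distrib_right)
    also have "\<dots> = ennreal (max 0 (partial_sum x k - partial_sum x n)) * F (partial_sum x k, partial_sum x k - partial_sum x n)"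
      by (subst sum_ennreal) (auto simp: R(1))
    finally show "(\<Sum>r<n - k. H (\<lambda>i. x (rotate_tail k n r i))) = ennreal (max 0 (partial_sum x k - partial_sum x n)) * F (partial_sum x k, partial_sum x k - partial_sum x n)" .
  qed
  also have "\<dots> = (\<integral>\<^sup>+x. of_nat (n - k) * (ennreal (max 0 (partial_sum x k - partial_sum x n) / real (n - k)) * F (partial_sum x k, partial_sum x k - partial_sum x n)) \<partial>N)"
  proof (intro nn_integral_cong)
    fix x
    have "ennreal (max 0 (partial_sum x k - partial_sum x n)) = of_nat (n - k) * ennreal (max 0 (partial_sum x k - partial_sum x n) / real (n - k))"
      using k by (simp add: ennreal_of_nat_eq_real_of_nat ennreal_mult[symmetric])
    then show "ennreal (max 0 (partial_sum x k - partial_sum x n)) * F (partial_sum x k, partial_sum x k - partial_sum x n) =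
      of_nat (n - k) * (ennreal (max 0 (partial_sum x k - partial_sum x n) / real (n - k)) * F (partial_sum x k, partial_sum x k - partial_sum x n))"
      by (simp add: mult.assoc)
  qed
  also have "\<dots> = of_nat (n - k) * ?R"
    unfolding N_def[symmetric] by (intro nn_integral_cmult) measurable
  finally have "of_nat (n - k) * (\<integral>\<^sup>+x. H x \<partial>N) = of_nat (n - k) * ?R" .
  \<comment> \<open>The integral may be infinite; the factor \<open>n - k\<close> can be cancelled
    all the same, being finite and nonzero.\<close>
  then have "(\<integral>\<^sup>+x. H x \<partial>N) = ?R"
    using k by (subst (asm) ennreal_mult_cancel_left) (auto simp: of_nat_eq_0_iff)
  then show ?thesis unfolding H_def N_def .
qed

section \<open>Spectrally positive processes and the walks sampled from them\<close>

locale spectrally_positive_levy = prob_space M for M :: "'a measure" +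
  fixes X :: "real \<Rightarrow> 'a \<Rightarrow> real"
  assumes meas: "0 \<le> t \<Longrightarrow> X t \<in> borel_measurable M"
    and regular_path: "\<omega> \<in> space M \<Longrightarrow> no_neg_jump_path (\<lambda>t. X t \<omega>)"
    and indep: "0 \<le> \<tau> 0 \<Longrightarrow> (\<And>i. i < n \<Longrightarrow> \<tau> i \<le> \<tau> (Suc i)) \<Longrightarrow>
      indep_vars (\<lambda>_. borel) (\<lambda>i \<omega>. X (\<tau> (Suc i)) \<omega> - X (\<tau> i) \<omega>) {..<n}"
    and stat: "0 \<le> s \<Longrightarrow> 0 \<le> h \<Longrightarrow> distr M borel (\<lambda>\<omega>. X (s + h) \<omega> - X s \<omega>) = distr M borel (X h)"
begin

text \<open>The locale constrains \<open>X t\<close> only for \<open>t \<ge> 0\<close>, hence \<open>X (max 0 s)\<close> wherever joint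
  measurability in the time argument is needed.\<close>

abbreviation path :: "'a \<Rightarrow> real \<Rightarrow> real" where
  "path \<omega> \<equiv> \<lambda>t. X t \<omega>"

abbreviation gap :: "real \<Rightarrow> real \<Rightarrow> 'a \<Rightarrow> real \<times> real" where
  "gap T s \<omega> \<equiv> (X (max 0 s) \<omega>, X (max 0 s) \<omega> - X T \<omega>)"

abbreviation drop_rate :: "real \<Rightarrow> real \<Rightarrow> 'a \<Rightarrow> real" where
  "drop_rate T s \<omega> \<equiv> max 0 (X (max 0 s) \<omega> - X T \<omega>) / (T - s)"

text \<open>The event is that the path exceeds \<open>v\<close> during \<open>{a..T}\<close> but
  ends below \<open>v\<close>; the weight \<phi> is evaluated at the depth below \<open>v\<close> at
  the end.\<close>

abbreviation hit :: "(real \<Rightarrow> real) \<Rightarrow> real \<Rightarrow> real \<Rightarrow> real \<Rightarrow> 'a \<Rightarrow> ennreal" where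
  "hit \<phi> a T v \<omega> \<equiv> ennreal (\<phi> (v - X T \<omega>)) * indicator {X T \<omega><..<path_sup (\<lambda>t. X t \<omega>) a T} v"

definition grid_incr :: "real \<Rightarrow> real \<Rightarrow> 'a \<Rightarrow> nat \<Rightarrow> real" where
  "grid_incr a h \<omega> i = X (a + real (Suc i) * h) \<omega> - X (a + real i * h) \<omega>"

lemma X0: "\<omega> \<in> space M \<Longrightarrow> X 0 \<omega> = 0"
  using regular_path by (auto simp: no_neg_jump_path_def)

lemma grid_incr_meas: "0 \<le> a \<Longrightarrow> 0 \<le> h \<Longrightarrow> (\<lambda>\<omega>. grid_incr a h \<omega> i) \<in> borel_measurable M"
  unfolding grid_incr_def by (intro borel_measurable_diff meas) auto

lemma sum_incr: "(\<Sum>i<j. grid_incr a h \<omega> i) = X (a + real j * h) \<omega> - X a \<omega>"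
  unfolding grid_incr_def using sum_lessThan_telescope[of "\<lambda>i. X (a + real i * h) \<omega>" j] by simp

lemma grid_incr_distr:
  assumes a: "0 \<le> a" and h: "0 \<le> h" and n: "0 < n"
  shows "distr M (PiM {..<n} (\<lambda>_. borel)) (\<lambda>\<omega>. \<lambda>i\<in>{..<n}. grid_incr a h \<omega> i) = PiM {..<n} (\<lambda>_. distr M borel (X h))"
proof -
  have "indep_vars (\<lambda>_. borel) (\<lambda>i \<omega>. grid_incr a h \<omega> i) {..<n}"
    unfolding grid_incr_def using indep[of "\<lambda>i. a + real i * h" n] a h
    by (simp add: algebra_simps)
  then have "distr M (PiM {..<n} (\<lambda>_. borel)) (\<lambda>\<omega>. \<lambda>i\<in>{..<n}. grid_incr a h \<omega> i) =
     PiM {..<n} (\<lambda>i. distr M borel (\<lambda>\<omega>. grid_incr a h \<omega> i))"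
    using n grid_incr_meas[OF a h] by (subst (asm) indep_vars_iff_distr_eq_PiM') auto
  moreover have "distr M borel (\<lambda>\<omega>. grid_incr a h \<omega> i) = distr M borel (X h)" for i
    using stat[of "a + real i * h" h] a h by (simp add: grid_incr_def algebra_simps)
  ultimately show ?thesis by simp
qed

lemma grid_max_meas [measurable]:
  assumes "0 \<le> T"
  shows "(\<lambda>\<omega>. grid_max (path \<omega>) T n k) \<in> borel_measurable M"
  unfolding grid_max_def by (intro borel_measurable_Max meas) (use assms in auto)

text \<open>The values on the grid form a walk with i.i.d. steps. The future maximum at
  \<open>k\<close> is the larger of the value there and the next future maximum, so its decrement is
  the positive part that occurs in \<open>cyclic_ballot_identity\<close>.\<close>

lemma discrete_ballot:
  fixes F :: "real \<times> real \<Rightarrow> ennreal"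
  assumes T: "0 < T" and k: "k < n" and F [measurable]: "F \<in> borel_measurable borel"
  defines "h \<equiv> T / real n"
  shows "(\<integral>\<^sup>+\<omega>. ennreal (grid_max (path \<omega>) T n k - grid_max (path \<omega>) T n (Suc k))
         * F (X (real k * h) \<omega>, X (real k * h) \<omega> - X T \<omega>) \<partial>M)
    = (\<integral>\<^sup>+\<omega>. ennreal (max 0 (X (real k * h) \<omega> - X T \<omega>) / real (n - k))
         * F (X (real k * h) \<omega>, X (real k * h) \<omega> - X T \<omega>) \<partial>M)"
proof -
  have h: "0 \<le> h" and nh: "real n * h = T" using T k by (auto simp: h_def)
  define \<xi> where "\<xi> \<omega> = (\<lambda>i\<in>{..<n}. grid_incr 0 h \<omega> i)" for \<omega>
  have SX: "partial_sum (\<xi> \<omega>) j = X (real j * h) \<omega>" if "j \<le> n" "\<omega> \<in> space M" for j \<omega>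
  proof -
    have "partial_sum (\<xi> \<omega>) j = (\<Sum>i<j. grid_incr 0 h \<omega> i)"
      unfolding partial_sum_def \<xi>_def using that by (intro sum.cong) auto
    then show ?thesis using that X0 by (simp add: sum_incr)
  qed
  have gm: "grid_max (path \<omega>) T n k - grid_max (path \<omega>) T n (Suc k)
      = max 0 (partial_sum (\<xi> \<omega>) k - Max (partial_sum (\<xi> \<omega>) ` {Suc k..n}))" if "\<omega> \<in> space M" for \<omega>
  proof -
    have "partial_sum (\<xi> \<omega>) ` {Suc k..n} = (\<lambda>j. X (real j * h) \<omega>) ` {Suc k..n}"
      using SX that by (intro image_cong) auto
    then have "grid_max (path \<omega>) T n (Suc k) = Max (partial_sum (\<xi> \<omega>) ` {Suc k..n})"
      by (simp add: grid_max_def h_def)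
    then show ?thesis
      using grid_max_rec[OF k, of "\<lambda>t. X t \<omega>" T] SX[of k \<omega>] that k by (auto simp: h_def)
  qed
  let ?P = "PiM {..<n} (\<lambda>_. borel :: real measure)"
  have \<xi>m [measurable]: "\<xi> \<in> measurable M ?P"
    unfolding \<xi>_def by (intro measurable_restrict grid_incr_meas) (use h in auto)
  have [measurable]: "(\<lambda>x. partial_sum x k) \<in> borel_measurable ?P" "(\<lambda>x. partial_sum x n) \<in> borel_measurable ?P"
    "(\<lambda>x. Max (partial_sum x ` {Suc k..n})) \<in> borel_measurable ?P"
    using k by (auto intro!: partial_sum_measurable borel_measurable_Max)
  have D: "distr M ?P \<xi> = PiM {..<n} (\<lambda>_. distr M borel (X h))"
    unfolding \<xi>_def using h k by (intro grid_incr_distr) auto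
  have "prob_space (distr M borel (X h))" using meas[OF h] by (rule prob_space_distr)
  note I = cyclic_ballot_identity[OF this _ k F, folded D]
  have "(\<integral>\<^sup>+\<omega>. ennreal (max 0 (partial_sum (\<xi> \<omega>) k - Max (partial_sum (\<xi> \<omega>) ` {Suc k..n}))) * F (partial_sum (\<xi> \<omega>) k, partial_sum (\<xi> \<omega>) k - partial_sum (\<xi> \<omega>) n) \<partial>M)
    = (\<integral>\<^sup>+\<omega>. ennreal (max 0 (partial_sum (\<xi> \<omega>) k - partial_sum (\<xi> \<omega>) n) / real (n - k)) * F (partial_sum (\<xi> \<omega>) k, partial_sum (\<xi> \<omega>) k - partial_sum (\<xi> \<omega>) n) \<partial>M)"
    using I by (simp add: nn_integral_distr)
  then show ?thesis
    using k by (simp add: gm SX nh cong: nn_integral_cong_simp)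
qed

end

subsection \<open>From grids to continuous time\<close>

text \<open>Indicators of bounded open sets are increasing limits of the functions
  \<open>min 1 (m * infdist x (- U))\<close>, and these sets are stable under intersection and
  generate the Borel sets. Lipschitz functions with bounded support are the ones that pass through
  the grid limits. Finiteness is asked only on bounded sets because a measure over levels can have
  infinite mass.\<close>

lemma borel_measure_eqI_lipschitz:
  fixes N1 N2 :: "'b::euclidean_space measure"
  assumes sets: "sets N1 = sets borel" "sets N2 = sets borel"
    and eq: "\<And>F L. L-lipschitz_on UNIV F \<Longrightarrow> (\<And>x. 0 \<le> F x) \<Longrightarrow> (\<And>x. F x \<le> 1) \<Longrightarrow> bounded {x. F x \<noteq> 0} \<Longrightarrow>
       (\<integral>\<^sup>+x. ennreal (F x) \<partial>N1) = (\<integral>\<^sup>+x. ennreal (F x) \<partial>N2)"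
    and fin: "\<And>U. bounded U \<Longrightarrow> open U \<Longrightarrow> emeasure N1 U \<noteq> \<infinity>"
  shows "N1 = N2"
proof (rule measure_eqI_generator_eq[where E="{U. open U \<and> bounded U}" and \<Omega>=UNIV and A="\<lambda>i. ball 0 (real i)"])
  let ?E = "{U :: 'b set. open U \<and> bounded U}"
  show "Int_stable ?E" by (auto simp: Int_stable_def intro: open_Int bounded_subset)
  have "sigma_sets UNIV ?E = sigma_sets UNIV (Collect open)"
  proof (rule sigma_sets_eqI)
    fix U :: "'b set" assume "U \<in> Collect open"
    then have "U = (\<Union>i::nat. U \<inter> ball 0 (real i))" "open U"
      using reals_Archimedean2 by (auto simp: dist_norm)
    moreover have "(\<Union>i::nat. U \<inter> ball 0 (real i)) \<in> sigma_sets UNIV ?E"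
      by (rule sigma_sets.Union) (use \<open>open U\<close> in \<open>auto intro!: sigma_sets.Basic open_Int intro: bounded_subset[OF bounded_ball]\<close>)
    ultimately show "U \<in> sigma_sets UNIV ?E" by simp
  qed (auto intro: sigma_sets.Basic)
  then show "sets N1 = sigma_sets UNIV ?E" "sets N2 = sigma_sets UNIV ?E"
    unfolding sets by (simp_all add: borel_def)
  fix U :: "'b set" assume "U \<in> ?E"
  then have U: "open U" "bounded U" by auto
  \<comment> \<open>A nonempty complement is essential: the distance to an empty set is 0 by
    convention, and \<open>f\<close> would vanish instead of increasing to 1.\<close>
  then have ne: "- U \<noteq> {}" using not_bounded_UNIV by (metis double_complement Compl_empty_eq)
  define f where "f m x = min 1 (real m * infdist x (- U))" for m :: nat and x
  have lip: "(real m)-lipschitz_on UNIV (f m)" for m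
  proof (rule lipschitz_onI)
    fix x y
    have "\<bar>f m x - f m y\<bar> \<le> \<bar>real m * infdist x (- U) - real m * infdist y (- U)\<bar>" by (auto simp: f_def)
    also have "\<dots> = real m * \<bar>infdist x (- U) - infdist y (- U)\<bar>"
      by (simp add: abs_mult flip: right_diff_distrib)
    also have "\<dots> \<le> real m * dist x y" by (intro mult_left_mono infdist_triangle_abs) auto
    finally show "dist (f m x) (f m y) \<le> real m * dist x y" by (simp add: dist_real_def)
  qed simp
  have f0: "0 \<le> f m x" "f m x \<le> 1" for m x by (auto simp: f_def infdist_nonneg)
  have "{x. f m x \<noteq> 0} \<subseteq> U" for m
  proof
    fix x assume "x \<in> {x. f m x \<noteq> 0}"
    then show "x \<in> U" by (cases "x \<in> U") (auto simp: f_def infdist_zero)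
  qed
  then have bd: "bounded {x. f m x \<noteq> 0}" for m using U(2) bounded_subset by blast
  have [measurable]: "f m \<in> borel_measurable borel" for m
    using lipschitz_on_continuous_on[OF lip] by (rule borel_measurable_continuous_onI)
  have sup: "(SUP m. ennreal (f m x)) = indicator U x" for x
  proof (cases "x \<in> U")
    case False
    then show ?thesis by (simp add: f_def infdist_zero)
  next
    case True
    have pos: "infdist x (- U) > 0"
      using True U ne infdist_nonneg[of x "- U"] in_closed_iff_infdist_zero[of "- U" x]
      by (auto simp: closed_Compl less_le)
    then obtain m where m: "1 < real m * infdist x (- U)" using reals_Archimedean3 by blast
    have "(SUP m. ennreal (f m x)) = 1"
    proof (rule antisym)
      show "(SUP m. ennreal (f m x)) \<le> 1" using f0 by (intro SUP_least) (auto simp: ennreal_le_1)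
      have "f m x = 1" using m by (simp add: f_def)
      then show "1 \<le> (SUP m. ennreal (f m x))" by (intro SUP_upper2[of m]) auto
    qed
    then show ?thesis using True by simp
  qed
  have inc: "incseq (\<lambda>m x. ennreal (f m x))"
    unfolding incseq_def le_fun_def f_def
    by (intro allI impI ennreal_leI min.mono mult_right_mono) (auto simp: infdist_nonneg)
  have "emeasure N U = (SUP m. \<integral>\<^sup>+x. ennreal (f m x) \<partial>N)" if "sets N = sets borel" for N
  proof -
    have [measurable_cong]: "sets N = sets borel" by fact
    have "emeasure N U = (\<integral>\<^sup>+x. indicator U x \<partial>N)" using U that by simp
    also have "\<dots> = (\<integral>\<^sup>+x. (SUP m. ennreal (f m x)) \<partial>N)" by (simp add: sup)
    also have "\<dots> = (SUP m. \<integral>\<^sup>+x. ennreal (f m x) \<partial>N)"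
      by (rule nn_integral_monotone_convergence_SUP[OF inc]) measurable
    finally show ?thesis .
  qed
  then show "emeasure N1 U = emeasure N2 U"
    using eq[OF lip f0 bd] sets by simp
next
  show "(\<Union>i::nat. ball 0 (real i)) = (UNIV :: 'b set)" using reals_Archimedean2 by (auto simp: dist_norm)
qed (use fin in auto)

lemma no_neg_jump_path_right_LIMSEQ:
  assumes x: "no_neg_jump_path x" and s: "0 \<le> s" and \<sigma>: "\<sigma> \<longlonglongrightarrow> s" "\<And>n. s \<le> \<sigma> n"
  shows "(\<lambda>n. x (\<sigma> n)) \<longlonglongrightarrow> x s"
proof (rule tendstoI)
  fix e :: real assume e: "0 < e"
  have "\<forall>\<^sub>F t in at_right s. dist (x t) (x s) < e"
    using no_neg_jump_path_right[OF x s] e by (rule tendstoD)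
  then obtain d where d: "d > s" "\<And>t. s < t \<Longrightarrow> t < d \<Longrightarrow> dist (x t) (x s) < e"
    unfolding eventually_at_right_field by blast
  have "\<forall>\<^sub>F n in sequentially. \<sigma> n < d" using \<sigma>(1) d(1) by (rule order_tendstoD)
  then show "\<forall>\<^sub>F n in sequentially. dist (x (\<sigma> n)) (x s) < e"
  proof eventually_elim
    case (elim n)
    then show ?case using d(2)[of "\<sigma> n"] \<sigma>(2)[of n] e by (cases "\<sigma> n = s") auto
  qed
qed

text \<open>A decrement of the future maximum can be positive only if the path value at that grid
  point is the maximum. The sum is thus a Riemann sum for \<open>G\<close> over the levels between
  the two suprema, whose cells are shorter than \<eta> by the absence of negative jumps. The mean
  value theorem for an antiderivative \<Phi> bounds the error by \<open>L * \<eta>\<close> times the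
  total length.\<close>

lemma grid_riemann_LIMSEQ:
  fixes x G :: "real \<Rightarrow> real"
  assumes x: "no_neg_jump_path x" and b: "0 \<le> b" "b < T"
    and G: "\<And>v. 0 \<le> G v" "\<And>v w. \<bar>G v - G w\<bar> \<le> L * \<bar>v - w\<bar>"
  defines "K \<equiv> \<lambda>n. nat \<lfloor>b * real n / T\<rfloor>"
  shows "(\<lambda>n. ennreal (\<Sum>k\<in>{1..K n}. (grid_max x T n k - grid_max x T n (Suc k)) * G (x (real k * (T / real n)))))
     \<longlonglongrightarrow> (\<integral>\<^sup>+v. ennreal (G v) * indicator {path_sup x b T<..<path_sup x 0 T} v \<partial>lborel)"
proof -
  have T: "0 < T" using b by simp
  have L: "0 \<le> L" using G(2)[of 0 1] abs_ge_zero[of "G 0 - G 1"] by simp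
  have "L-lipschitz_on UNIV G" using G(2) L by (intro lipschitz_onI) (auto simp: dist_real_def)
  then have Gc: "continuous_on UNIV G" by (rule lipschitz_on_continuous_on)
  then have Gm [measurable]: "G \<in> borel_measurable borel" by (rule borel_measurable_continuous_onI)
  have "\<exists>\<Phi>. \<forall>v::real. -\<infinity> < ereal v \<longrightarrow> ereal v < \<infinity> \<longrightarrow> (\<Phi> has_vector_derivative G v) (at v)"
    using Gc by (intro einterval_antiderivative) (auto simp: continuous_on_eq_continuous_at)
  then obtain \<Phi> where \<Phi>: "\<And>v. (\<Phi> has_real_derivative G v) (at v)"
    by (auto simp: has_real_derivative_iff_has_vector_derivative)
  have \<Phi>c: "isCont \<Phi> v" for v using \<Phi> by (rule DERIV_isCont)
  define g where "g n k = grid_max x T n k" for n k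
  define S where "S n = (\<Sum>k\<in>{1..K n}. (g n k - g n (Suc k)) * G (x (real k * (T / real n))))" for n
  \<comment> \<open>For \<open>b = 0\<close> the floor index is 0 and the grid starts at
    \<open>Suc 0\<close>; this is why the sums run from \<open>k = 1\<close>.\<close>
  have lim0: "(\<lambda>n. g n (Suc 0)) \<longlonglongrightarrow> path_sup x 0 T"
    using grid_max_LIMSEQ[OF x order_refl T] by (simp add: g_def)
  have limb: "(\<lambda>n. g n (Suc (K n))) \<longlonglongrightarrow> path_sup x b T"
    using grid_max_LIMSEQ[OF x b] by (simp add: g_def K_def)
  have err: "\<forall>\<^sub>F n in sequentially. \<bar>S n - (\<Phi> (g n (Suc 0)) - \<Phi> (g n (Suc (K n))))\<bar> \<le> L * \<eta> * (g n (Suc 0) - g n (Suc (K n)))"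
    if \<eta>: "0 < \<eta>" for \<eta>
  proof -
    obtain d where d: "d > 0" "\<And>s t. 0 \<le> s \<Longrightarrow> s \<le> t \<Longrightarrow> t \<le> T \<Longrightarrow> t - s < d \<Longrightarrow> x s < x t + \<eta>"
      using no_neg_jump_path_unif[OF x \<eta>, of T] by auto
    obtain N where N: "\<And>n. n \<ge> N \<Longrightarrow> 0 < n \<and> T / real n < d" using ex_small_mesh[OF d(1), of T] by blast
    show ?thesis
    proof (rule eventually_sequentiallyI[of N])
      fix n assume "N \<le> n"
      then have n: "0 < n" "T / real n < d" using N by auto
      define h where "h = T / real n"
      have h: "0 < h" "real n * h = T" using n T by (auto simp: h_def)
      have Kn: "K n < n" unfolding K_def by (rule floor_index(1)[OF n(1) b])
      have step: "\<bar>(g n k - g n (Suc k)) * G (x (real k * h)) - (\<Phi> (g n k) - \<Phi> (g n (Suc k)))\<bar>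
          \<le> L * \<eta> * (g n k - g n (Suc k))" if k: "k \<in> {1..K n}" for k
      proof -
        have kn: "k < n" using k Kn by auto
        have rec: "g n k = max (x (real k * h)) (g n (Suc k))"
          unfolding g_def h_def by (rule grid_max_rec[OF kn])
        have "x (real (Suc k) * h) \<le> g n (Suc k)"
          unfolding g_def grid_max_def h_def using kn by (intro Max_ge image_eqI[of _ _ "Suc k"]) auto
        moreover have "x (real k * h) < x (real (Suc k) * h) + \<eta>"
        proof (rule d(2))
          have "real (Suc k) * h \<le> real n * h" using kn h by (intro mult_right_mono) auto
          then show "real (Suc k) * h \<le> T" using h by simp
        qed (use h n in \<open>auto simp: algebra_simps h_def[symmetric]\<close>)
        ultimately have small: "x (real k * h) - g n (Suc k) < \<eta>" by linarith
        show ?thesis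
        proof (cases "x (real k * h) \<le> g n (Suc k)")
          case True then show ?thesis using rec by simp
        next
          case False
          then have eq: "g n k = x (real k * h)" and lt: "g n (Suc k) < g n k" using rec by auto
          obtain z where z: "g n (Suc k) < z" "z < g n k"
            "\<Phi> (g n k) - \<Phi> (g n (Suc k)) = (g n k - g n (Suc k)) * G z"
            using MVT2[OF lt, of \<Phi> G] \<Phi> by auto
          have "\<bar>(g n k - g n (Suc k)) * G (x (real k * h)) - (\<Phi> (g n k) - \<Phi> (g n (Suc k)))\<bar>
            = (g n k - g n (Suc k)) * \<bar>G (g n k) - G z\<bar>"
            using lt by (simp add: z(3) eq[symmetric] abs_mult flip: right_diff_distrib)
          also have "\<bar>G (g n k) - G z\<bar> \<le> L * \<bar>g n k - z\<bar>" by (rule G(2))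
          also have "\<dots> \<le> L * \<eta>" using z small eq L by (intro mult_left_mono) auto
          finally show ?thesis using lt by (simp add: mult.commute mult_left_mono)
        qed
      qed
      have tel: "(\<Sum>k\<in>{1..m}. f k - f (Suc k)) = f (Suc 0) - f (Suc m)" for f :: "nat \<Rightarrow> real" and m
        by (induction m) auto
      have e: "\<Phi> (g n (Suc 0)) - \<Phi> (g n (Suc (K n))) = (\<Sum>k\<in>{1..K n}. \<Phi> (g n k) - \<Phi> (g n (Suc k)))"
        by (rule tel[of "\<lambda>k. \<Phi> (g n k)", symmetric])
      have "\<bar>S n - (\<Phi> (g n (Suc 0)) - \<Phi> (g n (Suc (K n))))\<bar> =
         \<bar>\<Sum>k\<in>{1..K n}. (g n k - g n (Suc k)) * G (x (real k * h)) - (\<Phi> (g n k) - \<Phi> (g n (Suc k)))\<bar>"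
        unfolding e S_def h_def by (subst sum_subtractf[symmetric]) (rule refl)
      also have "\<dots> \<le> (\<Sum>k\<in>{1..K n}. L * \<eta> * (g n k - g n (Suc k)))"
        by (rule order_trans[OF sum_abs sum_mono[OF step]])
      also have "\<dots> = L * \<eta> * (g n (Suc 0) - g n (Suc (K n)))"
        unfolding sum_distrib_left[symmetric] tel ..
      finally show "\<bar>S n - (\<Phi> (g n (Suc 0)) - \<Phi> (g n (Suc (K n))))\<bar> \<le> L * \<eta> * (g n (Suc 0) - g n (Suc (K n)))" .
    qed
  qed
  have "(\<lambda>n. S n - (\<Phi> (g n (Suc 0)) - \<Phi> (g n (Suc (K n))))) \<longlonglongrightarrow> 0"
  proof (rule tendstoI)
    fix e :: real assume e: "0 < e"
    define D where "D = path_sup x 0 T - path_sup x b T"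
    \<comment> \<open>The 1 added to \<open>\<bar>D\<bar>\<close> leaves room for the convergence of
      the total length; the outer 1 keeps the denominator positive when
      \<open>L = 0\<close>.\<close>
    define \<eta> where "\<eta> = e / (L * (\<bar>D\<bar> + 1) + 1)"
    have p: "0 < L * (\<bar>D\<bar> + 1) + 1" using L by (intro add_nonneg_pos) auto
    then have \<eta>: "0 < \<eta>" using e by (simp add: \<eta>_def)
    have "(\<lambda>n. g n (Suc 0) - g n (Suc (K n))) \<longlonglongrightarrow> D" unfolding D_def by (intro tendsto_diff lim0 limb)
    then have "\<forall>\<^sub>F n in sequentially. g n (Suc 0) - g n (Suc (K n)) < \<bar>D\<bar> + 1" by (rule order_tendstoD) auto
    then show "\<forall>\<^sub>F n in sequentially. dist (S n - (\<Phi> (g n (Suc 0)) - \<Phi> (g n (Suc (K n))))) 0 < e"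
      using err[OF \<eta>]
    proof eventually_elim
      case (elim n)
      have "L * \<eta> * (g n (Suc 0) - g n (Suc (K n))) \<le> L * \<eta> * (\<bar>D\<bar> + 1)"
        using elim(1) L \<eta> by (intro mult_left_mono) auto
      also have "\<dots> < \<eta> * (L * (\<bar>D\<bar> + 1) + 1)" using \<eta> by (simp add: algebra_simps)
      also have "\<dots> = e" using p by (simp add: \<eta>_def)
      finally show ?case using elim(2) by (simp add: dist_real_def)
    qed
  qed
  moreover have "(\<lambda>n. \<Phi> (g n (Suc 0)) - \<Phi> (g n (Suc (K n)))) \<longlonglongrightarrow> \<Phi> (path_sup x 0 T) - \<Phi> (path_sup x b T)"
    by (intro tendsto_diff isCont_tendsto_compose[OF \<Phi>c] lim0 limb)
  ultimately have "(\<lambda>n. S n - (\<Phi> (g n (Suc 0)) - \<Phi> (g n (Suc (K n)))) + (\<Phi> (g n (Suc 0)) - \<Phi> (g n (Suc (K n)))))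
     \<longlonglongrightarrow> 0 + (\<Phi> (path_sup x 0 T) - \<Phi> (path_sup x b T))" by (rule tendsto_add)
  then have "S \<longlonglongrightarrow> \<Phi> (path_sup x 0 T) - \<Phi> (path_sup x b T)" by simp
  then have "(\<lambda>n. ennreal (S n)) \<longlonglongrightarrow> ennreal (\<Phi> (path_sup x 0 T) - \<Phi> (path_sup x b T))" by (rule tendsto_ennrealI)
  also have "ennreal (\<Phi> (path_sup x 0 T) - \<Phi> (path_sup x b T)) =
      (\<integral>\<^sup>+v. ennreal (G v) * indicator {path_sup x b T..path_sup x 0 T} v \<partial>lborel)"
  proof (rule nn_integral_FTC_Icc[symmetric])
    show "path_sup x b T \<le> path_sup x 0 T"
      unfolding path_sup_def using b no_neg_jump_path_bdd[OF x, of 0 T] by (intro cSUP_subset_mono) auto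
  qed (use \<Phi> G in auto)
  also have "\<dots> = (\<integral>\<^sup>+v. ennreal (G v) * indicator {path_sup x b T<..<path_sup x 0 T} v \<partial>lborel)"
  proof (rule nn_integral_cong_AE)
    show "AE v in lborel. ennreal (G v) * indicator {path_sup x b T..path_sup x 0 T} v =
        ennreal (G v) * indicator {path_sup x b T<..<path_sup x 0 T} v"
      using AE_lborel_singleton[of "path_sup x b T"] AE_lborel_singleton[of "path_sup x 0 T"]
      by eventually_elim (auto simp: indicator_def)
  qed
  finally show ?thesis unfolding S_def g_def .
qed

text \<open>Since \<open>G\<close> vanishes above \<open>x T + C\<close> and every future maximum is
  at least \<open>x T\<close>, only levels in an interval of length \<open>C\<close> contribute:
  truncating the maxima at \<open>x T + C\<close> gives a telescoping majorant. The bound depends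
  neither on the path nor on the grid, as dominated convergence requires.\<close>

lemma grid_riemann_bound:
  fixes x G :: "real \<Rightarrow> real"
  assumes m: "m < n" and G: "\<And>v. 0 \<le> G v" "\<And>v. G v \<le> 1" "\<And>v. x T + C < v \<Longrightarrow> G v = 0" and C: "0 \<le> C"
  shows "(\<Sum>k\<in>{1..m}. (grid_max x T n k - grid_max x T n (Suc k)) * G (x (real k * (T / real n)))) \<le> C"
proof -
  define g where "g k = grid_max x T n k" for k
  have low: "x T \<le> g k" if "k \<le> n" for k
    unfolding g_def grid_max_def using that m
    by (intro Max_ge image_eqI[of _ _ n]) auto
  define q where "q k = min (g k) (x T + C)" for k
  have "(\<Sum>k\<in>{1..m}. (g k - g (Suc k)) * G (x (real k * (T / real n)))) \<le> (\<Sum>k\<in>{1..m}. q k - q (Suc k))"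
  proof (rule sum_mono)
    fix k assume k: "k \<in> {1..m}"
    then have rec: "g k = max (x (real k * (T / real n))) (g (Suc k))"
      unfolding g_def using m by (intro grid_max_rec) auto
    show "(g k - g (Suc k)) * G (x (real k * (T / real n))) \<le> q k - q (Suc k)"
    proof (cases "g k \<le> x T + C")
      case True
      then have "q k - q (Suc k) = g k - g (Suc k)" using rec by (auto simp: q_def)
      then show ?thesis using rec G(2) by (simp add: mult_left_le)
    next
      case False
      have "(g k - g (Suc k)) * G (x (real k * (T / real n))) = 0"
      proof (cases "x (real k * (T / real n)) \<le> g (Suc k)")
        case True then show ?thesis using rec by simp
      next
        case F2: False
        then have "g k = x (real k * (T / real n))" using rec by simp
        then show ?thesis using G(3)[of "g k"] False by simp
      qed
      then show ?thesis using rec by (auto simp: q_def)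
    qed
  qed
  also have "\<dots> = q (Suc 0) - q (Suc m)" by (induction m) auto
  also have "\<dots> \<le> C" using low[of "Suc m"] m C by (auto simp: q_def)
  finally show ?thesis by (simp add: g_def)
qed

text \<open>The ceiling sends \<open>s\<close> to the right end of its cell, so that
  right-continuity of the paths can be used in the limit. The step function is measurable for
  arbitrary \<open>r\<close> because \<open>r\<close> is evaluated at countably many points
  only.\<close>

lemma step_sum_integral:
  fixes r :: "real \<Rightarrow> ennreal"
  assumes h: "0 < h"
  shows "(\<lambda>s. r (real (nat \<lceil>s / h\<rceil>) * h)) \<in> borel_measurable borel"
    and "(\<Sum>k\<in>{1..m}. ennreal h * r (real k * h)) =
      (\<integral>\<^sup>+s. r (real (nat \<lceil>s / h\<rceil>) * h) * indicator {0<..real m * h} s \<partial>lborel)"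
proof -
  show [measurable]: "(\<lambda>s. r (real (nat \<lceil>s / h\<rceil>) * h)) \<in> borel_measurable borel"
  proof (rule measurable_compose_countable[where f="\<lambda>i s. r (real i * h)" and g="\<lambda>s. nat \<lceil>s / h\<rceil>"])
    show "(\<lambda>s. nat \<lceil>s / h\<rceil>) \<in> measurable borel (count_space UNIV)" by measurable
  qed simp
  show "(\<Sum>k\<in>{1..m}. ennreal h * r (real k * h)) =
      (\<integral>\<^sup>+s. r (real (nat \<lceil>s / h\<rceil>) * h) * indicator {0<..real m * h} s \<partial>lborel)"
  proof (induction m)
    case 0 then show ?case by simp
  next
    case (Suc m)
    have le: "real m * h \<le> real (Suc m) * h" using h by (intro mult_right_mono) auto
    have "(\<integral>\<^sup>+s. r (real (nat \<lceil>s / h\<rceil>) * h) * indicator {real m * h<..real (Suc m) * h} s \<partial>lborel)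
       = (\<integral>\<^sup>+s. r (real (Suc m) * h) * indicator {real m * h<..real (Suc m) * h} s \<partial>lborel)"
    proof (intro nn_integral_cong)
      fix s
      have "nat \<lceil>s / h\<rceil> = Suc m" if "real m * h < s" "s \<le> real (Suc m) * h"
      proof -
        have "real m < s / h" "s / h \<le> real m + 1" using that h by (auto simp: field_simps)
        then have "\<lceil>s / h\<rceil> = int (Suc m)" by (intro ceiling_unique) auto
        then show ?thesis by simp
      qed
      then show "r (real (nat \<lceil>s / h\<rceil>) * h) * indicator {real m * h<..real (Suc m) * h} s =
        r (real (Suc m) * h) * indicator {real m * h<..real (Suc m) * h} s"
        by (auto simp: indicator_def simp del: of_nat_Suc)
    qed
    also have "\<dots> = ennreal h * r (real (Suc m) * h)"
      using le h by (simp add: nn_integral_cmult algebra_simps)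
    finally have 1: "(\<integral>\<^sup>+s. r (real (nat \<lceil>s / h\<rceil>) * h) * indicator {real m * h<..real (Suc m) * h} s \<partial>lborel)
       = ennreal h * r (real (Suc m) * h)" .
    have "(\<integral>\<^sup>+s. r (real (nat \<lceil>s / h\<rceil>) * h) * indicator {0<..real (Suc m) * h} s \<partial>lborel) =
      (\<integral>\<^sup>+s. r (real (nat \<lceil>s / h\<rceil>) * h) * indicator {0<..real m * h} s +
        r (real (nat \<lceil>s / h\<rceil>) * h) * indicator {real m * h<..real (Suc m) * h} s \<partial>lborel)"
    proof (intro nn_integral_cong)
      fix s
      have "0 \<le> real m * h" using h by simp
      then show "r (real (nat \<lceil>s / h\<rceil>) * h) * indicator {0<..real (Suc m) * h} s =
        r (real (nat \<lceil>s / h\<rceil>) * h) * indicator {0<..real m * h} s +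
        r (real (nat \<lceil>s / h\<rceil>) * h) * indicator {real m * h<..real (Suc m) * h} s"
        using le by (auto simp: indicator_def simp del: of_nat_Suc)
    qed
    also have "\<dots> = (\<integral>\<^sup>+s. r (real (nat \<lceil>s / h\<rceil>) * h) * indicator {0<..real m * h} s \<partial>lborel) + ennreal h * r (real (Suc m) * h)"
      by (subst nn_integral_add) (auto simp: 1 simp del: of_nat_Suc)
    finally show ?case using Suc by simp
  qed
qed

context spectrally_positive_levy begin

text \<open>The approximating times take countably many values and tend to \<open>s\<close> from the
  right, so right-continuity turns countable patchings of the measurable \<open>X t\<close> into a
  jointly measurable limit.\<close>

lemma joint_meas [measurable]: "(\<lambda>(s, \<omega>). X (max 0 s) \<omega>) \<in> borel_measurable ((lborel :: real measure) \<Otimes>\<^sub>M M)"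
proof (rule borel_measurable_LIMSEQ_real)
  let ?\<tau> = "\<lambda>n s. (real (nat \<lfloor>max 0 s * real (Suc n)\<rfloor>) + 1) / real (Suc n)"
  show "(\<lambda>(s, \<omega>). X (?\<tau> n s) \<omega>) \<in> borel_measurable ((lborel :: real measure) \<Otimes>\<^sub>M M)" for n
  proof -
    have "(\<lambda>p. (\<lambda>i p. X ((real i + 1) / real (Suc n)) (snd p)) (nat \<lfloor>max 0 (fst p) * real (Suc n)\<rfloor>) p) \<in> borel_measurable ((lborel :: real measure) \<Otimes>\<^sub>M M)"
    proof (rule measurable_compose_countable[where f="\<lambda>i p. X ((real i + 1) / real (Suc n)) (snd p)"
          and g="\<lambda>p. nat \<lfloor>max 0 (fst p) * real (Suc n)\<rfloor>"])
      show "(\<lambda>p. X ((real i + 1) / real (Suc n)) (snd p)) \<in> borel_measurable ((lborel :: real measure) \<Otimes>\<^sub>M M)" for i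
        by (rule measurable_compose[OF measurable_snd meas]) simp
      have "(\<lambda>s::real. nat \<lfloor>max 0 s * real (Suc n)\<rfloor>) \<in> measurable lborel (count_space UNIV)" by measurable
      then show "(\<lambda>p. nat \<lfloor>max 0 (fst p) * real (Suc n)\<rfloor>) \<in> measurable ((lborel :: real measure) \<Otimes>\<^sub>M M) (count_space UNIV)"
        by (rule measurable_compose[OF measurable_fst])
    qed
    then show ?thesis by (simp only: case_prod_beta')
  qed
  fix p assume "p \<in> space ((lborel :: real measure) \<Otimes>\<^sub>M M)"
  then have p: "snd p \<in> space M" by (auto simp: space_pair_measure)
  define s where "s = max 0 (fst p)"
  have lohi: "s \<le> (real (nat \<lfloor>s * N\<rfloor>) + 1) / N \<and> (real (nat \<lfloor>s * N\<rfloor>) + 1) / N \<le> s + 1 / N" if N: "0 < N" for N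
  proof -
    have "0 \<le> s * N" using N by (simp add: s_def)
    then have "real (nat \<lfloor>s * N\<rfloor>) = of_int \<lfloor>s * N\<rfloor>" by simp
    then have "real (nat \<lfloor>s * N\<rfloor>) \<le> s * N" "s * N < real (nat \<lfloor>s * N\<rfloor>) + 1" by linarith+
    then show ?thesis using N by (simp add: field_simps)
  qed
  have lo: "s \<le> (real (nat \<lfloor>s * real (Suc n)\<rfloor>) + 1) / real (Suc n)" for n
    by (rule conjunct1[OF lohi]) simp
  have hi: "(real (nat \<lfloor>s * real (Suc n)\<rfloor>) + 1) / real (Suc n) \<le> s + 1 / real (Suc n)" for n
    by (rule conjunct2[OF lohi]) simp
  have "(\<lambda>n. s + 1 / real (Suc n)) \<longlonglongrightarrow> s + 0"
    by (intro tendsto_add tendsto_const LIMSEQ_Suc[OF lim_const_over_n])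
  then have a: "(\<lambda>n. s + 1 / real (Suc n)) \<longlonglongrightarrow> s" by (simp only: add_0_right)
  have "\<forall>\<^sub>F n in sequentially. s \<le> (real (nat \<lfloor>s * real (Suc n)\<rfloor>) + 1) / real (Suc n)"
    "\<forall>\<^sub>F n in sequentially. (real (nat \<lfloor>s * real (Suc n)\<rfloor>) + 1) / real (Suc n) \<le> s + 1 / real (Suc n)"
    by (intro always_eventually allI lo hi)+
  then have "(\<lambda>n. (real (nat \<lfloor>s * real (Suc n)\<rfloor>) + 1) / real (Suc n)) \<longlonglongrightarrow> s"
    by (rule tendsto_sandwich[OF _ _ tendsto_const a])
  then have "(\<lambda>n. X ((real (nat \<lfloor>s * real (Suc n)\<rfloor>) + 1) / real (Suc n)) (snd p)) \<longlonglongrightarrow> X s (snd p)"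
    by (rule no_neg_jump_path_right_LIMSEQ[of "\<lambda>t. X t (snd p)", OF regular_path[OF p] _ _ lo, rotated]) (simp add: s_def)
  then show "(\<lambda>n. (\<lambda>(s, \<omega>). X (?\<tau> n s) \<omega>) p) \<longlonglongrightarrow> (\<lambda>(s, \<omega>). X (max 0 s) \<omega>) p"
    by (simp only: case_prod_beta' s_def)
qed

lemma path_sup_meas:
  assumes b: "0 \<le> b" "b < T"
  shows "(\<lambda>\<omega>. path_sup (path \<omega>) b T) \<in> borel_measurable M"
  by (rule borel_measurable_LIMSEQ_real[OF grid_max_LIMSEQ[OF regular_path b]]) (use b in \<open>auto intro!: grid_max_meas\<close>)

end

subsection \<open>The ballot identity for spectrally positive processes\<close>

context spectrally_positive_levy begin

text \<open>When \<open>discrete_ballot\<close> is summed over the grid points of the window, the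
  left side is a Riemann sum over levels and the right side one over times. Stopping at
  \<open>b < T\<close> keeps \<open>1 / (T - s)\<close> bounded, and the vanishing of
  \<open>F (v, w)\<close> for \<open>w > C\<close> bounds both sides uniformly, so both limits
  follow by dominated convergence.\<close>

lemma ballot_window:
  fixes F :: "real \<times> real \<Rightarrow> real"
  assumes b: "0 < b" "b < T"
    and F: "L-lipschitz_on UNIV F" "\<And>p. 0 \<le> F p" "\<And>p. F p \<le> 1" and C: "0 \<le> C" "\<And>v w. C < w \<Longrightarrow> F (v, w) = 0"
  shows "(\<integral>\<^sup>+\<omega>. \<integral>\<^sup>+v. ennreal (F (v, v - X T \<omega>)) *
        indicator {path_sup (path \<omega>) b T<..<path_sup (path \<omega>) 0 T} v \<partial>lborel \<partial>M)
    = (\<integral>\<^sup>+s. (\<integral>\<^sup>+\<omega>. ennreal (drop_rate T s \<omega> *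
        F (gap T s \<omega>)) \<partial>M) * indicator {0<..<b} s \<partial>lborel)"
    (is "?L = ?R")
proof -
  have T: "0 < T" using b by simp
  have [measurable]: "F \<in> borel_measurable borel"
    using lipschitz_on_continuous_on[OF F(1)] by (rule borel_measurable_continuous_onI)
  have Fc: "isCont F p" for p
    using lipschitz_on_continuous_on[OF F(1)] by (cases p) (simp add: continuous_on_eq_continuous_at)
  have XT [measurable]: "X T \<in> borel_measurable M" using T by (intro meas) auto
  have [measurable]: "(\<lambda>\<omega>. path_sup (path \<omega>) b T) \<in> borel_measurable M"
    "(\<lambda>\<omega>. path_sup (path \<omega>) 0 T) \<in> borel_measurable M"
    using b by (auto intro!: path_sup_meas)
  define K where "K n = nat \<lfloor>b * real n / T\<rfloor>" for n
  define h where "h n = T / real n" for n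
  define r where "r s = (\<integral>\<^sup>+\<omega>. ennreal (max 0 (X s \<omega> - X T \<omega>) / (T - s) * F (X s \<omega>, X s \<omega> - X T \<omega>)) \<partial>M)" for s
  define D where "D n \<omega> = (\<Sum>k\<in>{1..K n}. (grid_max (path \<omega>) T n k - grid_max (path \<omega>) T n (Suc k)) *
     F (X (real k * h n) \<omega>, X (real k * h n) \<omega> - X T \<omega>))" for n \<omega>
  have Kn: "K n < n" "real (K n) * h n \<le> b" "b < real (Suc (K n)) * h n" if "0 < n" for n
    unfolding K_def h_def using floor_index[OF that, of b T] b by auto
  have hpos: "0 < h n" if "0 < n" for n using that T by (simp add: h_def)
  have Xk [measurable]: "X (real k * h n) \<in> borel_measurable M" for k n
    using T by (intro meas) (simp add: h_def)
  have D_meas [measurable]: "D n \<in> borel_measurable M" for n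
    unfolding D_def using T by (intro borel_measurable_sum borel_measurable_times borel_measurable_diff grid_max_meas) auto
  have D_lim: "(\<lambda>n. ennreal (D n \<omega>)) \<longlonglongrightarrow> (\<integral>\<^sup>+v. ennreal (F (v, v - X T \<omega>)) *
        indicator {path_sup (path \<omega>) b T<..<path_sup (path \<omega>) 0 T} v \<partial>lborel)" if \<omega>: "\<omega> \<in> space M" for \<omega>
    unfolding D_def K_def h_def
  proof (rule grid_riemann_LIMSEQ[OF regular_path[OF \<omega>], of b T "\<lambda>v. F (v, v - X T \<omega>)" "L * 2"])
    fix v w
    have "\<bar>F (v, v - X T \<omega>) - F (w, w - X T \<omega>)\<bar> \<le> L * dist (v, v - X T \<omega>) (w, w - X T \<omega>)"
      using lipschitz_onD[OF F(1)] by (simp add: dist_real_def)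
    also have "dist (v, v - X T \<omega>) (w, w - X T \<omega>) \<le> 2 * \<bar>v - w\<bar>"
      unfolding dist_Pair_Pair using sqrt_sum_squares_le_sum_abs[of "dist v w" "dist (v - X T \<omega>) (w - X T \<omega>)"]
      by (simp add: dist_real_def)
    finally show "\<bar>F (v, v - X T \<omega>) - F (w, w - X T \<omega>)\<bar> \<le> L * 2 * \<bar>v - w\<bar>"
      using lipschitz_on_nonneg[OF F(1)] by (simp add: mult_left_mono mult.assoc)
  qed (use b F in auto)
  have D_bound: "D n \<omega> \<le> C" for n \<omega>
  proof (cases "n = 0")
    case True then show ?thesis using C by (simp add: D_def K_def)
  next
    case False
    then show ?thesis
      unfolding D_def h_def
      by (intro grid_riemann_bound[of "K n" n "\<lambda>v. F (v, v - X T \<omega>)" "\<lambda>t. X t \<omega>" T C]) (use Kn F C in auto)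
  qed
  have [measurable]: "(\<lambda>p. indicator {path_sup (\<lambda>t. X t (fst p)) b T<..<path_sup (\<lambda>t. X t (fst p)) 0 T} (snd p) :: ennreal)
      \<in> borel_measurable (M \<Otimes>\<^sub>M lborel)"
    unfolding greaterThanLessThan_iff indicator_def by measurable
  have [measurable]: "(\<lambda>\<omega>. \<integral>\<^sup>+v. ennreal (F (v, v - X T \<omega>)) *
        indicator {path_sup (path \<omega>) b T<..<path_sup (path \<omega>) 0 T} v \<partial>lborel) \<in> borel_measurable M"
    by (intro lborel.borel_measurable_nn_integral) (simp add: case_prod_beta')
  have L_lim: "(\<lambda>n. \<integral>\<^sup>+\<omega>. ennreal (D n \<omega>) \<partial>M) \<longlonglongrightarrow> ?L"
    by (rule nn_integral_dominated_convergence[where w="\<lambda>_. ennreal C"])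
      (use D_lim D_bound in \<open>auto simp: emeasure_space_1 ennreal_leI\<close>)
  have D_int: "(\<integral>\<^sup>+\<omega>. ennreal (D n \<omega>) \<partial>M) = (\<Sum>k\<in>{1..K n}. ennreal (h n) * r (real k * h n))" if n: "0 < n" for n
  proof -
    have gm: "0 \<le> grid_max (path \<omega>) T n k - grid_max (path \<omega>) T n (Suc k)" if "k \<in> {1..K n}" for k \<omega>
      using grid_max_rec[of k n "\<lambda>t. X t \<omega>" T] that Kn[OF n] by auto
    have "(\<integral>\<^sup>+\<omega>. ennreal (D n \<omega>) \<partial>M) = (\<integral>\<^sup>+\<omega>. (\<Sum>k\<in>{1..K n}. ennreal (grid_max (path \<omega>) T n k - grid_max (path \<omega>) T n (Suc k)) *
       ennreal (F (X (real k * h n) \<omega>, X (real k * h n) \<omega> - X T \<omega>))) \<partial>M)"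
      unfolding D_def using gm F
      by (intro nn_integral_cong) (subst sum_ennreal[symmetric], auto simp: ennreal_mult intro!: sum.cong)
    also have "\<dots> = (\<Sum>k\<in>{1..K n}. \<integral>\<^sup>+\<omega>. ennreal (grid_max (path \<omega>) T n k - grid_max (path \<omega>) T n (Suc k)) *
       ennreal (F (X (real k * h n) \<omega>, X (real k * h n) \<omega> - X T \<omega>)) \<partial>M)"
    proof (rule nn_integral_sum)
      fix k
      have [measurable]: "(\<lambda>\<omega>. grid_max (path \<omega>) T n k) \<in> borel_measurable M"
        "(\<lambda>\<omega>. grid_max (path \<omega>) T n (Suc k)) \<in> borel_measurable M"
        using T by (auto intro!: grid_max_meas)
      show "(\<lambda>\<omega>. ennreal (grid_max (path \<omega>) T n k - grid_max (path \<omega>) T n (Suc k)) *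
        ennreal (F (X (real k * h n) \<omega>, X (real k * h n) \<omega> - X T \<omega>))) \<in> borel_measurable M" by measurable
    qed
    also have "\<dots> = (\<Sum>k\<in>{1..K n}. ennreal (h n) * r (real k * h n))"
    proof (rule sum.cong[OF refl])
      fix k assume k: "k \<in> {1..K n}"
      then have kn: "k < n" using Kn[OF n] by auto
      have nh: "real n * h n = T" using n by (simp add: h_def)
      \<comment> \<open>Division by \<open>n - k\<close> becomes division by
        \<open>T - real k * h n\<close> with the mesh as a factor, which makes the sum a Riemann sum
        in time.\<close>
      have Tk: "T - real k * h n = real (n - k) * h n" using nh kn by (simp add: of_nat_diff algebra_simps)
      have "(\<integral>\<^sup>+\<omega>. ennreal (grid_max (path \<omega>) T n k - grid_max (path \<omega>) T n (Suc k)) *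
         ennreal (F (X (real k * h n) \<omega>, X (real k * h n) \<omega> - X T \<omega>)) \<partial>M)
        = (\<integral>\<^sup>+\<omega>. ennreal (max 0 (X (real k * h n) \<omega> - X T \<omega>) / real (n - k)) *
         ennreal (F (X (real k * h n) \<omega>, X (real k * h n) \<omega> - X T \<omega>)) \<partial>M)"
        unfolding h_def by (rule discrete_ballot[OF T kn]) measurable
      also have "\<dots> = (\<integral>\<^sup>+\<omega>. ennreal (h n) * ennreal (max 0 (X (real k * h n) \<omega> - X T \<omega>) / (T - real k * h n) *
         F (X (real k * h n) \<omega>, X (real k * h n) \<omega> - X T \<omega>)) \<partial>M)"
        unfolding Tk using hpos[OF n] kn F(2) by (intro nn_integral_cong) (simp flip: ennreal_mult)
      also have "\<dots> = ennreal (h n) * r (real k * h n)"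
        unfolding r_def by (intro nn_integral_cmult) measurable
      finally show "(\<integral>\<^sup>+\<omega>. ennreal (grid_max (path \<omega>) T n k - grid_max (path \<omega>) T n (Suc k)) *
         ennreal (F (X (real k * h n) \<omega>, X (real k * h n) \<omega> - X T \<omega>)) \<partial>M) = ennreal (h n) * r (real k * h n)" .
    qed
    finally show ?thesis .
  qed
  define \<sigma> where "\<sigma> n s = real (nat \<lceil>s / h n\<rceil>) * h n" for n s
  have \<sigma>: "s \<le> \<sigma> n s" "\<sigma> n s \<le> s + h n" if "0 < n" "0 < s" for n s
  proof -
    have "0 < s / h n" using hpos[OF that(1)] that(2) by simp
    then have "real (nat \<lceil>s / h n\<rceil>) = of_int \<lceil>s / h n\<rceil>" by simp
    then have "s / h n \<le> real (nat \<lceil>s / h n\<rceil>)" "real (nat \<lceil>s / h n\<rceil>) \<le> s / h n + 1" by linarith+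
    then show "s \<le> \<sigma> n s" "\<sigma> n s \<le> s + h n" using hpos[OF that(1)] by (auto simp: \<sigma>_def field_simps)
  qed
  have h0: "h \<longlonglongrightarrow> 0" unfolding h_def by (rule lim_const_over_n)
  have \<sigma>_lim: "(\<lambda>n. \<sigma> n s) \<longlonglongrightarrow> s" if s: "0 < s" for s
  proof (rule tendsto_sandwich[of "\<lambda>n. s" _ _ "\<lambda>n. s + h n"])
    show "(\<lambda>n. s + h n) \<longlonglongrightarrow> s" using tendsto_add[OF tendsto_const h0] by simp
  qed (use \<sigma> s in \<open>auto intro!: eventually_sequentiallyI[of 1]\<close>)
  have \<sigma>_le: "\<sigma> n s \<le> real (K n) * h n" if "0 < n" "0 < s" "s \<le> real (K n) * h n" for n s
  proof -
    have "s / h n \<le> real (K n)" using that hpos[OF that(1)] by (simp add: field_simps)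
    then have "\<lceil>s / h n\<rceil> \<le> int (K n)" by (intro ceiling_le) simp
    then have "nat \<lceil>s / h n\<rceil> \<le> K n" using nat_mono by fastforce
    then show ?thesis unfolding \<sigma>_def using hpos[OF that(1)] by (intro mult_right_mono) auto
  qed
  have r_pt: "max 0 (X s \<omega> - X T \<omega>) / (T - s) * F (X s \<omega>, X s \<omega> - X T \<omega>) \<le> C / (T - b)" if s: "s \<le> b" for s \<omega>
  proof -
    define w where "w = X s \<omega> - X T \<omega>"
    have "max 0 w * F (X s \<omega>, w) \<le> C"
    proof (cases "w \<le> C")
      case True
      then have "max 0 w * F (X s \<omega>, w) \<le> max 0 w" using F by (intro mult_left_le) auto
      then show ?thesis using True C by auto
    qed (use C in auto)
    then have "max 0 w * F (X s \<omega>, w) / (T - s) \<le> C / (T - b)"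
      using s b F C by (intro frac_le) auto
    then show ?thesis by (simp add: w_def)
  qed
  have r_bound: "r s \<le> ennreal (C / (T - b))" if s: "s \<le> b" for s
  proof -
    have "r s \<le> (\<integral>\<^sup>+\<omega>. ennreal (C / (T - b)) \<partial>M)"
      unfolding r_def by (intro nn_integral_mono ennreal_leI r_pt s)
    also have "\<dots> = ennreal (C / (T - b))" by (simp add: emeasure_space_1)
    finally show ?thesis .
  qed
  have r_lim: "(\<lambda>n. r (\<sigma> n s)) \<longlonglongrightarrow> r s" if s: "0 < s" "s < b" for s
  proof -
    have "\<forall>\<^sub>F n in sequentially. h n < b - s \<and> 0 < n"
      using order_tendstoD(2)[OF h0, of "b - s"] s by (intro eventually_conj eventually_gt_at_top) auto
    then obtain N where N: "\<And>n. N \<le> n \<Longrightarrow> h n < b - s" "\<And>n. N \<le> n \<Longrightarrow> 0 < n"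
      by (auto simp: eventually_sequentially)
    \<comment> \<open>Dominated convergence wants the bound at all indices, hence the shift by
      \<open>N\<close>, past which the grid times stay inside the window.\<close>
    have \<sigma>N: "0 < n + N" "s \<le> \<sigma> (n + N) s" "\<sigma> (n + N) s \<le> b" for n
      using N[of "n + N"] \<sigma>[of "n + N" s] s by auto
    have [measurable]: "X (\<sigma> (n + N) s) \<in> borel_measurable M" for n
      using \<sigma>N(2)[of n] s by (intro meas) auto
    have [measurable]: "X s \<in> borel_measurable M" using s by (intro meas) auto
    have "(\<lambda>n. r (\<sigma> (n + N) s)) \<longlonglongrightarrow> r s"
      unfolding r_def
    proof (rule nn_integral_dominated_convergence[where w="\<lambda>_. ennreal (C / (T - b))"])
      show "AE \<omega> in M. (\<lambda>n. ennreal (max 0 (X (\<sigma> (n + N) s) \<omega> - X T \<omega>) / (T - \<sigma> (n + N) s) *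
           F (X (\<sigma> (n + N) s) \<omega>, X (\<sigma> (n + N) s) \<omega> - X T \<omega>)))
           \<longlonglongrightarrow> ennreal (max 0 (X s \<omega> - X T \<omega>) / (T - s) * F (X s \<omega>, X s \<omega> - X T \<omega>))"
      proof (rule AE_I2)
        fix \<omega> assume \<omega>: "\<omega> \<in> space M"
        have sl: "(\<lambda>n. \<sigma> (n + N) s) \<longlonglongrightarrow> s" using \<sigma>_lim[OF s(1)] by (rule LIMSEQ_ignore_initial_segment)
        have Xl: "(\<lambda>n. X (\<sigma> (n + N) s) \<omega>) \<longlonglongrightarrow> X s \<omega>"
          by (rule no_neg_jump_path_right_LIMSEQ[of "\<lambda>t. X t \<omega>", OF regular_path[OF \<omega>] _ sl]) (use s \<sigma>N in auto)
        show "(\<lambda>n. ennreal (max 0 (X (\<sigma> (n + N) s) \<omega> - X T \<omega>) / (T - \<sigma> (n + N) s) *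
           F (X (\<sigma> (n + N) s) \<omega>, X (\<sigma> (n + N) s) \<omega> - X T \<omega>)))
           \<longlonglongrightarrow> ennreal (max 0 (X s \<omega> - X T \<omega>) / (T - s) * F (X s \<omega>, X s \<omega> - X T \<omega>))"
          using s b by (intro tendsto_intros tendsto_ennrealI isCont_tendsto_compose[OF Fc] sl Xl) auto
      qed
    qed (use r_pt \<sigma>N in \<open>auto simp: emeasure_space_1 intro!: ennreal_leI\<close>)
    then show ?thesis by (rule LIMSEQ_offset)
  qed
  \<comment> \<open>\<open>r\<close> involves \<open>X s\<close> at negative \<open>s\<close>, about
    which nothing is known; \<open>r'\<close> agrees with it at positive times and is measurable by
    joint measurability.\<close>
  define r' where "r' s = (\<integral>\<^sup>+\<omega>. ennreal (drop_rate T s \<omega> *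
        F (gap T s \<omega>)) \<partial>M)" for s
  have r'_meas [measurable]: "r' \<in> borel_measurable lborel"
    unfolding r'_def by measurable
  have rr': "r' s = r s" if "0 < s" for s using that by (simp add: r_def r'_def)
  have R_lim: "(\<lambda>n. \<integral>\<^sup>+s. r (\<sigma> (Suc n) s) * indicator {0<..real (K (Suc n)) * h (Suc n)} s \<partial>lborel)
     \<longlonglongrightarrow> (\<integral>\<^sup>+s. r' s * indicator {0<..<b} s \<partial>lborel)"
  proof (rule nn_integral_dominated_convergence[where w="\<lambda>s. ennreal (C / (T - b)) * indicator {0<..b} s"])
    fix n
    have [measurable]: "(\<lambda>s. r (\<sigma> (Suc n) s)) \<in> borel_measurable borel"
      unfolding \<sigma>_def using hpos[of "Suc n"] by (intro step_sum_integral(1)) simp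
    show "(\<lambda>s. r (\<sigma> (Suc n) s) * indicator {0<..real (K (Suc n)) * h (Suc n)} s) \<in> borel_measurable lborel"
      by measurable
    show "AE s in lborel. r (\<sigma> (Suc n) s) * indicator {0<..real (K (Suc n)) * h (Suc n)} s \<le>
       ennreal (C / (T - b)) * indicator {0<..b} s"
    proof (rule AE_I2)
      fix s
      have Kb: "real (K (Suc n)) * h (Suc n) \<le> b" by (rule Kn(2)) simp
      show "r (\<sigma> (Suc n) s) * indicator {0<..real (K (Suc n)) * h (Suc n)} s \<le>
         ennreal (C / (T - b)) * indicator {0<..b} s"
      proof (cases "0 < s \<and> s \<le> real (K (Suc n)) * h (Suc n)")
        case True
        then have "\<sigma> (Suc n) s \<le> b" using \<sigma>_le[of "Suc n" s] Kb by auto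
        then show ?thesis using True Kb r_bound by (auto simp: indicator_def)
      qed (auto simp: indicator_def)
    qed
  next
    show "AE s in lborel. (\<lambda>n. r (\<sigma> (Suc n) s) * indicator {0<..real (K (Suc n)) * h (Suc n)} s)
      \<longlonglongrightarrow> r' s * indicator {0<..<b} s"
      using AE_lborel_singleton[of b]
    proof eventually_elim
      case (elim s)
      have Kb: "real (K (Suc n)) * h (Suc n) \<le> b" for n by (rule Kn(2)) simp
      show ?case
      proof (cases "0 < s \<and> s < b")
        case True
        have "\<forall>\<^sub>F n in sequentially. h n < b - s \<and> 0 < n"
          using order_tendstoD(2)[OF h0, of "b - s"] True by (intro eventually_conj eventually_gt_at_top) auto
        then have "\<forall>\<^sub>F n in sequentially. s \<le> real (K n) * h n"
        proof eventually_elim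
          case (elim n)
          then show ?case using Kn(3)[of n] by (simp add: algebra_simps)
        qed
        then have "\<forall>\<^sub>F n in sequentially. s \<le> real (K (Suc n)) * h (Suc n)"
          by (subst eventually_sequentially_Suc)
        then have "\<forall>\<^sub>F n in sequentially. r (\<sigma> (Suc n) s) = r (\<sigma> (Suc n) s) * indicator {0<..real (K (Suc n)) * h (Suc n)} s"
          by eventually_elim (use True in auto)
        moreover have "(\<lambda>n. r (\<sigma> (Suc n) s)) \<longlonglongrightarrow> r' s * indicator {0<..<b} s"
          using r_lim[of s, THEN LIMSEQ_Suc] True rr' by auto
        ultimately show ?thesis by (rule Lim_transform_eventually[rotated])
      next
        case False
        then have "s \<notin> {0<..real (K (Suc n)) * h (Suc n)}" for n using elim Kb[of n] by auto
        then have "r (\<sigma> (Suc n) s) * indicator {0<..real (K (Suc n)) * h (Suc n)} s = 0" for n by simp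
        moreover have "r' s * indicator {0<..<b} s = 0" using False by auto
        ultimately show ?thesis by (simp only: tendsto_const)
      qed
    qed
  next
    have "(\<integral>\<^sup>+s. ennreal (C / (T - b)) * indicator {0<..b} s \<partial>lborel) = ennreal (C / (T - b)) * ennreal b"
      using b by (simp add: nn_integral_cmult)
    then show "(\<integral>\<^sup>+s. ennreal (C / (T - b)) * indicator {0<..b} s \<partial>lborel) < \<infinity>"
      by (simp add: ennreal_mult_less_top)
  qed measurable
  have "(\<integral>\<^sup>+\<omega>. ennreal (D (Suc n) \<omega>) \<partial>M) =
     (\<integral>\<^sup>+s. r (\<sigma> (Suc n) s) * indicator {0<..real (K (Suc n)) * h (Suc n)} s \<partial>lborel)" for n
    unfolding D_int[OF zero_less_Suc] \<sigma>_def by (rule step_sum_integral(2)) (simp add: hpos)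
  then have "(\<lambda>n. \<integral>\<^sup>+\<omega>. ennreal (D (Suc n) \<omega>) \<partial>M) \<longlonglongrightarrow> ?R"
    using R_lim unfolding r'_def by simp
  with LIMSEQ_Suc[OF L_lim] show ?thesis by (rule LIMSEQ_unique)
qed

end

text \<open>Just before \<open>T\<close> the path is close to its left limit, which is at most
  \<open>x T < v\<close>. So the suprema over \<open>{b..T}\<close> drop below every level above the
  final value as \<open>b\<close> tends to \<open>T\<close>; a negative jump at \<open>T\<close>
  would prevent this.\<close>

lemma path_sup_left_end:
  assumes x: "no_neg_jump_path x" and T: "0 < T" and v: "x T < v"
  shows "\<exists>b0<T. \<forall>b. b0 \<le> b \<longrightarrow> b < T \<longrightarrow> path_sup x b T < v"
proof -
  obtain l where l: "l \<le> x T" "(x \<longlongrightarrow> l) (at_left T)" using no_neg_jump_path_left[OF x T] by auto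
  \<comment> \<open>A supremum of values below \<open>v'\<close> is only known to be at most
    \<open>v'\<close>; the midpoint leaves room for the strict inequality.\<close>
  define v' where "v' = (x T + v) / 2"
  have v': "x T < v'" "v' < v" using v by (auto simp: v'_def)
  then have "\<forall>\<^sub>F s in at_left T. x s < v'" using l by (intro order_tendstoD[OF l(2)]) auto
  then obtain b0 where b0: "b0 < T" "\<And>s. b0 < s \<Longrightarrow> s < T \<Longrightarrow> x s < v'"
    unfolding eventually_at_left_field by blast
  show ?thesis
  proof (intro exI[of _ "(b0 + T) / 2"] conjI allI impI)
    fix b assume b: "(b0 + T) / 2 \<le> b" "b < T"
    have "x s \<le> v'" if "s \<in> {b..T}" for s
      using b0(2)[of s] that b b0(1) v' by (cases "s = T") auto
    then have "path_sup x b T \<le> v'"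
      unfolding path_sup_def using b by (intro cSUP_least) auto
    then show "path_sup x b T < v" using v' by simp
  qed (use b0 in auto)
qed

lemma SUP_mult_indicator:
  "(SUP i. (c::ennreal) * indicator (A i) v) = c * indicator (\<Union>i. A i) v"
proof (cases "\<exists>i. v \<in> A i")
  case True
  then obtain i where i: "v \<in> A i" by auto
  show ?thesis
  proof (rule antisym)
    show "(SUP i. c * indicator (A i) v) \<le> c * indicator (\<Union>i. A i) v"
      by (intro SUP_least mult_left_mono) (auto simp: indicator_def)
    show "c * indicator (\<Union>i. A i) v \<le> (SUP i. c * indicator (A i) v)"
      using i by (intro SUP_upper2[of i]) (auto simp: indicator_def)
  qed
qed auto

context spectrally_positive_levy begin

text \<open>The bound available on a window deteriorates like \<open>1 / (T - b)\<close>, so the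
  windows are exhausted by monotone convergence on both sides. On the left, the level intervals fill
  up everything between the final value and the supremum by
  \<open>path_sup_left_end\<close>.\<close>

lemma ballot_lipschitz:
  fixes F :: "real \<times> real \<Rightarrow> real"
  assumes T: "0 < T"
    and F: "L-lipschitz_on UNIV F" "\<And>p. 0 \<le> F p" "\<And>p. F p \<le> 1" and C: "0 \<le> C" "\<And>v w. C < w \<Longrightarrow> F (v, w) = 0"
  shows "(\<integral>\<^sup>+\<omega>. \<integral>\<^sup>+v. ennreal (F (v, v - X T \<omega>)) *
        indicator {X T \<omega><..<path_sup (path \<omega>) 0 T} v \<partial>lborel \<partial>M)
    = (\<integral>\<^sup>+s. (\<integral>\<^sup>+\<omega>. ennreal (drop_rate T s \<omega> *
        F (gap T s \<omega>)) \<partial>M) * indicator {0<..<T} s \<partial>lborel)"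
    (is "?L = ?R")
proof -
  \<comment> \<open>The 2 makes the first window end at \<open>T / 2\<close> instead of being
    empty.\<close>
  define b where "b i = T - T / (real i + 2)" for i :: nat
  have b: "0 < b i" "b i < T" for i using T by (auto simp: b_def field_simps add_pos_nonneg)
  have b_inc: "b i \<le> b j" if "i \<le> j" for i j
    unfolding b_def using that T by (intro diff_mono divide_left_mono) auto
  have b_lim: "\<exists>i. c < b i" if "c < T" for c
  proof -
    obtain i :: nat where "T / (T - c) < real i" using reals_Archimedean2 by blast
    then have "T < (T - c) * (real i + 2)" using that T by (simp add: field_simps)
    then have "T / (real i + 2) < T - c" by (simp add: field_simps)
    then show ?thesis by (intro exI[of _ i]) (simp add: b_def)
  qed
  have [measurable]: "F \<in> borel_measurable borel"
    using lipschitz_on_continuous_on[OF F(1)] by (rule borel_measurable_continuous_onI)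
  have XT [measurable]: "X T \<in> borel_measurable M" using T by (intro meas) auto
  have [measurable]: "(\<lambda>\<omega>. path_sup (path \<omega>) (b i) T) \<in> borel_measurable M"
    "(\<lambda>\<omega>. path_sup (path \<omega>) 0 T) \<in> borel_measurable M" for i
    using b[of i] T by (auto intro!: path_sup_meas)
  define A where "A \<omega> i = {path_sup (path \<omega>) (b i) T<..<path_sup (path \<omega>) 0 T}" for \<omega> i
  have A_inc: "A \<omega> i \<subseteq> A \<omega> j" if "i \<le> j" "\<omega> \<in> space M" for \<omega> i j
  proof -
    have "path_sup (path \<omega>) (b j) T \<le> path_sup (path \<omega>) (b i) T"
      unfolding path_sup_def using b[of i] b[of j] b_inc[OF that(1)] no_neg_jump_path_bdd[OF regular_path[OF that(2)], of "b i" T]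
      by (intro cSUP_subset_mono) auto
    then show ?thesis by (auto simp: A_def)
  qed
  have A_UN: "(\<Union>i. A \<omega> i) = {X T \<omega><..<path_sup (path \<omega>) 0 T}" if \<omega>: "\<omega> \<in> space M" for \<omega>
  proof (intro set_eqI iffI)
    fix v assume "v \<in> (\<Union>i. A \<omega> i)"
    then obtain i where "v \<in> A \<omega> i" by auto
    moreover have "X T \<omega> \<le> path_sup (path \<omega>) (b i) T"
      using b[of i] by (intro path_sup_upper[OF regular_path[OF \<omega>]]) auto
    ultimately show "v \<in> {X T \<omega><..<path_sup (path \<omega>) 0 T}" by (auto simp: A_def)
  next
    fix v assume v: "v \<in> {X T \<omega><..<path_sup (path \<omega>) 0 T}"
    then obtain b0 where b0: "b0 < T" "\<forall>b. b0 \<le> b \<longrightarrow> b < T \<longrightarrow> path_sup (path \<omega>) b T < v"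
      using path_sup_left_end[OF regular_path[OF \<omega>] T, of v] by auto
    then obtain i where "b0 < b i" using b_lim by blast
    then show "v \<in> (\<Union>i. A \<omega> i)" using b0 b[of i] v by (auto simp: A_def intro!: exI[of _ i])
  qed
  have A_meas [measurable]: "(\<lambda>p. indicator (A (fst p) i) (snd p) :: ennreal) \<in> borel_measurable (M \<Otimes>\<^sub>M lborel)" for i
    unfolding A_def greaterThanLessThan_iff indicator_def by measurable
  have inner_meas [measurable]: "(\<lambda>\<omega>. \<integral>\<^sup>+v. ennreal (F (v, v - X T \<omega>)) * indicator (A \<omega> i) v \<partial>lborel) \<in> borel_measurable M" for i
    using A_meas[of i] by (intro lborel.borel_measurable_nn_integral) (simp add: case_prod_beta')
  have "?L = (\<integral>\<^sup>+\<omega>. \<integral>\<^sup>+v. (SUP i. ennreal (F (v, v - X T \<omega>)) * indicator (A \<omega> i) v) \<partial>lborel \<partial>M)"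
    by (intro nn_integral_cong) (simp add: SUP_mult_indicator A_UN)
  also have "\<dots> = (\<integral>\<^sup>+\<omega>. (SUP i. \<integral>\<^sup>+v. ennreal (F (v, v - X T \<omega>)) * indicator (A \<omega> i) v \<partial>lborel) \<partial>M)"
  proof (intro nn_integral_cong nn_integral_monotone_convergence_SUP)
    fix \<omega> i assume \<omega>: "\<omega> \<in> space M"
    show "incseq (\<lambda>i v. ennreal (F (v, v - X T \<omega>)) * indicator (A \<omega> i) v)"
      using A_inc[OF _ \<omega>] by (force simp: incseq_def le_fun_def indicator_def)
    show "(\<lambda>v. ennreal (F (v, v - X T \<omega>)) * indicator (A \<omega> i) v) \<in> borel_measurable lborel"
      unfolding A_def by measurable
  qed
  also have "\<dots> = (SUP i. \<integral>\<^sup>+\<omega>. \<integral>\<^sup>+v. ennreal (F (v, v - X T \<omega>)) * indicator (A \<omega> i) v \<partial>lborel \<partial>M)"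
  proof (rule nn_integral_monotone_convergence_SUP_AE)
    fix i show "AE \<omega> in M. (\<integral>\<^sup>+v. ennreal (F (v, v - X T \<omega>)) * indicator (A \<omega> i) v \<partial>lborel)
      \<le> (\<integral>\<^sup>+v. ennreal (F (v, v - X T \<omega>)) * indicator (A \<omega> (Suc i)) v \<partial>lborel)"
      using A_inc[of i "Suc i"] by (intro AE_I2 nn_integral_mono mult_left_mono) (auto simp: indicator_def)
  qed measurable
  also have "\<dots> = (SUP i. \<integral>\<^sup>+s. (\<integral>\<^sup>+\<omega>. ennreal (drop_rate T s \<omega> *
        F (gap T s \<omega>)) \<partial>M) * indicator {0<..<b i} s \<partial>lborel)"
    unfolding A_def by (subst ballot_window[OF b F C]) auto
  also have "\<dots> = (\<integral>\<^sup>+s. (SUP i. (\<integral>\<^sup>+\<omega>. ennreal (drop_rate T s \<omega> *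
        F (gap T s \<omega>)) \<partial>M) * indicator {0<..<b i} s) \<partial>lborel)"
  proof (rule nn_integral_monotone_convergence_SUP[symmetric])
    show "incseq (\<lambda>i s. (\<integral>\<^sup>+\<omega>. ennreal (drop_rate T s \<omega> *
        F (gap T s \<omega>)) \<partial>M) * indicator {0<..<b i} s)"
      using b_inc by (force simp: incseq_def le_fun_def indicator_def)
  qed measurable
  also have "\<dots> = ?R"
  proof (intro nn_integral_cong)
    fix s :: real
    have "(\<Union>i. {0<..<b i}) = {0<..<T}"
    proof (intro set_eqI iffI)
      fix s assume "s \<in> (\<Union>i. {0<..<b i})"
      then obtain i where "s \<in> {0<..<b i}" by auto
      then show "s \<in> {0<..<T}" using b[of i] by auto
    qed (use b_lim in auto)
    then show "(SUP i. (\<integral>\<^sup>+\<omega>. ennreal (drop_rate T s \<omega> *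
        F (gap T s \<omega>)) \<partial>M) * indicator {0<..<b i} s) =
       (\<integral>\<^sup>+\<omega>. ennreal (drop_rate T s \<omega> *
        F (gap T s \<omega>)) \<partial>M) * indicator {0<..<T} s"
      by (simp add: SUP_mult_indicator)
  qed
  finally show ?thesis .
qed

text \<open>Both sides integrate \<open>F\<close> against a measure on pairs of a level and a depth
  below it, so it suffices that the two measures agree on Lipschitz functions. Bounded sets have
  finite mass because a bound on the depth confines the level to an interval of that length above
  \<open>X T\<close>.\<close>

theorem ballot_identity:
  fixes F :: "real \<times> real \<Rightarrow> ennreal"
  assumes T: "0 < T" and F [measurable]: "F \<in> borel_measurable borel"
  shows "(\<integral>\<^sup>+\<omega>. \<integral>\<^sup>+v. F (v, v - X T \<omega>) *
        indicator {X T \<omega><..<path_sup (path \<omega>) 0 T} v \<partial>lborel \<partial>M)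
    = (\<integral>\<^sup>+s. (\<integral>\<^sup>+\<omega>. ennreal (drop_rate T s \<omega>) *
        F (gap T s \<omega>) \<partial>M) * indicator {0<..<T} s \<partial>lborel)"
proof -
  have XT [measurable]: "X T \<in> borel_measurable M" using T by (intro meas) auto
  have [measurable]: "(\<lambda>\<omega>. path_sup (path \<omega>) 0 T) \<in> borel_measurable M"
    using T by (auto intro!: path_sup_meas)
  define I where "I = (\<lambda>p. indicator {X T (fst p)<..<path_sup (\<lambda>t. X t (fst p)) 0 T} (snd p) :: ennreal)"
  have I [measurable]: "I \<in> borel_measurable (M \<Otimes>\<^sub>M lborel)"
    unfolding I_def greaterThanLessThan_iff indicator_def by measurable
  define W where "W = (\<lambda>p. ennreal (max 0 (X (max 0 (fst p)) (snd p) - X T (snd p)) / (T - fst p)) * indicator {0<..<T} (fst p))"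
  have Xm [measurable]: "(\<lambda>p. X (max 0 (fst p)) (snd p)) \<in> borel_measurable ((lborel :: real measure) \<Otimes>\<^sub>M M)"
    using joint_meas by (simp add: case_prod_beta')
  have W [measurable]: "W \<in> borel_measurable (lborel \<Otimes>\<^sub>M M)"
    unfolding W_def by measurable
  define N1 where "N1 = distr (density (M \<Otimes>\<^sub>M lborel) I) (borel :: (real \<times> real) measure) (\<lambda>p. (snd p, snd p - X T (fst p)))"
  define N2 where "N2 = distr (density (lborel \<Otimes>\<^sub>M M) W) (borel :: (real \<times> real) measure)
    (\<lambda>p. (X (max 0 (fst p)) (snd p), X (max 0 (fst p)) (snd p) - X T (snd p)))"
  have n1: "(\<integral>\<^sup>+p. G p \<partial>N1) = (\<integral>\<^sup>+\<omega>. \<integral>\<^sup>+v. G (v, v - X T \<omega>) *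
        indicator {X T \<omega><..<path_sup (path \<omega>) 0 T} v \<partial>lborel \<partial>M)"
    if [measurable]: "G \<in> borel_measurable borel" for G
  proof -
    have "(\<integral>\<^sup>+p. G p \<partial>N1) = (\<integral>\<^sup>+p. I p * G (snd p, snd p - X T (fst p)) \<partial>(M \<Otimes>\<^sub>M lborel))"
      unfolding N1_def by (subst nn_integral_distr) (auto simp: nn_integral_density)
    also have "\<dots> = (\<integral>\<^sup>+\<omega>. \<integral>\<^sup>+v. I (\<omega>, v) * G (v, v - X T \<omega>) \<partial>lborel \<partial>M)"
      by (subst lborel.nn_integral_fst[symmetric]) auto
    finally show ?thesis by (simp add: I_def mult.commute)
  qed
  have n2: "(\<integral>\<^sup>+p. G p \<partial>N2) = (\<integral>\<^sup>+s. (\<integral>\<^sup>+\<omega>. ennreal (drop_rate T s \<omega>) *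
        G (gap T s \<omega>) \<partial>M) * indicator {0<..<T} s \<partial>lborel)"
    if [measurable]: "G \<in> borel_measurable borel" for G
  proof -
    have "(\<integral>\<^sup>+p. G p \<partial>N2) = (\<integral>\<^sup>+p. W p * G (X (max 0 (fst p)) (snd p), X (max 0 (fst p)) (snd p) - X T (snd p)) \<partial>(lborel \<Otimes>\<^sub>M M))"
      unfolding N2_def by (subst nn_integral_distr) (auto simp: nn_integral_density)
    also have "\<dots> = (\<integral>\<^sup>+s. \<integral>\<^sup>+\<omega>. W (s, \<omega>) * G (gap T s \<omega>) \<partial>M \<partial>lborel)"
      by (subst nn_integral_fst[symmetric]) auto
    also have "\<dots> = (\<integral>\<^sup>+s. (\<integral>\<^sup>+\<omega>. ennreal (drop_rate T s \<omega>) *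
        G (gap T s \<omega>) \<partial>M) * indicator {0<..<T} s \<partial>lborel)"
    proof (intro nn_integral_cong)
      fix s :: real
      have [measurable]: "X (max 0 s) \<in> borel_measurable M" by (intro meas) simp
      show "(\<integral>\<^sup>+\<omega>. W (s, \<omega>) * G (gap T s \<omega>) \<partial>M) =
        (\<integral>\<^sup>+\<omega>. ennreal (drop_rate T s \<omega>) *
          G (gap T s \<omega>) \<partial>M) * indicator {0<..<T} s"
        by (subst nn_integral_multc[symmetric]) (auto simp: W_def mult_ac)
    qed
    finally show ?thesis .
  qed
  have "N1 = N2"
  proof (rule borel_measure_eqI_lipschitz)
    fix F :: "real \<times> real \<Rightarrow> real" and L
    assume F: "L-lipschitz_on UNIV F" "\<And>p. 0 \<le> F p" "\<And>p. F p \<le> 1" "bounded {p. F p \<noteq> 0}"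
    have [measurable]: "F \<in> borel_measurable borel"
      using lipschitz_on_continuous_on[OF F(1)] by (rule borel_measurable_continuous_onI)
    obtain C where C: "\<And>p. F p \<noteq> 0 \<Longrightarrow> norm p \<le> C" using F(4) by (auto simp: bounded_iff)
    have C0: "F (v, w) = 0" if "max 0 C < w" for v w
      using C[of "(v, w)"] norm_snd_le[of w v] that by force
    have e: "(\<integral>\<^sup>+\<omega>. ennreal (drop_rate T s \<omega>) * ennreal (F (gap T s \<omega>)) \<partial>M) * indicator {0<..<T} s
      = (\<integral>\<^sup>+\<omega>. ennreal (drop_rate T s \<omega> * F (gap T s \<omega>)) \<partial>M) * indicator {0<..<T} s" for s
      using F(2) by (cases "s \<in> {0<..<T}") (auto intro!: nn_integral_cong simp flip: ennreal_mult)
    then show "(\<integral>\<^sup>+p. ennreal (F p) \<partial>N1) = (\<integral>\<^sup>+p. ennreal (F p) \<partial>N2)"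
      using ballot_lipschitz[where C="max 0 C", OF T F(1-3) max.cobounded1 C0]
      by (simp only: n1[of "\<lambda>p. ennreal (F p)"] n2[of "\<lambda>p. ennreal (F p)"] measurable_compose_rev[OF measurable_ennreal] \<open>F \<in> borel_measurable borel\<close> e)
  next
    fix U :: "(real \<times> real) set" assume U: "bounded U" "open U"
    obtain C where C: "\<And>p. p \<in> U \<Longrightarrow> norm p \<le> C" using U by (auto simp: bounded_iff)
    have [measurable]: "U \<in> sets borel" using U by auto
    have "emeasure N1 U = (\<integral>\<^sup>+p. indicator U p \<partial>N1)" by (simp add: N1_def)
    also have "\<dots> \<le> (\<integral>\<^sup>+\<omega>. \<integral>\<^sup>+v. indicator {X T \<omega>..X T \<omega> + max 0 C} v \<partial>lborel \<partial>M)"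
      unfolding n1[OF borel_measurable_indicator[OF \<open>U \<in> sets borel\<close>]]
    proof (intro nn_integral_mono)
      fix \<omega> v
      have "v - X T \<omega> \<le> C" if "(v, v - X T \<omega>) \<in> U"
        using C[OF that] norm_snd_le[of "v - X T \<omega>" v] by force
      then show "indicator U (v, v - X T \<omega>) * indicator {X T \<omega><..<path_sup (path \<omega>) 0 T} v
         \<le> (indicator {X T \<omega>..X T \<omega> + max 0 C} v :: ennreal)"
        by (auto simp: indicator_def)
    qed
    also have "\<dots> = (\<integral>\<^sup>+\<omega>. ennreal (max 0 C) \<partial>M)" by (intro nn_integral_cong) simp
    also have "\<dots> = ennreal (max 0 C)" by (simp add: emeasure_space_1)
    finally show "emeasure N1 U \<noteq> \<infinity>" using neq_top_trans by (metis ennreal_neq_top infinity_ennreal_def)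
  qed (simp_all add: N1_def N2_def)
  then show ?thesis using n1[OF F] n2[OF F] by simp
qed

end

subsection \<open>Independence of past and future\<close>

text \<open>The version for families of paths other than that of the process itself, namely
  restarted and drifted ones.\<close>

lemma path_sup_meas_gen:
  assumes "\<And>\<omega>. \<omega> \<in> space M \<Longrightarrow> no_neg_jump_path (x \<omega>)" "\<And>t. 0 \<le> t \<Longrightarrow> (\<lambda>\<omega>. x \<omega> t) \<in> borel_measurable M"
    and b: "0 \<le> b" "b < T"
  shows "(\<lambda>\<omega>. path_sup (x \<omega>) b T) \<in> borel_measurable M"
proof (rule borel_measurable_LIMSEQ_real[OF grid_max_LIMSEQ[OF assms(1) b]])
  fix n show "(\<lambda>\<omega>. grid_max (x \<omega>) T n (Suc (nat \<lfloor>b * real n / T\<rfloor>))) \<in> borel_measurable M"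
    unfolding grid_max_def by (intro borel_measurable_Max assms(2)) (use b in auto)
qed

context spectrally_positive_levy begin

text \<open>The grids over \<open>{0..a}\<close> and \<open>{a..a + S}\<close>, each with its own
  mesh, are strung into one time sequence \<tau>, to which independence of increments applies; past
  and future then occupy disjoint index blocks.\<close>

lemma grid_incr_indep:
  assumes a: "0 < a" and S: "0 < S" and n: "0 < n"
  shows "indep_var (PiM {..<n} (\<lambda>_. borel)) (\<lambda>\<omega>. \<lambda>i\<in>{..<n}. grid_incr 0 (a / real n) \<omega> i)
      (PiM {..<n} (\<lambda>_. borel)) (\<lambda>\<omega>. \<lambda>i\<in>{..<n}. grid_incr a (S / real n) \<omega> i)"
proof -
  define \<tau> where "\<tau> i = (if i \<le> n then real i * (a / real n) else a + real (i - n) * (S / real n))" for i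
  have \<tau>1: "\<tau> i = real i * (a / real n)" if "i \<le> n" for i using that by (simp add: \<tau>_def)
  have \<tau>2: "\<tau> (n + i) = a + real i * (S / real n)" for i using n by (cases i) (auto simp: \<tau>_def)
  have inc: "\<tau> i \<le> \<tau> (Suc i)" for i
  proof (cases "i < n")
    case True
    then show ?thesis using a by (auto simp: \<tau>1 intro!: divide_right_mono mult_right_mono)
  next
    case False
    then obtain k where k: "i = n + k" by (metis add.commute le_iff_add not_less)
    then have "\<tau> (Suc i) = a + real (Suc k) * (S / real n)" using \<tau>2[of "Suc k"] by simp
    then show ?thesis unfolding k \<tau>2 using S n by (auto intro!: divide_right_mono mult_right_mono)
  qed
  define Y where "Y i \<omega> = X (\<tau> (Suc i)) \<omega> - X (\<tau> i) \<omega>" for i \<omega>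
  have "indep_vars (\<lambda>_. borel) Y {..<n + n}"
    unfolding Y_def by (rule indep) (use inc \<tau>1[of 0] in auto)
  then have "indep_var (PiM {..<n} (\<lambda>_. borel)) (\<lambda>\<omega>. restrict (\<lambda>i. Y i \<omega>) {..<n})
     (PiM {n..<n + n} (\<lambda>_. borel)) (\<lambda>\<omega>. restrict (\<lambda>i. Y i \<omega>) {n..<n + n})"
    by (rule indep_var_restrict) auto
  then have "indep_var (PiM {..<n} (\<lambda>_. borel)) ((\<lambda>x. x) \<circ> (\<lambda>\<omega>. restrict (\<lambda>i. Y i \<omega>) {..<n}))
     (PiM {..<n} (\<lambda>_. borel)) ((\<lambda>x. \<lambda>i\<in>{..<n}. x (n + i)) \<circ> (\<lambda>\<omega>. restrict (\<lambda>i. Y i \<omega>) {n..<n + n}))"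
    by (rule indep_var_compose) (auto intro!: measurable_restrict measurable_component_singleton)
  also have "(\<lambda>x. x) \<circ> (\<lambda>\<omega>. restrict (\<lambda>i. Y i \<omega>) {..<n}) = (\<lambda>\<omega>. \<lambda>i\<in>{..<n}. grid_incr 0 (a / real n) \<omega> i)"
    by (auto simp: fun_eq_iff Y_def grid_incr_def \<tau>1 Suc_le_eq restrict_def)
  also have "(\<lambda>x. \<lambda>i\<in>{..<n}. x (n + i)) \<circ> (\<lambda>\<omega>. restrict (\<lambda>i. Y i \<omega>) {n..<n + n}) = (\<lambda>\<omega>. \<lambda>i\<in>{..<n}. grid_incr a (S / real n) \<omega> i)"
    using \<tau>2[of "Suc _"] by (auto simp: fun_eq_iff Y_def grid_incr_def \<tau>2 restrict_def)
  finally show ?thesis .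
qed

text \<open>The past enters through its end value and supremum, the future through its total
  increment and its supremum after subtraction of a drift \<open>d\<close>. These four numbers are
  all that a restart at a fixed time requires, so no law on path space is involved. On grids the two
  pairs are functions of disjoint blocks of increments; the suprema are limits of grid maxima, and
  Lipschitz test functions carry the equality to the limit.\<close>

lemma markov_distr:
  assumes a: "0 < a" and S: "0 < S"
  shows "distr M borel (\<lambda>\<omega>. ((X a \<omega>, path_sup (path \<omega>) 0 a),
        (X (a + S) \<omega> - X a \<omega>, path_sup (\<lambda>r. X (a + r) \<omega> - X a \<omega> - d * r) 0 S)))
    = distr (M \<Otimes>\<^sub>M M) borel (\<lambda>p. ((X a (fst p), path_sup (\<lambda>t. X t (fst p)) 0 a),
        (X S (snd p), path_sup (\<lambda>r. X r (snd p) - d * r) 0 S)))"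
proof -
  interpret P: pair_prob_space M M ..
  define fut where "fut = (\<lambda>\<omega> r. X (a + r) \<omega> - X a \<omega> - d * r)"
  define fut' where "fut' = (\<lambda>\<omega> r. X r \<omega> - d * r)"
  have nf: "no_neg_jump_path (fut \<omega>)" "no_neg_jump_path (fut' \<omega>)" if "\<omega> \<in> space M" for \<omega>
    unfolding fut_def fut'_def using a regular_path[OF that]
    by (auto intro!: no_neg_jump_path_drift no_neg_jump_path_shift[of "\<lambda>t. X t \<omega>" a])
  have fm: "(\<lambda>\<omega>. fut \<omega> t) \<in> borel_measurable M" "(\<lambda>\<omega>. fut' \<omega> t) \<in> borel_measurable M" if "0 \<le> t" for t
  proof -
    have [measurable]: "X (a + t) \<in> borel_measurable M" "X a \<in> borel_measurable M" "X t \<in> borel_measurable M"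
      using that a by (auto intro!: meas)
    show "(\<lambda>\<omega>. fut \<omega> t) \<in> borel_measurable M" "(\<lambda>\<omega>. fut' \<omega> t) \<in> borel_measurable M"
      unfolding fut_def fut'_def by measurable
  qed
  have [measurable]: "X a \<in> borel_measurable M" "X S \<in> borel_measurable M" "X (a + S) \<in> borel_measurable M"
    using a S by (auto intro!: meas)
  have [measurable]: "(\<lambda>\<omega>. path_sup (path \<omega>) 0 a) \<in> borel_measurable M" using a by (intro path_sup_meas) auto
  have [measurable]: "(\<lambda>\<omega>. path_sup (fut \<omega>) 0 S) \<in> borel_measurable M" "(\<lambda>\<omega>. path_sup (fut' \<omega>) 0 S) \<in> borel_measurable M"
    using S by (auto intro!: path_sup_meas_gen nf fm)
  define p where "p n x = (partial_sum x n, Max (partial_sum x ` {1..n}))" for n x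
  define q where "q n x = (partial_sum x n, Max ((\<lambda>j. partial_sum x j - d * (real j * (S / real n))) ` {1..n}))" for n x
  define Pn where "Pn n \<omega> = (X a \<omega>, grid_max (path \<omega>) a n 1)" for n \<omega>
  define Qn where "Qn n \<omega> = (X (a + S) \<omega> - X a \<omega>, grid_max (fut \<omega>) S n 1)" for n \<omega>
  define Qn' where "Qn' n \<omega> = (X S \<omega>, grid_max (fut' \<omega>) S n 1)" for n \<omega>
  define PP where "PP \<omega> = (X a \<omega>, path_sup (path \<omega>) 0 a)" for \<omega>
  define QQ where "QQ \<omega> = (X (a + S) \<omega> - X a \<omega>, path_sup (fut \<omega>) 0 S)" for \<omega>
  define QQ' where "QQ' \<omega> = (X S \<omega>, path_sup (fut' \<omega>) 0 S)" for \<omega>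
  have [measurable]: "PP \<in> borel_measurable M" "QQ \<in> borel_measurable M" "QQ' \<in> borel_measurable M"
    unfolding PP_def QQ_def QQ'_def by measurable
  have [measurable]: "(\<lambda>\<omega>. grid_max (path \<omega>) a n 1) \<in> borel_measurable M"
    "(\<lambda>\<omega>. grid_max (fut \<omega>) S n 1) \<in> borel_measurable M" "(\<lambda>\<omega>. grid_max (fut' \<omega>) S n 1) \<in> borel_measurable M" for n
    unfolding grid_max_def using a S by (auto intro!: borel_measurable_Max fm meas)
  have [measurable]: "Pn n \<in> borel_measurable M" "Qn n \<in> borel_measurable M" "Qn' n \<in> borel_measurable M" for n
    unfolding Pn_def Qn_def Qn'_def by measurable
  have lim: "(\<lambda>n. Pn n \<omega>) \<longlonglongrightarrow> PP \<omega>" "(\<lambda>n. Qn n \<omega>) \<longlonglongrightarrow> QQ \<omega>" "(\<lambda>n. Qn' n \<omega>) \<longlonglongrightarrow> QQ' \<omega>"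
    if "\<omega> \<in> space M" for \<omega>
    unfolding Pn_def PP_def Qn_def QQ_def Qn'_def QQ'_def
    using grid_max_LIMSEQ[OF regular_path[OF that] order_refl a] grid_max_LIMSEQ[OF nf(1)[OF that] order_refl S]
      grid_max_LIMSEQ[OF nf(2)[OF that] order_refl S]
    by (auto intro!: tendsto_Pair)
  have main: "distr M borel (\<lambda>\<omega>. (PP \<omega>, QQ \<omega>)) = distr (M \<Otimes>\<^sub>M M) borel (\<lambda>z. (PP (fst z), QQ' (snd z)))"
  proof (rule borel_measure_eqI_lipschitz)
    fix F :: "(real \<times> real) \<times> (real \<times> real) \<Rightarrow> real" and L
    assume F: "L-lipschitz_on UNIV F" "\<And>x. 0 \<le> F x" "\<And>x. F x \<le> 1" "bounded {x. F x \<noteq> 0}"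
    have [measurable]: "F \<in> borel_measurable borel"
      using lipschitz_on_continuous_on[OF F(1)] by (rule borel_measurable_continuous_onI)
    have Fc: "isCont F x" for x
      using lipschitz_on_continuous_on[OF F(1)] continuous_on_eq_continuous_at[OF open_UNIV] by blast
    have eqn: "(\<integral>\<^sup>+\<omega>. ennreal (F (Pn n \<omega>, Qn n \<omega>)) \<partial>M) = (\<integral>\<^sup>+z. ennreal (F (Pn n (fst z), Qn' n (snd z))) \<partial>(M \<Otimes>\<^sub>M M))"
      if n: "0 < n" for n
    proof -
      let ?B = "PiM {..<n} (\<lambda>_. borel :: real measure)"
      define \<xi> where "\<xi> \<omega> = (\<lambda>i\<in>{..<n}. grid_incr 0 (a / real n) \<omega> i)" for \<omega>
      define \<zeta> where "\<zeta> \<omega> = (\<lambda>i\<in>{..<n}. grid_incr a (S / real n) \<omega> i)" for \<omega>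
      define \<zeta>' where "\<zeta>' \<omega> = (\<lambda>i\<in>{..<n}. grid_incr 0 (S / real n) \<omega> i)" for \<omega>
      have [measurable]: "\<xi> \<in> measurable M ?B" "\<zeta> \<in> measurable M ?B" "\<zeta>' \<in> measurable M ?B"
        unfolding \<xi>_def \<zeta>_def \<zeta>'_def by (intro measurable_restrict grid_incr_meas; use a S in simp)+
      have [measurable]: "p n \<in> borel_measurable ?B" "q n \<in> borel_measurable ?B"
        unfolding p_def q_def
        by (auto intro!: borel_measurable_Pair borel_measurable_Max borel_measurable_diff partial_sum_measurable)
      have psr: "partial_sum (\<lambda>i\<in>{..<n}. f i) j = (\<Sum>i<j. f i)" if "j \<le> n" for f :: "nat \<Rightarrow> real" and j
        unfolding partial_sum_def using that by (intro sum.cong) auto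
      have pP: "Pn n \<omega> = p n (\<xi> \<omega>)" if "\<omega> \<in> space M" for \<omega>
      proof -
        have "partial_sum (\<xi> \<omega>) j = X (real j * (a / real n)) \<omega>" if "j \<le> n" for j
          unfolding \<xi>_def using psr[OF that] X0[OF \<open>\<omega> \<in> space M\<close>] by (simp add: sum_incr)
        then show ?thesis unfolding Pn_def p_def grid_max_def using n by (auto intro!: arg_cong[of _ _ Max] image_cong)
      qed
      have qQ: "Qn n \<omega> = q n (\<zeta> \<omega>)" for \<omega>
      proof -
        have "partial_sum (\<zeta> \<omega>) j = X (a + real j * (S / real n)) \<omega> - X a \<omega>" if "j \<le> n" for j
          unfolding \<zeta>_def using psr[OF that] by (simp add: sum_incr)
        then show ?thesis unfolding Qn_def q_def grid_max_def fut_def using n by (auto intro!: arg_cong[of _ _ Max] image_cong)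
      qed
      have qQ': "Qn' n \<omega> = q n (\<zeta>' \<omega>)" if "\<omega> \<in> space M" for \<omega>
      proof -
        have "partial_sum (\<zeta>' \<omega>) j = X (real j * (S / real n)) \<omega>" if "j \<le> n" for j
          unfolding \<zeta>'_def using psr[OF that] X0[OF \<open>\<omega> \<in> space M\<close>] by (simp add: sum_incr)
        then show ?thesis unfolding Qn'_def q_def grid_max_def fut'_def using n by (auto intro!: arg_cong[of _ _ Max] image_cong)
      qed
      have "distr M (?B \<Otimes>\<^sub>M ?B) (\<lambda>\<omega>. (\<xi> \<omega>, \<zeta> \<omega>)) = distr M ?B \<xi> \<Otimes>\<^sub>M distr M ?B \<zeta>"
        using grid_incr_indep[OF a S n] unfolding \<xi>_def \<zeta>_def indep_var_distribution_eq by simp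
      also have "distr M ?B \<zeta> = distr M ?B \<zeta>'"
        unfolding \<zeta>_def \<zeta>'_def using a S n by (simp add: grid_incr_distr)
      also have "distr M ?B \<xi> \<Otimes>\<^sub>M distr M ?B \<zeta>' = distr (M \<Otimes>\<^sub>M M) (?B \<Otimes>\<^sub>M ?B) (\<lambda>(\<omega>, \<omega>'). (\<xi> \<omega>, \<zeta>' \<omega>'))"
      proof (rule pair_measure_distr)
        interpret D: prob_space "distr M ?B \<zeta>'" by (rule prob_space_distr) measurable
        show "sigma_finite_measure (distr M ?B \<zeta>')" ..
      qed measurable
      finally have D: "distr M (?B \<Otimes>\<^sub>M ?B) (\<lambda>\<omega>. (\<xi> \<omega>, \<zeta> \<omega>)) = distr (M \<Otimes>\<^sub>M M) (?B \<Otimes>\<^sub>M ?B) (\<lambda>(\<omega>, \<omega>'). (\<xi> \<omega>, \<zeta>' \<omega>'))" .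
      have Gm: "(\<lambda>z. ennreal (F (p n (fst z), q n (snd z)))) \<in> borel_measurable (?B \<Otimes>\<^sub>M ?B)" by measurable
      have "(\<integral>\<^sup>+\<omega>. ennreal (F (Pn n \<omega>, Qn n \<omega>)) \<partial>M) = (\<integral>\<^sup>+\<omega>. ennreal (F (p n (\<xi> \<omega>), q n (\<zeta> \<omega>))) \<partial>M)"
        by (intro nn_integral_cong) (simp add: pP qQ)
      also have "\<dots> = (\<integral>\<^sup>+z. ennreal (F (p n (fst z), q n (snd z))) \<partial>distr M (?B \<Otimes>\<^sub>M ?B) (\<lambda>\<omega>. (\<xi> \<omega>, \<zeta> \<omega>)))"
        by (subst nn_integral_distr) (use Gm in auto)
      also have "\<dots> = (\<integral>\<^sup>+z. ennreal (F (p n (\<xi> (fst z)), q n (\<zeta>' (snd z)))) \<partial>(M \<Otimes>\<^sub>M M))"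
        unfolding D by (subst nn_integral_distr) (use Gm in \<open>auto simp: case_prod_beta'\<close>)
      also have "\<dots> = (\<integral>\<^sup>+z. ennreal (F (Pn n (fst z), Qn' n (snd z))) \<partial>(M \<Otimes>\<^sub>M M))"
        by (intro nn_integral_cong) (auto simp: pP qQ' space_pair_measure)
      finally show ?thesis .
    qed
    have "(\<lambda>n. \<integral>\<^sup>+\<omega>. ennreal (F (Pn n \<omega>, Qn n \<omega>)) \<partial>M) \<longlonglongrightarrow> (\<integral>\<^sup>+\<omega>. ennreal (F (PP \<omega>, QQ \<omega>)) \<partial>M)"
      by (rule nn_integral_dominated_convergence[where w="\<lambda>_. 1"])
        (use F in \<open>auto simp: emeasure_space_1 ennreal_le_1 intro!: tendsto_ennrealI isCont_tendsto_compose[OF Fc] tendsto_Pair lim\<close>)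
    from LIMSEQ_Suc[OF this]
    have 1: "(\<lambda>n. \<integral>\<^sup>+z. ennreal (F (Pn (Suc n) (fst z), Qn' (Suc n) (snd z))) \<partial>(M \<Otimes>\<^sub>M M)) \<longlonglongrightarrow> (\<integral>\<^sup>+\<omega>. ennreal (F (PP \<omega>, QQ \<omega>)) \<partial>M)"
      by (simp only: eqn zero_less_Suc)
    have P1: "emeasure (M \<Otimes>\<^sub>M M) (space M \<times> space M) = 1"
      using P.emeasure_space_1 by (simp add: space_pair_measure)
    have "(\<lambda>n. \<integral>\<^sup>+z. ennreal (F (Pn n (fst z), Qn' n (snd z))) \<partial>(M \<Otimes>\<^sub>M M)) \<longlonglongrightarrow> (\<integral>\<^sup>+z. ennreal (F (PP (fst z), QQ' (snd z))) \<partial>(M \<Otimes>\<^sub>M M))"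
      by (rule nn_integral_dominated_convergence[where w="\<lambda>_. 1"])
        (use F in \<open>auto simp: P1 ennreal_le_1 space_pair_measure intro!: tendsto_ennrealI isCont_tendsto_compose[OF Fc] tendsto_Pair lim\<close>)
    with LIMSEQ_unique[OF 1 LIMSEQ_Suc[OF this]]
    show "(\<integral>\<^sup>+x. ennreal (F x) \<partial>distr M borel (\<lambda>\<omega>. (PP \<omega>, QQ \<omega>))) =
      (\<integral>\<^sup>+x. ennreal (F x) \<partial>distr (M \<Otimes>\<^sub>M M) borel (\<lambda>z. (PP (fst z), QQ' (snd z))))"
      by (simp add: nn_integral_distr)
  next
    fix U :: "((real \<times> real) \<times> (real \<times> real)) set"
    interpret D: prob_space "distr M borel (\<lambda>\<omega>. (PP \<omega>, QQ \<omega>))" by (rule prob_space_distr) measurable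
    show "emeasure (distr M borel (\<lambda>\<omega>. (PP \<omega>, QQ \<omega>))) U \<noteq> \<infinity>" by simp
  qed auto
  then show ?thesis unfolding PP_def QQ_def QQ'_def fut_def fut'_def .
qed

lemma markov_nn_integral:
  assumes a: "0 < a" and S: "0 < S" and H [measurable]: "H \<in> borel_measurable borel"
  shows "(\<integral>\<^sup>+\<omega>. H ((X a \<omega>, path_sup (path \<omega>) 0 a),
        (X (a + S) \<omega> - X a \<omega>, path_sup (\<lambda>r. X (a + r) \<omega> - X a \<omega> - d * r) 0 S)) \<partial>M)
    = (\<integral>\<^sup>+\<omega>. \<integral>\<^sup>+\<omega>'. H ((X a \<omega>, path_sup (path \<omega>) 0 a), (X S \<omega>', path_sup (\<lambda>r. X r \<omega>' - d * r) 0 S)) \<partial>M \<partial>M)"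
proof -
  have [measurable]: "X a \<in> borel_measurable M" "X S \<in> borel_measurable M" "X (a + S) \<in> borel_measurable M"
    using a S by (auto intro!: meas)
  have [measurable]: "(\<lambda>\<omega>. path_sup (path \<omega>) 0 a) \<in> borel_measurable M" using a by (intro path_sup_meas) auto
  have [measurable]: "(\<lambda>\<omega>. path_sup (\<lambda>r. X (a + r) \<omega> - X a \<omega> - d * r) 0 S) \<in> borel_measurable M"
    "(\<lambda>\<omega>. path_sup (\<lambda>r. X r \<omega> - d * r) 0 S) \<in> borel_measurable M"
    using a S by (auto intro!: path_sup_meas_gen no_neg_jump_path_drift no_neg_jump_path_shift regular_path borel_measurable_diff meas)
  have "(\<integral>\<^sup>+\<omega>. H ((X a \<omega>, path_sup (path \<omega>) 0 a),
        (X (a + S) \<omega> - X a \<omega>, path_sup (\<lambda>r. X (a + r) \<omega> - X a \<omega> - d * r) 0 S)) \<partial>M)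
    = (\<integral>\<^sup>+z. H ((X a (fst z), path_sup (\<lambda>t. X t (fst z)) 0 a),
        (X S (snd z), path_sup (\<lambda>r. X r (snd z) - d * r) 0 S)) \<partial>(M \<Otimes>\<^sub>M M))"
    using arg_cong[OF markov_distr[OF a S, of d], of "\<lambda>D. nn_integral D H"]
    by (subst (asm) (1 2) nn_integral_distr) auto
  also have "\<dots> = (\<integral>\<^sup>+\<omega>. \<integral>\<^sup>+\<omega>'. H ((X a \<omega>, path_sup (path \<omega>) 0 a), (X S \<omega>', path_sup (\<lambda>r. X r \<omega>' - d * r) 0 S)) \<partial>M \<partial>M)"
    by (subst nn_integral_fst[symmetric]) auto
  finally show ?thesis .
qed

end

subsection \<open>Pointwise densities\<close>

lemma liminf_mult_le:
  fixes f :: "nat \<Rightarrow> ennreal"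
  shows "liminf f * c \<le> liminf (\<lambda>n. f n * c)"
  unfolding liminf_SUP_INF SUP_mult_right_ennreal
  by (intro SUP_mono') (auto intro!: INF_greatest mult_right_mono INF_lower)

text \<open>Two reals that exceed the same numbers are equal, and \<open>path_sup_gt_iff\<close>
  turns exceeding into the existence of a time, where the shift is immediate.\<close>

lemma path_sup_split:
  assumes x: "no_neg_jump_path x" and a: "0 \<le> a" "a \<le> T"
  shows "path_sup x a T = x a + path_sup (\<lambda>r. x (a + r) - x a) 0 (T - a)"
proof -
  have 1: "v < path_sup x a T \<longleftrightarrow> v - x a < path_sup (\<lambda>r. x (a + r) - x a) 0 (T - a)" for v
  proof -
    have "v < path_sup x a T \<longleftrightarrow> (\<exists>t\<in>{a..T}. v < x t)"
      by (rule path_sup_gt_iff[OF x a])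
    also have "\<dots> \<longleftrightarrow> (\<exists>r\<in>{0..T - a}. v - x a < x (a + r) - x a)"
    proof
      assume "\<exists>t\<in>{a..T}. v < x t"
      then obtain t where "t \<in> {a..T}" "v < x t" by auto
      then show "\<exists>r\<in>{0..T - a}. v - x a < x (a + r) - x a" by (intro bexI[of _ "t - a"]) auto
    next
      assume "\<exists>r\<in>{0..T - a}. v - x a < x (a + r) - x a"
      then obtain r where "r \<in> {0..T - a}" "v - x a < x (a + r) - x a" by auto
      then show "\<exists>t\<in>{a..T}. v < x t" by (intro bexI[of _ "a + r"]) auto
    qed
    also have "\<dots> \<longleftrightarrow> v - x a < path_sup (\<lambda>r. x (a + r) - x a) 0 (T - a)"
      using a by (intro path_sup_gt_iff[symmetric] no_neg_jump_path_shift x) auto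
    finally show ?thesis .
  qed
  show ?thesis
    using 1[of "path_sup x a T"] 1[of "x a + path_sup (\<lambda>r. x (a + r) - x a) 0 (T - a)"] by auto
qed

lemma nn_integral_indicator_compose:
  assumes [measurable]: "Y \<in> borel_measurable M" "A \<in> sets borel"
  shows "(\<integral>\<^sup>+\<omega>. indicator A (Y \<omega>) \<partial>M) = emeasure M {\<omega> \<in> space M. Y \<omega> \<in> A}"
proof -
  have "(\<integral>\<^sup>+\<omega>. indicator A (Y \<omega>) \<partial>M) = (\<integral>\<^sup>+\<omega>. indicator {\<omega> \<in> space M. Y \<omega> \<in> A} \<omega> \<partial>M)"
    by (intro nn_integral_cong) (simp add: indicator_def)
  then show ?thesis by simp
qed

lemma pair_measurable [measurable]:
  "(\<lambda>z :: real \<times> real. fst z) \<in> borel_measurable borel"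
  "(\<lambda>z :: real \<times> real. snd z) \<in> borel_measurable borel"
  by (intro borel_measurable_continuous_onI continuous_intros)+

lemma quadruple_measurable [measurable]:
  "(\<lambda>z :: (real \<times> real) \<times> (real \<times> real). fst (fst z)) \<in> borel_measurable borel"
  "(\<lambda>z :: (real \<times> real) \<times> (real \<times> real). snd (fst z)) \<in> borel_measurable borel"
  "(\<lambda>z :: (real \<times> real) \<times> (real \<times> real). fst (snd z)) \<in> borel_measurable borel"
  "(\<lambda>z :: (real \<times> real) \<times> (real \<times> real). snd (snd z)) \<in> borel_measurable borel"
  by (intro borel_measurable_continuous_onI continuous_intros)+

context spectrally_positive_levy begin

text \<open>The mean of the drop rate over the last \<open>t\<close> units of time; by stationary
  independent increments it does not depend on the past. For \<open>\<phi> = 1\<close> it is minus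
  the factor of the density in the integral of \<open>crossing_formula\<close>.\<close>

definition descent_rate :: "(real \<Rightarrow> real) \<Rightarrow> real \<Rightarrow> ennreal" where
  "descent_rate \<phi> t = (\<integral>\<^sup>+\<omega>. ennreal (max 0 (- X (max 0 t) \<omega>) / t) * ennreal (\<phi> (- X (max 0 t) \<omega>)) \<partial>M)"

text \<open>For \<open>\<phi> = 1\<close> this is the probability of exceeding \<open>v\<close> by
  time \<open>T\<close> and ending below \<open>v\<close>. If \<phi> is the tail of the supremum of
  an independent restarted process, it is the probability that this process in addition exceeds the
  remaining depth.\<close>

definition crossing_weight :: "(real \<Rightarrow> real) \<Rightarrow> real \<Rightarrow> real \<Rightarrow> ennreal" where
  "crossing_weight \<phi> T v = (\<integral>\<^sup>+\<omega>. hit \<phi> 0 T v \<omega> \<partial>M)"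

text \<open>The difference quotient of \<open>lower_right_density\<close> as an extended nonnegative
  number, the form in which Fatou's lemma takes it.\<close>

definition incr_ratio :: "real \<Rightarrow> real \<Rightarrow> real \<Rightarrow> ennreal" where
  "incr_ratio v t h = emeasure M {\<omega> \<in> space M. v < X t \<omega> \<and> X t \<omega> \<le> v + h} * ennreal (1 / h)"

lemma joint_meas' [measurable]: "(\<lambda>p. X (max 0 (fst p)) (snd p)) \<in> borel_measurable ((lborel :: real measure) \<Otimes>\<^sub>M M)"
  using joint_meas by (simp add: case_prod_beta')

lemma descent_rate_meas [measurable]:
  assumes [measurable]: "\<phi> \<in> borel_measurable borel"
  shows "descent_rate \<phi> \<in> borel_measurable borel"
proof -
  have "(\<lambda>t. \<integral>\<^sup>+\<omega>. ennreal (max 0 (- X (max 0 t) \<omega>) / t) * ennreal (\<phi> (- X (max 0 t) \<omega>)) \<partial>M) \<in> borel_measurable lborel"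
    by measurable
  then show ?thesis unfolding descent_rate_def[abs_def] by simp
qed

lemma crossing_weight_pair_meas:
  assumes T: "0 < T" and [measurable]: "\<phi> \<in> borel_measurable borel"
  shows "(\<lambda>p. ennreal (\<phi> (fst p - X T (snd p))) * indicator {X T (snd p)<..<path_sup (\<lambda>t. X t (snd p)) 0 T} (fst p) :: ennreal)
     \<in> borel_measurable ((lborel :: real measure) \<Otimes>\<^sub>M M)"
proof -
  have [measurable]: "X T \<in> borel_measurable M" using T by (intro meas) auto
  have [measurable]: "(\<lambda>\<omega>. path_sup (path \<omega>) 0 T) \<in> borel_measurable M"
    using T by (auto intro!: path_sup_meas)
  show ?thesis unfolding greaterThanLessThan_iff indicator_def by measurable
qed

lemma crossing_weight_meas [measurable]:
  assumes T: "0 < T" and [measurable]: "\<phi> \<in> borel_measurable borel"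
  shows "crossing_weight \<phi> T \<in> borel_measurable borel"
proof -
  have "(\<lambda>v. \<integral>\<^sup>+\<omega>. hit \<phi> 0 T v \<omega> \<partial>M) \<in> borel_measurable lborel"
    using crossing_weight_pair_meas[OF assms] by (intro borel_measurable_nn_integral) (simp add: case_prod_beta')
  then show ?thesis unfolding crossing_weight_def[abs_def] by simp
qed

text \<open>The product test function \<open>g v * \<phi> w\<close> in
  \<open>ballot_identity\<close> turns its left side into an average of the crossing weight over
  levels. As \<open>X T - X s\<close> is independent of \<open>X s\<close>, the expectation on the
  right factors into one of \<open>g\<close> and \<open>descent_rate \<phi> (T - s)\<close>.\<close>

lemma crossing_average:
  assumes T: "0 < T" and [measurable]: "\<phi> \<in> borel_measurable borel" "g \<in> borel_measurable borel"
  shows "(\<integral>\<^sup>+v. g v * crossing_weight \<phi> T v \<partial>lborel) =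
    (\<integral>\<^sup>+s. (\<integral>\<^sup>+\<omega>. g (X (max 0 s) \<omega>) \<partial>M) * descent_rate \<phi> (T - s) * indicator {0<..<T} s \<partial>lborel)"
proof -
  note cm = crossing_weight_pair_meas[OF T assms(2)]
  interpret Q: pair_sigma_finite "lborel :: real measure" M ..
  have XT [measurable]: "X T \<in> borel_measurable M" using T by (intro meas) auto
  have PS [measurable]: "(\<lambda>\<omega>. path_sup (path \<omega>) 0 T) \<in> borel_measurable M"
    using T by (auto intro!: path_sup_meas)
  have "(\<integral>\<^sup>+v. g v * crossing_weight \<phi> T v \<partial>lborel) = (\<integral>\<^sup>+v. \<integral>\<^sup>+\<omega>. g v * (hit \<phi> 0 T v \<omega>) \<partial>M \<partial>lborel)"
    unfolding crossing_weight_def using measurable_compose_Pair1[OF _ cm]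
    by (intro nn_integral_cong nn_integral_cmult[symmetric]) (simp add: space_pair_measure)
  also have "\<dots> = (\<integral>\<^sup>+\<omega>. \<integral>\<^sup>+v. g v * (hit \<phi> 0 T v \<omega>) \<partial>lborel \<partial>M)"
    by (rule Q.Fubini'[symmetric]) (use cm in \<open>simp add: case_prod_beta'\<close>)
  also have "\<dots> = (\<integral>\<^sup>+\<omega>. \<integral>\<^sup>+v. (\<lambda>(v, w). g v * ennreal (\<phi> w)) (v, v - X T \<omega>) *
        indicator {X T \<omega><..<path_sup (path \<omega>) 0 T} v \<partial>lborel \<partial>M)"
    by (simp add: mult.assoc)
  also have "\<dots> = (\<integral>\<^sup>+s. (\<integral>\<^sup>+\<omega>. ennreal (drop_rate T s \<omega>) *
        (\<lambda>(v, w). g v * ennreal (\<phi> w)) (gap T s \<omega>) \<partial>M) * indicator {0<..<T} s \<partial>lborel)"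
    by (rule ballot_identity[OF T]) (unfold case_prod_beta', measurable)
  also have "\<dots> = (\<integral>\<^sup>+s. (\<integral>\<^sup>+\<omega>. g (X (max 0 s) \<omega>) \<partial>M) * descent_rate \<phi> (T - s) * indicator {0<..<T} s \<partial>lborel)"
  proof (intro nn_integral_cong)
    fix s :: real
    show "(\<integral>\<^sup>+\<omega>. ennreal (drop_rate T s \<omega>) *
        (\<lambda>(v, w). g v * ennreal (\<phi> w)) (gap T s \<omega>) \<partial>M) * indicator {0<..<T} s
      = (\<integral>\<^sup>+\<omega>. g (X (max 0 s) \<omega>) \<partial>M) * descent_rate \<phi> (T - s) * indicator {0<..<T} s"
    proof (cases "s \<in> {0<..<T}")
      case True
      then have s: "0 < s" "0 < T - s" by auto
      have [measurable]: "X s \<in> borel_measurable M" "X (T - s) \<in> borel_measurable M" using s by (auto intro!: meas)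
      define H where "H z = ennreal (max 0 (- fst (snd z)) / (T - s)) * (g (fst (fst z)) * ennreal (\<phi> (- fst (snd z))))"
        for z :: "(real \<times> real) \<times> (real \<times> real)"
      have [measurable]: "H \<in> borel_measurable borel" unfolding H_def by measurable
      have "(\<integral>\<^sup>+\<omega>. ennreal (max 0 (X s \<omega> - X T \<omega>) / (T - s)) * (g (X s \<omega>) * ennreal (\<phi> (X s \<omega> - X T \<omega>))) \<partial>M)
        = (\<integral>\<^sup>+\<omega>. \<integral>\<^sup>+\<omega>'. ennreal (max 0 (- X (T - s) \<omega>') / (T - s)) * (g (X s \<omega>) * ennreal (\<phi> (- X (T - s) \<omega>'))) \<partial>M \<partial>M)"
        using markov_nn_integral[OF s, of H 0] by (simp add: H_def)
      also have "\<dots> = (\<integral>\<^sup>+\<omega>. g (X s \<omega>) * (\<integral>\<^sup>+\<omega>'. ennreal (max 0 (- X (T - s) \<omega>') / (T - s)) * ennreal (\<phi> (- X (T - s) \<omega>')) \<partial>M) \<partial>M)"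
        by (subst nn_integral_cmult[symmetric]) (auto intro!: nn_integral_cong simp: mult_ac)
      also have "\<dots> = (\<integral>\<^sup>+\<omega>. g (X s \<omega>) \<partial>M) * descent_rate \<phi> (T - s)"
        using s by (subst nn_integral_multc) (auto simp: descent_rate_def)
      finally show ?thesis using True by simp
    qed simp
  qed
  finally show ?thesis .
qed

lemma crossing_weight_le_1:
  assumes "\<And>z. \<phi> z \<le> 1"
  shows "crossing_weight \<phi> T v \<le> 1"
proof -
  have "crossing_weight \<phi> T v \<le> (\<integral>\<^sup>+\<omega>. 1 \<partial>M)"
    unfolding crossing_weight_def using assms
    by (intro nn_integral_mono) (auto simp: indicator_def ennreal_le_1)
  then show ?thesis by (simp add: emeasure_space_1)
qed

text \<open>Conditioning on \<open>X s\<close> shifts the interval by an independent amount; for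
  small \<open>h\<close> this is what compares the derivative at time \<open>s + t\<close> with a
  convolution.\<close>

lemma incr_ratio_add:
  assumes "0 < s" "0 < t"
  shows "incr_ratio v (s + t) h = (\<integral>\<^sup>+\<omega>. incr_ratio (v - X s \<omega>) t h \<partial>M)"
proof -
  have [measurable]: "X s \<in> borel_measurable M" "X t \<in> borel_measurable M" "X (s + t) \<in> borel_measurable M"
    using assms by (auto intro!: meas)
  define H where "H z = (indicator {v<..v + h} (fst (fst z) + fst (snd z)) :: ennreal)"
    for z :: "(real \<times> real) \<times> (real \<times> real)"
  have [measurable]: "H \<in> borel_measurable borel" unfolding H_def by measurable
  have e: "emeasure M {\<omega> \<in> space M. c < X r \<omega> \<and> X r \<omega> \<le> d} = (\<integral>\<^sup>+\<omega>. indicator {c<..d} (X r \<omega>) \<partial>M)"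
    if "X r \<in> borel_measurable M" for c d r
    using that by (subst nn_integral_indicator_compose) auto
  have i: "indicator {v - X s \<omega><..v - X s \<omega> + h} y = (indicator {v<..v + h} (X s \<omega> + y) :: ennreal)" for \<omega> y
    by (auto simp: indicator_def)
  have "(\<integral>\<^sup>+\<omega>. indicator {v<..v + h} (X (s + t) \<omega>) \<partial>M) = (\<integral>\<^sup>+\<omega>. \<integral>\<^sup>+\<omega>'. indicator {v<..v + h} (X s \<omega> + X t \<omega>') \<partial>M \<partial>M)"
    using markov_nn_integral[OF assms, of H 0] by (simp add: H_def)
  then show ?thesis
    unfolding incr_ratio_def by (subst nn_integral_multc) (auto simp: e i)
qed

lemma lower_right_density_seq:
  assumes t: "0 < t" and h: "h \<longlonglongrightarrow> 0" "\<And>n. 0 < h n" and c: "0 \<le> c" "ereal c < lower_right_density M X v t"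
  shows "ennreal c \<le> liminf (\<lambda>n. incr_ratio v t (h n))"
proof (rule Liminf_bounded)
  have "\<forall>\<^sub>F e in at_right 0. ereal c < ereal (measure M {\<omega> \<in> space M. v < X t \<omega> \<and> X t \<omega> \<le> v + e} / e)"
    using c(2) unfolding lower_right_density_def by (rule less_LiminfD)
  moreover have "filterlim h (at_right 0) sequentially"
    using h by (auto simp: filterlim_at less_imp_neq[OF h(2), symmetric])
  ultimately have "\<forall>\<^sub>F n in sequentially. ereal c < ereal (measure M {\<omega> \<in> space M. v < X t \<omega> \<and> X t \<omega> \<le> v + h n} / h n)"
    by (rule eventually_compose_filterlim)
  then show "\<forall>\<^sub>F n in sequentially. ennreal c \<le> incr_ratio v t (h n)"
  proof eventually_elim
    case (elim n)
    have "incr_ratio v t (h n) = ennreal (measure M {\<omega> \<in> space M. v < X t \<omega> \<and> X t \<omega> \<le> v + h n} / h n)"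
      unfolding incr_ratio_def emeasure_eq_measure using h(2)[of n] by (simp add: divide_inverse flip: ennreal_mult)
    then show ?case using elim by (auto intro!: ennreal_leI)
  qed
qed

lemma lower_right_density_seq_infinite:
  assumes t: "0 < t" and h: "h \<longlonglongrightarrow> 0" "\<And>n. 0 < h n" and D: "lower_right_density M X v t = \<infinity>"
  shows "liminf (\<lambda>n. incr_ratio v t (h n)) = \<infinity>"
proof (rule ccontr)
  assume "liminf (\<lambda>n. incr_ratio v t (h n)) \<noteq> \<infinity>"
  then obtain n :: nat where n: "liminf (\<lambda>n. incr_ratio v t (h n)) < of_nat n"
    using ennreal_Ex_less_of_nat by (auto simp: less_top)
  have "ennreal (real n) \<le> liminf (\<lambda>n. incr_ratio v t (h n))"
    by (rule lower_right_density_seq[OF t h]) (auto simp: D)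
  then show False using n by (simp add: ennreal_of_nat_eq_real_of_nat)
qed

lemma lower_right_density_seq_finite:
  assumes t: "0 < t" and h: "h \<longlonglongrightarrow> 0" "\<And>n. 0 < h n" and D: "lower_right_density M X v t = ereal q" "0 \<le> q"
  shows "ennreal q \<le> liminf (\<lambda>n. incr_ratio v t (h n))"
proof (rule ccontr)
  assume "\<not> ?thesis"
  then have lt: "liminf (\<lambda>n. incr_ratio v t (h n)) < ennreal q" by simp
  then obtain l where l: "0 \<le> l" "liminf (\<lambda>n. incr_ratio v t (h n)) = ennreal l"
    by (cases "liminf (\<lambda>n. incr_ratio v t (h n))") auto
  then have "l < q" using lt by (simp add: ennreal_less_iff)
  \<comment> \<open>Only numbers strictly below the derivative are known to be eventually exceeded
    by the quotients; the midpoint is such a number and still larger than \<open>l\<close>.\<close>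
  then have "ennreal ((l + q) / 2) \<le> ennreal l"
    unfolding l(2)[symmetric] using l(1) D by (intro lower_right_density_seq[OF t h]) auto
  then show False using \<open>l < q\<close> l(1) by (simp add: ennreal_le_iff)
qed

end

text \<open>Measurability on the whole plane and nonnegativity everywhere keep time restrictions out
  of the measurability arguments; extending a density by 0 to times \<open>t \<le> 0\<close>
  achieves both.\<close>

locale spectrally_positive_levy_density = spectrally_positive_levy +
  fixes p :: "real \<Rightarrow> real \<Rightarrow> real"
  assumes p_meas: "(\<lambda>z. p (fst z) (snd z)) \<in> borel_measurable borel"
    and p_nonneg: "0 \<le> p u t"
    and p_density: "0 < t \<Longrightarrow> distributed M lborel (X t) (\<lambda>u. ennreal (p u t))"
    and p_version: "AE t in lborel. 0 < t \<longrightarrow>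
      (\<forall>u. lower_right_density M X u t < \<infinity> \<longrightarrow> ereal (p u t) = lower_right_density M X u t)"
begin

lemma p_meas' [measurable (raw)]:
  assumes [measurable]: "f \<in> borel_measurable N" "g \<in> borel_measurable N"
  shows "(\<lambda>x. p (f x) (g x)) \<in> borel_measurable N"
  using measurable_compose[OF borel_measurable_Pair[OF assms] p_meas] by simp

lemma nn_integral_X:
  assumes t: "0 < t" and [measurable]: "g \<in> borel_measurable borel"
  shows "(\<integral>\<^sup>+\<omega>. g (X t \<omega>) \<partial>M) = (\<integral>\<^sup>+a. ennreal (p a t) * g a \<partial>lborel)"
  using distributed_nn_integral[OF p_density[OF t], of g] by simp

lemma AE_X_neq: "0 < t \<Longrightarrow> AE \<omega> in M. X t \<omega> \<noteq> u"
proof -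
  assume t: "0 < t"
  have [measurable]: "X t \<in> borel_measurable M" using t by (intro meas) auto
  have "emeasure M {\<omega> \<in> space M. X t \<omega> = u} = (\<integral>\<^sup>+\<omega>. indicator {u} (X t \<omega>) \<partial>M)"
    by (subst nn_integral_indicator_compose) auto
  also have "\<dots> = (\<integral>\<^sup>+a. ennreal (p a t) * indicator {u} a \<partial>lborel)" by (rule nn_integral_X[OF t]) measurable
  also have "\<dots> = (\<integral>\<^sup>+a. 0 \<partial>(lborel :: real measure))"
  proof (rule nn_integral_cong_AE)
    show "AE a in lborel. ennreal (p a t) * indicator {u} a = 0"
      using AE_lborel_singleton[of u] by eventually_elim simp
  qed
  finally have "emeasure M {\<omega> \<in> space M. X t \<omega> = u} = 0" by simp
  then show ?thesis by (intro AE_I[of _ _ "{\<omega> \<in> space M. X t \<omega> = u}"]) auto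
qed

text \<open>The condition holds at all levels at once because the convolution evaluates the density
  at the random level \<open>u - X s \<omega>\<close>.\<close>

definition good_time :: "real \<Rightarrow> bool" where
  "good_time t \<longleftrightarrow> 0 < t \<and> (\<forall>u. lower_right_density M X u t < \<infinity> \<longrightarrow> ereal (p u t) = lower_right_density M X u t)"

text \<open>An infinite derivative makes the lower limit infinite, so the inequality survives at the
  levels where \<open>p\<close> is unconstrained.\<close>

lemma good_time_seq:
  assumes t: "good_time t" and h: "h \<longlonglongrightarrow> 0" "\<And>n. 0 < h n"
  shows "ennreal (p v t) \<le> liminf (\<lambda>n. incr_ratio v t (h n))"
proof (cases "lower_right_density M X v t = \<infinity>")
  case True
  have "0 < t" using t unfolding good_time_def by (rule conjunct1)
  then have "liminf (\<lambda>n. incr_ratio v t (h n)) = \<infinity>"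
    by (rule lower_right_density_seq_infinite[OF _ h True])
  then show ?thesis by simp
next
  case False
  have t0: "0 < t" using t unfolding good_time_def by (rule conjunct1)
  from False have "lower_right_density M X v t < \<infinity>" by simp
  then have "lower_right_density M X v t = ereal (p v t)" using t unfolding good_time_def by metis
  then show ?thesis by (rule lower_right_density_seq_finite[OF t0 h _ p_nonneg])
qed

lemma ex_good_time: "0 < e \<Longrightarrow> \<exists>t. 0 < t \<and> t < e \<and> good_time t"
proof (rule ccontr)
  assume e: "0 < e" and no: "\<nexists>t. 0 < t \<and> t < e \<and> good_time t"
  have "AE t in lborel. t \<notin> {0<..<e}"
    using p_version by eventually_elim (use no in \<open>auto simp: good_time_def\<close>)
  moreover have "{t \<in> space lborel. \<not> t \<notin> {0<..<e}} = {0<..<e}" by auto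
  ultimately have "emeasure lborel {0<..<e} = 0" by (subst (asm) AE_iff_measurable[OF _ refl]) simp_all
  then show False using e by simp
qed

text \<open>If the convolution exceeded \<open>p u (s + \<epsilon>)\<close>, a number
  \<open>c\<close> in between would bound the difference quotients at time
  \<open>s + \<epsilon>\<close> along some \<open>h n\<close> tending to 0, since \<open>p\<close>
  is their lower limit. These quotients are those at time \<epsilon> averaged over
  \<open>X s\<close>, so Fatou's lemma would bound the convolution by \<open>c\<close>.\<close>

lemma good_time_convolution:
  assumes s: "0 < s" and e: "good_time \<epsilon>" and D: "lower_right_density M X u (s + \<epsilon>) < \<infinity>"
    "ereal (p u (s + \<epsilon>)) = lower_right_density M X u (s + \<epsilon>)"
  shows "(\<integral>\<^sup>+\<omega>. ennreal (p (u - X s \<omega>) \<epsilon>) \<partial>M) \<le> ennreal (p u (s + \<epsilon>))"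
proof (rule ccontr)
  have e0: "0 < \<epsilon>" using e by (simp add: good_time_def)
  have Xs [measurable]: "X s \<in> borel_measurable M" "X \<epsilon> \<in> borel_measurable M" using s e0 by (auto intro!: meas)
  assume "\<not> ?thesis"
  then have lt: "ennreal (p u (s + \<epsilon>)) < (\<integral>\<^sup>+\<omega>. ennreal (p (u - X s \<omega>) \<epsilon>) \<partial>M)" by simp
  then obtain y where y: "ennreal (p u (s + \<epsilon>)) < y" "y < (\<integral>\<^sup>+\<omega>. ennreal (p (u - X s \<omega>) \<epsilon>) \<partial>M)"
    using dense[OF lt] by blast
  then have "y \<noteq> top" by auto
  then obtain c where c: "y = ennreal c" "0 \<le> c" by (cases y) auto
  have pc: "p u (s + \<epsilon>) < c" using y(1) p_nonneg[of u "s + \<epsilon>"] unfolding c(1) by (simp add: ennreal_less_iff)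
  define R where "R h = measure M {\<omega> \<in> space M. u < X (s + \<epsilon>) \<omega> \<and> X (s + \<epsilon>) \<omega> \<le> u + h} / h" for h
  have "\<not> (\<forall>\<^sub>F h in at_right 0. ereal c \<le> ereal (R h))"
  proof
    assume "\<forall>\<^sub>F h in at_right 0. ereal c \<le> ereal (R h)"
    then have "ereal c \<le> lower_right_density M X u (s + \<epsilon>)"
      unfolding lower_right_density_def R_def by (rule Liminf_bounded)
    then show False using pc D(2)[symmetric] by simp
  qed
  then have ex: "\<exists>h. 0 < h \<and> h < b \<and> R h < c" if "0 < b" for b
    unfolding eventually_at_right_field ereal_less_eq using that by (meson not_le)
  have "\<exists>h. 0 < h \<and> h < inverse (real (Suc n)) \<and> R h < c" for n by (rule ex) simp
  then have "\<forall>n. \<exists>h. 0 < h \<and> h < inverse (real (Suc n)) \<and> R h < c" ..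
  then obtain h where "\<forall>n. 0 < h n \<and> h n < inverse (real (Suc n)) \<and> R (h n) < c" unfolding choice_iff ..
  then have h: "\<And>n. 0 < h n" "\<And>n. h n < inverse (real (Suc n))" "\<And>n. R (h n) < c" by blast+
  have "\<forall>\<^sub>F n in sequentially. 0 \<le> h n" "\<forall>\<^sub>F n in sequentially. h n \<le> inverse (real (Suc n))"
    by (intro always_eventually allI less_imp_le h)+
  then have h0: "h \<longlonglongrightarrow> 0"
    by (rule tendsto_sandwich[OF _ _ tendsto_const LIMSEQ_inverse_real_of_nat])
  have R: "incr_ratio u (s + \<epsilon>) (h n) = ennreal (R (h n))" for n
    unfolding incr_ratio_def emeasure_eq_measure R_def using h(1)[of n] by (simp add: divide_inverse flip: ennreal_mult)
  have rm: "(\<lambda>\<omega>. incr_ratio (u - X s \<omega>) \<epsilon> (h n)) \<in> borel_measurable M" for n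
  proof -
    have [measurable]: "(\<lambda>z. indicator {u - X s (fst z)<..u - X s (fst z) + h n} (X \<epsilon> (snd z)) :: ennreal) \<in> borel_measurable (M \<Otimes>\<^sub>M M)"
      unfolding greaterThanAtMost_iff indicator_def by measurable
    have "(\<lambda>\<omega>. (\<integral>\<^sup>+\<omega>'. indicator {u - X s \<omega><..u - X s \<omega> + h n} (X \<epsilon> \<omega>') \<partial>M) * ennreal (1 / h n)) \<in> borel_measurable M"
      by (intro borel_measurable_times_ennreal borel_measurable_nn_integral) (simp_all add: case_prod_beta')
    then show ?thesis unfolding incr_ratio_def by (simp add: nn_integral_indicator_compose)
  qed
  have "(\<integral>\<^sup>+\<omega>. ennreal (p (u - X s \<omega>) \<epsilon>) \<partial>M) \<le> (\<integral>\<^sup>+\<omega>. liminf (\<lambda>n. incr_ratio (u - X s \<omega>) \<epsilon> (h n)) \<partial>M)"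
    by (intro nn_integral_mono good_time_seq e h0 h)
  also have "\<dots> \<le> liminf (\<lambda>n. \<integral>\<^sup>+\<omega>. incr_ratio (u - X s \<omega>) \<epsilon> (h n) \<partial>M)"
    by (intro nn_integral_liminf rm)
  also have "\<dots> = liminf (\<lambda>n. ennreal (R (h n)))"
    by (simp add: incr_ratio_add[OF s e0, symmetric] R)
  also have "\<dots> \<le> liminf (\<lambda>n. ennreal c)"
    using h(3) by (intro Liminf_mono always_eventually allI ennreal_leI) (auto intro: less_imp_le)
  also have "\<dots> = ennreal c" by (simp add: Liminf_const)
  finally show False using y c by simp
qed

section \<open>The crossing weight at a fixed level\<close>

context
  fixes \<phi> :: "real \<Rightarrow> real" and T :: real
  assumes T: "0 < T" and phi [measurable]: "\<phi> \<in> borel_measurable borel"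
    and phi01: "\<And>z. 0 \<le> \<phi> z" "\<And>z. \<phi> z \<le> 1"
    and phi_right: "\<And>z. 0 \<le> z \<Longrightarrow> (\<phi> \<longlongrightarrow> \<phi> z) (at_right z)"
begin

text \<open>Approaching \<open>u\<close> from the right matters twice: \<phi> is only assumed
  right-continuous, and if \<open>u\<close> is the supremum, larger levels stay outside the open
  interval while smaller ones may lie inside. The event that the final value equals \<open>u\<close>
  is null.\<close>

lemma crossing_weight_right_continuous:
  assumes d: "d \<longlonglongrightarrow> 0" "\<And>n. 0 < d n"
  shows "(\<lambda>n. crossing_weight \<phi> T (u + d n)) \<longlonglongrightarrow> crossing_weight \<phi> T u"
  unfolding crossing_weight_def
proof (rule nn_integral_dominated_convergence[where w="\<lambda>_. 1"])
  have [measurable]: "X T \<in> borel_measurable M" using T by (intro meas) auto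
  have [measurable]: "(\<lambda>\<omega>. path_sup (path \<omega>) 0 T) \<in> borel_measurable M"
    using T by (auto intro!: path_sup_meas)
  show "(\<lambda>\<omega>. hit \<phi> 0 T v \<omega>) \<in> borel_measurable M" for v
    unfolding greaterThanLessThan_iff indicator_def by measurable
  then show "(\<lambda>\<omega>. hit \<phi> 0 T v \<omega>) \<in> borel_measurable M" for v .
  show "AE \<omega> in M. hit \<phi> 0 T (u + d n) \<omega> \<le> 1" for n
    using phi01 by (intro AE_I2) (auto simp: indicator_def ennreal_le_1)
  have ud: "(\<lambda>n. u + d n) \<longlonglongrightarrow> u" using tendsto_add[OF tendsto_const d(1), of u] by simp
  show "AE \<omega> in M. (\<lambda>n. hit \<phi> 0 T (u + d n) \<omega>)
     \<longlonglongrightarrow> hit \<phi> 0 T u \<omega>"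
    using AE_X_neq[OF T, of u]
  proof eventually_elim
    case (elim \<omega>)
    let ?A = "{X T \<omega><..<path_sup (path \<omega>) 0 T}"
    consider "u < X T \<omega>" | "path_sup (path \<omega>) 0 T \<le> u" | "u \<in> ?A" using elim by fastforce
    then show ?case
    proof cases
      case 1
      then have "\<forall>\<^sub>F n in sequentially. u + d n < X T \<omega>" by (rule order_tendstoD(2)[OF ud])
      then have "\<forall>\<^sub>F n in sequentially. ennreal (\<phi> (u - X T \<omega>)) * indicator ?A u = ennreal (\<phi> (u + d n - X T \<omega>)) * indicator ?A (u + d n)"
        by eventually_elim (use 1 in auto)
      then show ?thesis by (rule Lim_transform_eventually[OF tendsto_const])
    next
      case 2
      then have "u + d n \<notin> ?A" "u \<notin> ?A" for n using d(2)[of n] by auto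
      then show ?thesis by simp
    next
      case 3
      then have "\<forall>\<^sub>F n in sequentially. u + d n \<in> ?A"
        by (intro topological_tendstoD[OF ud]) auto
      then have "\<forall>\<^sub>F n in sequentially. ennreal (\<phi> (u + d n - X T \<omega>)) = ennreal (\<phi> (u + d n - X T \<omega>)) * indicator ?A (u + d n)"
        by eventually_elim auto
      moreover have flt: "filterlim (\<lambda>n. u + d n - X T \<omega>) (at_right (u - X T \<omega>)) sequentially"
        unfolding filterlim_at using d(2) less_imp_neq[OF d(2), symmetric] by (auto intro!: tendsto_diff ud)
      have "(\<phi> \<longlongrightarrow> \<phi> (u - X T \<omega>)) (at_right (u - X T \<omega>))" by (rule phi_right) (use 3 in auto)
      then have "(\<lambda>n. \<phi> (u + d n - X T \<omega>)) \<longlonglongrightarrow> \<phi> (u - X T \<omega>)"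
        using flt by (rule filterlim_compose)
      then have "(\<lambda>n. ennreal (\<phi> (u + d n - X T \<omega>))) \<longlonglongrightarrow> ennreal (\<phi> (u - X T \<omega>)) * indicator ?A u"
        using 3 by (simp add: tendsto_ennrealI)
      ultimately show ?thesis by (rule Lim_transform_eventually[rotated])
    qed
  qed
qed (auto simp: emeasure_space_1)

text \<open>When the level is averaged over an interval of length \<open>h\<close> to the right of
  \<open>u\<close>, the factor at time \<open>s\<close> in \<open>crossing_average\<close> is the
  difference quotient at \<open>u\<close>. The averages converge by right-continuity, and Fatou's
  lemma gives the inequality. Its finite right side also forces the lower limit of the quotients to
  be finite at almost every \<open>s\<close> where \<open>descent_rate\<close> is not 0, so that
  \<open>p\<close> is pinned down there.\<close>

lemma crossing_weight_fatou:
  shows "AE s in lborel. s \<in> {0<..<T} \<longrightarrow> descent_rate \<phi> (T - s) = 0 \<or>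
      (lower_right_density M X u s < \<infinity> \<and> ereal (p u s) = lower_right_density M X u s)"
    and "(\<integral>\<^sup>+s. descent_rate \<phi> (T - s) * ennreal (p u s) * indicator {0<..<T} s \<partial>lborel) \<le> crossing_weight \<phi> T u"
proof -
  define h where "h n = 1 / real (Suc n)" for n
  have h: "h \<longlonglongrightarrow> 0" unfolding h_def by (rule LIMSEQ_Suc[OF lim_const_over_n])
  have h: "h \<longlonglongrightarrow> 0" "\<And>n. 0 < h n" by (fact h) (simp add: h_def)
  define g where "g n v = ennreal (1 / h n) * indicator {u<..u + h n} v" for n v
  have [measurable]: "g n \<in> borel_measurable borel" for n unfolding g_def by measurable
  define q' where "q' n s = (\<integral>\<^sup>+\<omega>. g n (X (max 0 s) \<omega>) \<partial>M)" for n s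
  have q': "q' n s = incr_ratio u s (h n)" if s: "0 < s" for n s
  proof -
    have [measurable]: "X s \<in> borel_measurable M" using s by (intro meas) auto
    have "emeasure M {\<omega> \<in> space M. u < X s \<omega> \<and> X s \<omega> \<le> u + h n} = (\<integral>\<^sup>+\<omega>. indicator {u<..u + h n} (X s \<omega>) \<partial>M)"
      by (subst nn_integral_indicator_compose) auto
    then show ?thesis using s unfolding q'_def g_def incr_ratio_def by (simp add: nn_integral_cmult mult.commute)
  qed
  have [measurable]: "q' n \<in> borel_measurable borel" for n
  proof -
    have "q' n \<in> borel_measurable lborel" unfolding q'_def[abs_def] by measurable
    then show ?thesis by simp
  qed
  \<comment> \<open>The substitution \<open>v = u + h n * r\<close> moves all averages to the fixed
    window \<open>0 < r \<le> 1\<close>, where dominated convergence applies.\<close>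
  have avg: "(\<integral>\<^sup>+v. g n v * crossing_weight \<phi> T v \<partial>lborel) = (\<integral>\<^sup>+r. crossing_weight \<phi> T (u + h n * r) * indicator {0<..1} r \<partial>lborel)" for n
  proof -
    have cm [measurable]: "crossing_weight \<phi> T \<in> borel_measurable borel" by (rule crossing_weight_meas[OF T phi])
    have "(\<integral>\<^sup>+v. g n v * crossing_weight \<phi> T v \<partial>lborel) = ennreal \<bar>h n\<bar> * (\<integral>\<^sup>+r. g n (u + h n * r) * crossing_weight \<phi> T (u + h n * r) \<partial>lborel)"
      using h(2)[of n] by (intro nn_integral_real_affine) auto
    also have "\<dots> = (\<integral>\<^sup>+r. ennreal \<bar>h n\<bar> * (g n (u + h n * r) * crossing_weight \<phi> T (u + h n * r)) \<partial>lborel)"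
      by (intro nn_integral_cmult[symmetric]) measurable
    also have "\<dots> = (\<integral>\<^sup>+r. crossing_weight \<phi> T (u + h n * r) * indicator {0<..1} r \<partial>lborel)"
    proof (intro nn_integral_cong)
      fix r
      have "ennreal \<bar>h n\<bar> * ennreal (1 / h n) = 1" using h(2)[of n] by (simp flip: ennreal_mult)
      moreover have "indicator {u<..u + h n} (u + h n * r) = (indicator {0<..1} r :: ennreal)"
        using h(2)[of n] by (auto simp: indicator_def zero_less_mult_iff mult_le_cancel_left1 not_less)
      ultimately show "ennreal \<bar>h n\<bar> * (g n (u + h n * r) * crossing_weight \<phi> T (u + h n * r)) = crossing_weight \<phi> T (u + h n * r) * indicator {0<..1} r"
        unfolding g_def by (simp add: mult_ac flip: mult.assoc)
    qed
    finally show ?thesis .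
  qed
  have lim: "(\<lambda>n. \<integral>\<^sup>+r. crossing_weight \<phi> T (u + h n * r) * indicator {0<..1} r \<partial>lborel) \<longlonglongrightarrow> (\<integral>\<^sup>+r. crossing_weight \<phi> T u * indicator {0<..1::real} r \<partial>lborel)"
  proof (rule nn_integral_dominated_convergence[where w="\<lambda>r. indicator {0<..1} r"])
    have cm [measurable]: "crossing_weight \<phi> T \<in> borel_measurable borel" by (rule crossing_weight_meas[OF T phi])
    show "(\<lambda>r. crossing_weight \<phi> T (u + h n * r) * indicator {0<..1} r) \<in> borel_measurable lborel" for n by measurable
    show "AE r in lborel. crossing_weight \<phi> T (u + h n * r) * indicator {0<..1} r \<le> indicator {0<..1} r" for n
      using crossing_weight_le_1[of \<phi>, OF phi01(2)] by (intro AE_I2) (auto simp: indicator_def)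
    show "AE r in lborel. (\<lambda>n. crossing_weight \<phi> T (u + h n * r) * indicator {0<..1} r) \<longlonglongrightarrow> crossing_weight \<phi> T u * indicator {0<..1} r"
    proof (rule AE_I2)
      fix r :: real
      show "(\<lambda>n. crossing_weight \<phi> T (u + h n * r) * indicator {0<..1} r) \<longlonglongrightarrow> crossing_weight \<phi> T u * indicator {0<..1} r"
      proof (cases "r \<in> {0<..1}")
        case True
        have "(\<lambda>n. crossing_weight \<phi> T (u + h n * r)) \<longlonglongrightarrow> crossing_weight \<phi> T u"
          by (rule crossing_weight_right_continuous) (use True h(2) tendsto_mult_left_zero[OF h(1), of r] in auto)
        then show ?thesis using True by simp
      qed simp
    qed
  qed auto
  define V where "V n s = q' n s * (descent_rate \<phi> (T - s) * indicator {0<..<T} s)" for n s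
  have Vint: "(\<integral>\<^sup>+s. V n s \<partial>lborel) = (\<integral>\<^sup>+r. crossing_weight \<phi> T (u + h n * r) * indicator {0<..1} r \<partial>lborel)" for n
    unfolding avg[symmetric] V_def q'_def by (subst crossing_average[OF T phi]) (auto simp: mult.assoc)
  define L where "L s = liminf (\<lambda>n. q' n s)" for s
  have [measurable]: "L \<in> borel_measurable borel" unfolding L_def[abs_def] by measurable
  have "(\<integral>\<^sup>+s. L s * (descent_rate \<phi> (T - s) * indicator {0<..<T} s) \<partial>lborel) \<le> (\<integral>\<^sup>+s. liminf (\<lambda>n. V n s) \<partial>lborel)"
    unfolding L_def V_def by (intro nn_integral_mono liminf_mult_le)
  also have "\<dots> \<le> liminf (\<lambda>n. \<integral>\<^sup>+s. V n s \<partial>lborel)"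
    unfolding V_def by (intro nn_integral_liminf) measurable
  also have "\<dots> = (\<integral>\<^sup>+r. crossing_weight \<phi> T u * indicator {0<..1::real} r \<partial>lborel)"
    unfolding Vint by (rule lim_imp_Liminf[OF _ lim]) simp
  also have "\<dots> = crossing_weight \<phi> T u" by (simp add: nn_integral_cmult)
  finally have Lint: "(\<integral>\<^sup>+s. L s * (descent_rate \<phi> (T - s) * indicator {0<..<T} s) \<partial>lborel) \<le> crossing_weight \<phi> T u" .
  then have "(\<integral>\<^sup>+s. L s * (descent_rate \<phi> (T - s) * indicator {0<..<T} s) \<partial>lborel) \<noteq> \<infinity>"
    using crossing_weight_le_1[of \<phi> T u, OF phi01(2)] by (auto simp: top_unique)
  then have fin: "AE s in lborel. L s * (descent_rate \<phi> (T - s) * indicator {0<..<T} s) \<noteq> \<infinity>"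
    by (intro nn_integral_noteq_infinite) measurable
  have main: "AE s in lborel. s \<in> {0<..<T} \<longrightarrow> descent_rate \<phi> (T - s) = 0 \<or>
      (lower_right_density M X u s < \<infinity> \<and> ereal (p u s) = lower_right_density M X u s \<and> ennreal (p u s) \<le> L s)"
    using fin p_version
  proof eventually_elim
    case (elim s)
    show ?case
    proof (intro impI)
      assume s: "s \<in> {0<..<T}"
      show "descent_rate \<phi> (T - s) = 0 \<or>
      (lower_right_density M X u s < \<infinity> \<and> ereal (p u s) = lower_right_density M X u s \<and> ennreal (p u s) \<le> L s)"
      proof (cases "descent_rate \<phi> (T - s) = 0")
        case k: False
        have s0: "0 < s" using s by simp
        have Ls: "L s = liminf (\<lambda>n. incr_ratio u s (h n))" unfolding L_def q'[OF s0] ..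
        \<comment> \<open>A finite product with nonzero second factor has a finite first factor,
          whereas an infinite derivative would make \<open>L s\<close> infinite.\<close>
        have "L s \<noteq> \<infinity>" using elim(1) k s by (auto simp: ennreal_mult_eq_top_iff)
        then have D: "lower_right_density M X u s < \<infinity>"
          using lower_right_density_seq_infinite[OF s0 h, of u] Ls by (metis ereal_infty_less(1))
        then have e: "ereal (p u s) = lower_right_density M X u s" using elim(2) s0 by auto
        have "ennreal (p u s) \<le> L s"
          unfolding Ls by (rule lower_right_density_seq_finite[OF s0 h e[symmetric] p_nonneg])
        then show ?thesis using D e by blast
      qed simp
    qed
  qed
  then show "AE s in lborel. s \<in> {0<..<T} \<longrightarrow> descent_rate \<phi> (T - s) = 0 \<or>
      (lower_right_density M X u s < \<infinity> \<and> ereal (p u s) = lower_right_density M X u s)"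
    by (rule eventually_mono) blast
  have "(\<integral>\<^sup>+s. descent_rate \<phi> (T - s) * ennreal (p u s) * indicator {0<..<T} s \<partial>lborel)
    \<le> (\<integral>\<^sup>+s. L s * (descent_rate \<phi> (T - s) * indicator {0<..<T} s) \<partial>lborel)"
  proof (rule nn_integral_mono_AE)
    show "AE s in lborel. descent_rate \<phi> (T - s) * ennreal (p u s) * indicator {0<..<T} s \<le> L s * (descent_rate \<phi> (T - s) * indicator {0<..<T} s)"
      using main
    proof eventually_elim
      case (elim s)
      show ?case
      proof (cases "s \<in> {0<..<T} \<and> descent_rate \<phi> (T - s) \<noteq> 0")
        case True
        then have "descent_rate \<phi> (T - s) * ennreal (p u s) \<le> descent_rate \<phi> (T - s) * L s" using elim by (intro mult_left_mono) auto
        then show ?thesis using True by (simp add: mult.commute)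
      next
        case False
        then show ?thesis by (auto simp: indicator_def)
      qed
    qed
  qed
  then show "(\<integral>\<^sup>+s. descent_rate \<phi> (T - s) * ennreal (p u s) * indicator {0<..<T} s \<partial>lborel) \<le> crossing_weight \<phi> T u"
    using Lint by (rule order_trans)
qed

text \<open>After time \<epsilon> the level still to be crossed is \<open>u - X \<epsilon>\<close>,
  so the fixed level has become an average over levels. For almost every \<open>s\<close> that
  contributes, \<open>crossing_weight_fatou\<close> supplies the finite derivative under which
  \<open>good_time_convolution\<close> bounds the resulting convolution by
  \<open>p u s\<close>.\<close>

lemma crossing_weight_after:
  assumes e: "good_time \<epsilon>" "\<epsilon> < T"
  shows "(\<integral>\<^sup>+\<omega>. hit \<phi> \<epsilon> T u \<omega> \<partial>M)
    \<le> (\<integral>\<^sup>+s. descent_rate \<phi> (T - s) * ennreal (p u s) * indicator {0<..<T} s \<partial>lborel)"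
proof -
  have e0: "0 < \<epsilon>" "0 < T - \<epsilon>" using e by (auto simp: good_time_def)
  have cm [measurable]: "crossing_weight \<phi> (T - \<epsilon>) \<in> borel_measurable borel" by (rule crossing_weight_meas[OF e0(2) phi])
  define H where "H z = ennreal (\<phi> (u - (fst (fst z) + fst (snd z)))) *
      indicator {fst (fst z) + fst (snd z)<..<fst (fst z) + snd (snd z)} u"
    for z :: "(real \<times> real) \<times> (real \<times> real)"
  have [measurable]: "H \<in> borel_measurable borel"
    unfolding H_def greaterThanLessThan_iff indicator_def by measurable
  define m where "m s = (\<integral>\<^sup>+\<omega>. ennreal (p (u - X (max 0 s) \<omega>) \<epsilon>) \<partial>M)" for s
  have [measurable]: "m \<in> borel_measurable borel"
  proof -
    have "m \<in> borel_measurable lborel" unfolding m_def[abs_def] by measurable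
    then show ?thesis by simp
  qed
  have "(\<integral>\<^sup>+\<omega>. hit \<phi> \<epsilon> T u \<omega> \<partial>M)
    = (\<integral>\<^sup>+\<omega>. H ((X \<epsilon> \<omega>, path_sup (path \<omega>) 0 \<epsilon>),
        (X (\<epsilon> + (T - \<epsilon>)) \<omega> - X \<epsilon> \<omega>, path_sup (\<lambda>r. X (\<epsilon> + r) \<omega> - X \<epsilon> \<omega> - 0 * r) 0 (T - \<epsilon>))) \<partial>M)"
    using e0 by (intro nn_integral_cong) (simp add: H_def path_sup_split[OF regular_path])
  also have "\<dots> = (\<integral>\<^sup>+\<omega>. \<integral>\<^sup>+\<omega>'. H ((X \<epsilon> \<omega>, path_sup (path \<omega>) 0 \<epsilon>),
       (X (T - \<epsilon>) \<omega>', path_sup (\<lambda>r. X r \<omega>' - 0 * r) 0 (T - \<epsilon>))) \<partial>M \<partial>M)"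
    by (rule markov_nn_integral[OF e0]) measurable
  also have "\<dots> = (\<integral>\<^sup>+\<omega>. crossing_weight \<phi> (T - \<epsilon>) (u - X \<epsilon> \<omega>) \<partial>M)"
    unfolding crossing_weight_def H_def by (intro nn_integral_cong) (auto simp: indicator_def algebra_simps)
  also have "\<dots> = (\<integral>\<^sup>+a. ennreal (p a \<epsilon>) * crossing_weight \<phi> (T - \<epsilon>) (u - a) \<partial>lborel)"
    by (rule nn_integral_X[OF e0(1)]) measurable
  also have "\<dots> = ennreal \<bar>-1\<bar> * (\<integral>\<^sup>+v. ennreal (p (u + (-1) * v) \<epsilon>) * crossing_weight \<phi> (T - \<epsilon>) (u - (u + (-1) * v)) \<partial>lborel)"
    by (rule nn_integral_real_affine) auto
  also have "\<dots> = (\<integral>\<^sup>+v. ennreal (p (u - v) \<epsilon>) * crossing_weight \<phi> (T - \<epsilon>) v \<partial>lborel)" by simp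
  also have "\<dots> = (\<integral>\<^sup>+s. m s * descent_rate \<phi> (T - \<epsilon> - s) * indicator {0<..<T - \<epsilon>} s \<partial>lborel)"
    unfolding m_def by (rule crossing_average[OF e0(2) phi]) measurable
  \<comment> \<open>Shifting time by \<epsilon> turns the remaining horizon
    \<open>T - \<epsilon>\<close> back into \<open>T\<close> in the argument of
    \<open>descent_rate\<close>.\<close>
  also have "\<dots> = ennreal \<bar>1\<bar> * (\<integral>\<^sup>+s. m (-\<epsilon> + 1 * s) * descent_rate \<phi> (T - \<epsilon> - (-\<epsilon> + 1 * s)) * indicator {0<..<T - \<epsilon>} (-\<epsilon> + 1 * s) \<partial>lborel)"
    by (rule nn_integral_real_affine) auto
  also have "\<dots> = (\<integral>\<^sup>+s. m (s - \<epsilon>) * descent_rate \<phi> (T - s) * indicator {\<epsilon><..<T} s \<partial>lborel)"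
    by (auto intro!: nn_integral_cong simp: indicator_def)
  also have "\<dots> \<le> (\<integral>\<^sup>+s. descent_rate \<phi> (T - s) * ennreal (p u s) * indicator {0<..<T} s \<partial>lborel)"
  proof (rule nn_integral_mono_AE)
    show "AE s in lborel. m (s - \<epsilon>) * descent_rate \<phi> (T - s) * indicator {\<epsilon><..<T} s \<le> descent_rate \<phi> (T - s) * ennreal (p u s) * indicator {0<..<T} s"
      using crossing_weight_fatou(1)[of u]
    proof eventually_elim
      case (elim s)
      show ?case
      proof (cases "s \<in> {\<epsilon><..<T} \<and> descent_rate \<phi> (T - s) \<noteq> 0")
        case True
        then have "m (s - \<epsilon>) \<le> ennreal (p u s)"
          using elim e0 good_time_convolution[of "s - \<epsilon>" \<epsilon> u, OF _ e(1)] by (auto simp: m_def)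
        then have "m (s - \<epsilon>) * descent_rate \<phi> (T - s) \<le> ennreal (p u s) * descent_rate \<phi> (T - s)" by (intro mult_right_mono) auto
        then show ?thesis using True e0 by (simp add: mult.commute)
      next
        case False
        then show ?thesis by (auto simp: indicator_def)
      qed
    qed
  qed
  finally show ?thesis .
qed

text \<open>For the upper bound \<epsilon> tends to 0 along good times, and the weights of crossings
  during \<open>{\<epsilon>..T}\<close> converge to the full weight.\<close>

theorem crossing_weight_density:
  assumes u: "0 \<le> u"
  shows "crossing_weight \<phi> T u = (\<integral>\<^sup>+s. descent_rate \<phi> (T - s) * ennreal (p u s) * indicator {0<..<T} s \<partial>lborel)" (is "_ = ?I")
proof (rule antisym[OF _ crossing_weight_fatou(2)])
  have "\<exists>t. 0 < t \<and> t < T / real (Suc n) \<and> good_time t" for n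
    using T by (intro ex_good_time) simp
  then obtain e where e: "\<And>n. 0 < e n" "\<And>n. e n < T / real (Suc n)" "\<And>n. good_time (e n)" by metis
  have eT: "e n < T" for n
  proof -
    have "T / real (Suc n) \<le> T" using T by (simp add: field_simps)
    then show ?thesis using e(2)[of n] by linarith
  qed
  have "\<forall>\<^sub>F n in sequentially. 0 \<le> e n" "\<forall>\<^sub>F n in sequentially. e n \<le> T / real (Suc n)"
    by (intro always_eventually allI less_imp_le e)+
  then have e0: "e \<longlonglongrightarrow> 0"
    by (rule tendsto_sandwich[OF _ _ tendsto_const LIMSEQ_Suc[OF lim_const_over_n[of T]]])
  have [measurable]: "X T \<in> borel_measurable M" using T by (intro meas) auto
  have [measurable]: "(\<lambda>\<omega>. path_sup (path \<omega>) (e n) T) \<in> borel_measurable M"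
     "(\<lambda>\<omega>. path_sup (path \<omega>) 0 T) \<in> borel_measurable M" for n
    using T e(1)[of n] eT[of n] by (auto intro!: path_sup_meas)
  have "(\<lambda>n. \<integral>\<^sup>+\<omega>. hit \<phi> (e n) T u \<omega> \<partial>M) \<longlonglongrightarrow> crossing_weight \<phi> T u"
    unfolding crossing_weight_def
  proof (rule nn_integral_dominated_convergence[where w="\<lambda>_. 1"])
    show "(\<lambda>\<omega>. hit \<phi> (e n) T u \<omega>) \<in> borel_measurable M"
      "(\<lambda>\<omega>. hit \<phi> 0 T u \<omega>) \<in> borel_measurable M" for n
      unfolding greaterThanLessThan_iff indicator_def by measurable
    show "AE \<omega> in M. hit \<phi> (e n) T u \<omega> \<le> 1" for n
      using phi01 by (intro AE_I2) (auto simp: indicator_def ennreal_le_1)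
    show "AE \<omega> in M. (\<lambda>n. hit \<phi> (e n) T u \<omega>)
       \<longlonglongrightarrow> hit \<phi> 0 T u \<omega>"
    proof (rule AE_I2)
      fix \<omega> assume \<omega>: "\<omega> \<in> space M"
      have "\<forall>\<^sub>F n in sequentially. (u < path_sup (path \<omega>) (e n) T) = (u < path_sup (path \<omega>) 0 T)"
      proof (cases "u < path_sup (path \<omega>) 0 T")
        case True
        then obtain t where t: "t \<in> {0..T}" "u < X t \<omega>" using path_sup_gt_iff[OF regular_path[OF \<omega>], of 0 T u] T by auto
        \<comment> \<open>As \<open>X 0 \<omega> = 0 \<le> u\<close>, a time at which the path is
          above \<open>u\<close> is positive, and hence eventually larger than
          \<open>e n\<close>.\<close>
        then have "0 < t" using X0[OF \<omega>] u by (cases "t = 0") auto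
        then have "\<forall>\<^sub>F n in sequentially. e n < t" by (rule order_tendstoD(2)[OF e0])
        then show ?thesis
        proof eventually_elim
          case (elim n)
          have "X t \<omega> \<le> path_sup (path \<omega>) (e n) T"
            using elim t e(1)[of n] by (intro path_sup_upper[OF regular_path[OF \<omega>]]) auto
          then show ?case using True t by auto
        qed
      next
        case False
        have "\<not> u < path_sup (path \<omega>) (e n) T" for n
          using False path_sup_gt_iff[OF regular_path[OF \<omega>], of 0 T u] path_sup_gt_iff[OF regular_path[OF \<omega>], of "e n" T u] T e(1)[of n] eT[of n]
          by force
        then show ?thesis using False by simp
      qed
      then have "\<forall>\<^sub>F n in sequentially. hit \<phi> 0 T u \<omega> =
         hit \<phi> (e n) T u \<omega>"
        by eventually_elim (auto simp: indicator_def)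
      then show "(\<lambda>n. hit \<phi> (e n) T u \<omega>)
       \<longlonglongrightarrow> hit \<phi> 0 T u \<omega>"
        by (rule Lim_transform_eventually[OF tendsto_const])
    qed
  qed (auto simp: emeasure_space_1)
  then show "crossing_weight \<phi> T u \<le> ?I"
    by (rule LIMSEQ_le_const2) (use crossing_weight_after e(3) eT in blast)
qed

end

end

subsection \<open>Passing between the process and its version\<close>

text \<open>Independence depends on the joint law only, and the joint law does not see null
  sets.\<close>

lemma (in prob_space) indep_vars_cong_AE:
  assumes ind: "indep_vars (\<lambda>_. borel :: real measure) X I" and I: "I \<noteq> {}"
    and X: "\<And>i. i \<in> I \<Longrightarrow> X i \<in> borel_measurable M" and Y: "\<And>i. i \<in> I \<Longrightarrow> Y i \<in> borel_measurable M"
    and eq: "AE \<omega> in M. \<forall>i\<in>I. X i \<omega> = Y i \<omega>"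
  shows "indep_vars (\<lambda>_. borel :: real measure) Y I"
proof -
  have "distr M (PiM I (\<lambda>_. borel)) (\<lambda>\<omega>. \<lambda>i\<in>I. Y i \<omega>) = distr M (PiM I (\<lambda>_. borel)) (\<lambda>\<omega>. \<lambda>i\<in>I. X i \<omega>)"
  proof (rule distr_cong_AE[OF refl refl])
    show "AE \<omega> in M. (\<lambda>i\<in>I. Y i \<omega>) = (\<lambda>i\<in>I. X i \<omega>)"
      using eq by eventually_elim (auto simp: fun_eq_iff)
  qed (auto intro!: measurable_restrict X Y)
  also have "\<dots> = PiM I (\<lambda>i. distr M borel (X i))"
    using ind I X by (subst (asm) indep_vars_iff_distr_eq_PiM') auto
  also have "\<dots> = PiM I (\<lambda>i. distr M borel (Y i))"
  proof (rule PiM_cong[OF refl])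
    fix i assume i: "i \<in> I"
    have "AE \<omega> in M. X i \<omega> = Y i \<omega>" using eq by eventually_elim (use i in auto)
    then show "distr M borel (X i) = distr M borel (Y i)"
      by (intro distr_cong_AE X[OF i] Y[OF i] refl)
  qed
  finally show ?thesis
    using I Y by (subst indep_vars_iff_distr_eq_PiM') auto
qed

lemma (in prob_space) indep_vars_empty: "indep_vars M' X {}"
  by (simp add: indep_vars_def indep_sets_def)

text \<open>On a measurable null set containing all exceptional paths the process is set to 0,
  itself an admissible path. Regularity then holds for every \<omega>, so suprema and limits can be
  handled pointwise on the whole space.\<close>

lemma levy_process_version:
  assumes L: "levy_process M Z" and P: "spectrally_positive M Z"
  shows "\<exists>X. spectrally_positive_levy M X \<and> (AE \<omega> in M. \<forall>t. X t \<omega> = Z t \<omega>)"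
proof -
  interpret prob_space M using L by (simp add: levy_process_def)
  have Zm: "Z t \<in> borel_measurable M" if "0 \<le> t" for t using L that by (simp add: levy_process_def)
  have "AE \<omega> in M. Z 0 \<omega> = 0 \<and> (\<forall>t>0. \<forall>l. ((\<lambda>s. Z s \<omega>) \<longlongrightarrow> l) (at_left t) \<longrightarrow> l \<le> Z t \<omega>)"
    using L P unfolding levy_process_def spectrally_positive_def by (intro AE_conjI) auto
  then obtain N where N: "N \<in> null_sets M"
    "{\<omega> \<in> space M. \<not> (Z 0 \<omega> = 0 \<and> (\<forall>t>0. \<forall>l. ((\<lambda>s. Z s \<omega>) \<longlongrightarrow> l) (at_left t) \<longrightarrow> l \<le> Z t \<omega>))} \<subseteq> N"
    by (rule AE_E3) (auto simp: subset_eq)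
  define X where "X t \<omega> = (if \<omega> \<in> N then 0 else Z t \<omega>)" for t \<omega>
  have [measurable]: "N \<in> sets M" using N by auto
  have eq: "AE \<omega> in M. \<forall>t. X t \<omega> = Z t \<omega>"
    using AE_not_in[OF N(1)] by eventually_elim (simp add: X_def)
  have Xm: "X t \<in> borel_measurable M" if "0 \<le> t" for t
    unfolding X_def using Zm[OF that] by measurable
  have "spectrally_positive_levy M X"
  proof
    show "0 \<le> t \<Longrightarrow> X t \<in> borel_measurable M" for t by (rule Xm)
  next
    fix \<omega> assume \<omega>: "\<omega> \<in> space M"
    show "no_neg_jump_path (\<lambda>t. X t \<omega>)"
    proof (cases "\<omega> \<in> N")
      case True
      then show ?thesis by (auto simp: no_neg_jump_path_def X_def intro!: exI[of _ 0])
    next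
      case False
      then have Z: "Z 0 \<omega> = 0" "\<And>t l. 0 < t \<Longrightarrow> ((\<lambda>s. Z s \<omega>) \<longlongrightarrow> l) (at_left t) \<Longrightarrow> l \<le> Z t \<omega>"
        using N(2) \<omega> by blast+
      have "\<exists>l. ((\<lambda>s. Z s \<omega>) \<longlongrightarrow> l) (at_left t)" if "0 < t" for t
        using L \<omega> that by (simp add: levy_process_def)
      moreover have "continuous (at_right t) (\<lambda>s. Z s \<omega>)" if "0 \<le> t" for t
        using L \<omega> that by (simp add: levy_process_def)
      ultimately show ?thesis using False Z unfolding no_neg_jump_path_def X_def by (simp only: if_False) blast
    qed
  next
    fix \<tau> :: "nat \<Rightarrow> real" and n
    assume \<tau>: "0 \<le> \<tau> 0" "\<And>i. i < n \<Longrightarrow> \<tau> i \<le> \<tau> (Suc i)"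
    have \<tau>0: "0 \<le> \<tau> i" if "i \<le> n" for i
      using that by (induction i) (use \<tau> in \<open>auto intro: order_trans simp: Suc_le_eq\<close>)
    show "indep_vars (\<lambda>_. borel) (\<lambda>i \<omega>. X (\<tau> (Suc i)) \<omega> - X (\<tau> i) \<omega>) {..<n}"
    proof (cases "n = 0")
      case True
      then show ?thesis by (simp add: indep_vars_empty)
    next
      case False
      have "indep_vars (\<lambda>_. borel) (\<lambda>i \<omega>. Z (\<tau> (Suc i)) \<omega> - Z (\<tau> i) \<omega>) {..<n}"
        using L \<tau> unfolding levy_process_def by blast
      then show ?thesis
      proof (rule indep_vars_cong_AE)
        show "AE \<omega> in M. \<forall>i\<in>{..<n}. Z (\<tau> (Suc i)) \<omega> - Z (\<tau> i) \<omega> = X (\<tau> (Suc i)) \<omega> - X (\<tau> i) \<omega>"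
          using eq by eventually_elim simp
      qed (use False \<tau>0 in \<open>auto intro!: borel_measurable_diff Zm Xm\<close>)
    qed
  next
    fix s h :: real assume sh: "0 \<le> s" "0 \<le> h"
    have sh': "0 \<le> s + h" using sh by simp
    have "AE \<omega> in M. X (s + h) \<omega> - X s \<omega> = Z (s + h) \<omega> - Z s \<omega>" using eq by eventually_elim simp
    then have "distr M borel (\<lambda>\<omega>. X (s + h) \<omega> - X s \<omega>) = distr M borel (\<lambda>\<omega>. Z (s + h) \<omega> - Z s \<omega>)"
      by (intro distr_cong_AE borel_measurable_diff Xm Zm sh sh' refl)
    moreover have "distr M borel (\<lambda>\<omega>. Z (s + h) \<omega> - Z s \<omega>) = distr M borel (Z h)" using L sh by (simp add: levy_process_def)
    moreover have "AE \<omega> in M. Z h \<omega> = X h \<omega>" using eq by eventually_elim simp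
    then have "distr M borel (Z h) = distr M borel (X h)"
      by (intro distr_cong_AE Xm Zm sh refl)
    ultimately show "distr M borel (\<lambda>\<omega>. X (s + h) \<omega> - X s \<omega>) = distr M borel (X h)" by simp
  qed
  then show ?thesis using eq by blast
qed

lemma spectrally_positive_levy_drift:
  assumes "spectrally_positive_levy M X"
  shows "spectrally_positive_levy M (\<lambda>t \<omega>. X t \<omega> - c * t)"
proof -
  interpret spectrally_positive_levy M X by fact
  show ?thesis
  proof
    show "0 \<le> t \<Longrightarrow> (\<lambda>\<omega>. X t \<omega> - c * t) \<in> borel_measurable M" for t
      by (intro borel_measurable_diff meas) auto
    show "\<omega> \<in> space M \<Longrightarrow> no_neg_jump_path (\<lambda>t. X t \<omega> - c * t)" for \<omega>
      by (intro no_neg_jump_path_drift regular_path)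
  next
    fix \<tau> :: "nat \<Rightarrow> real" and n
    assume \<tau>: "0 \<le> \<tau> 0" "\<And>i. i < n \<Longrightarrow> \<tau> i \<le> \<tau> (Suc i)"
    have "indep_vars (\<lambda>_. borel) (\<lambda>i \<omega>. (\<lambda>x. x - c * (\<tau> (Suc i) - \<tau> i)) (X (\<tau> (Suc i)) \<omega> - X (\<tau> i) \<omega>)) {..<n}"
      by (rule indep_vars_compose2[OF indep[OF \<tau>]]) auto
    then show "indep_vars (\<lambda>_. borel) (\<lambda>i \<omega>. X (\<tau> (Suc i)) \<omega> - c * \<tau> (Suc i) - (X (\<tau> i) \<omega> - c * \<tau> i)) {..<n}"
      by (simp add: algebra_simps)
  next
    fix s h :: real assume sh: "0 \<le> s" "0 \<le> h"
    have [measurable]: "X (s + h) \<in> borel_measurable M" "X (h + s) \<in> borel_measurable M" "X s \<in> borel_measurable M" "X h \<in> borel_measurable M"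
      using sh by (auto intro!: meas)
    have "distr M borel (\<lambda>\<omega>. X (s + h) \<omega> - c * (s + h) - (X s \<omega> - c * s)) =
      distr (distr M borel (\<lambda>\<omega>. X (s + h) \<omega> - X s \<omega>)) borel (\<lambda>x. x - c * h)"
      by (subst distr_distr) (auto simp: comp_def algebra_simps)
    also have "\<dots> = distr M borel (\<lambda>\<omega>. X h \<omega> - c * h)"
      unfolding stat[OF sh] by (subst distr_distr) (auto simp: comp_def)
    finally show "distr M borel (\<lambda>\<omega>. X (s + h) \<omega> - c * (s + h) - (X s \<omega> - c * s)) = distr M borel (\<lambda>\<omega>. X h \<omega> - c * h)" .
  qed
qed

text \<open>Subtracting the drift turns the crossing of a line into the crossing of a level. Both
  the density and its lower right derivative move along \<open>u + c * t\<close>, which is how the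
  arguments on lines in \<open>crossing_formula\<close> arise.\<close>

lemma spectrally_positive_levy_density_drift:
  assumes X: "spectrally_positive_levy M X" and eq: "AE \<omega> in M. \<forall>t. X t \<omega> = Z t \<omega>"
    and Zm: "\<And>t. 0 \<le> t \<Longrightarrow> Z t \<in> borel_measurable M"
    and D: "density_family M Z f" and V: "pointwise_version M Z f"
  shows "spectrally_positive_levy_density M (\<lambda>t \<omega>. X t \<omega> - c * t) (\<lambda>u t. if 0 < t then f (u + c * t) t else 0)"
proof -
  interpret spectrally_positive_levy M "\<lambda>t \<omega>. X t \<omega> - c * t" using spectrally_positive_levy_drift[OF X] .
  have lrd: "lower_right_density M (\<lambda>t \<omega>. X t \<omega> - c * t) u t = lower_right_density M Z (u + c * t) t" if t: "0 \<le> t" for u t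
  proof -
    have [measurable]: "Z t \<in> borel_measurable M" "X t \<in> borel_measurable M"
      using t Zm spectrally_positive_levy.meas[OF X] by auto
    have "measure M {\<omega> \<in> space M. u < X t \<omega> - c * t \<and> X t \<omega> - c * t \<le> u + h} =
      measure M {\<omega> \<in> space M. u + c * t < Z t \<omega> \<and> Z t \<omega> \<le> u + c * t + h}" for h
    proof (rule measure_eq_AE)
      show "AE \<omega> in M. (\<omega> \<in> {\<omega> \<in> space M. u < X t \<omega> - c * t \<and> X t \<omega> - c * t \<le> u + h}) =
         (\<omega> \<in> {\<omega> \<in> space M. u + c * t < Z t \<omega> \<and> Z t \<omega> \<le> u + c * t + h})"
        using eq by eventually_elim auto
    qed measurable
    then show ?thesis unfolding lower_right_density_def by simp
  qed
  show ?thesis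
  proof
    define g :: "real \<times> real \<Rightarrow> real" where "g = (\<lambda>z. indicator (UNIV \<times> {0<..}) z *\<^sub>R (case z of (u, t) \<Rightarrow> f u t))"
    have "g \<in> borel_measurable borel"
      unfolding g_def using D by (simp add: density_family_def set_borel_measurable_def)
    moreover have "(\<lambda>z :: real \<times> real. (fst z + c * snd z, snd z)) \<in> borel_measurable borel"
      by (intro borel_measurable_continuous_onI continuous_intros)
    ultimately have "(\<lambda>z. g (fst z + c * snd z, snd z)) \<in> borel_measurable borel"
      by (rule measurable_compose[rotated])
    moreover have "g (fst z + c * snd z, snd z) = (if 0 < snd z then f (fst z + c * snd z) (snd z) else 0)" for z
      by (simp add: g_def)
    ultimately show "(\<lambda>z. if 0 < snd z then f (fst z + c * snd z) (snd z) else 0) \<in> borel_measurable borel"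
      by simp
    show "0 \<le> (if 0 < t then f (u + c * t) t else 0)" for u t using D by (simp add: density_family_def)
  next
    fix t :: real assume t: "0 < t"
    have [measurable]: "Z t \<in> borel_measurable M" "X t \<in> borel_measurable M"
      using t Zm spectrally_positive_levy.meas[OF X] by auto
    have "distributed M lborel (Z t) (\<lambda>u. ennreal (f u t))" using D t by (simp add: density_family_def)
    from distributed_affine[OF this, of 1 "- (c * t)"]
    have d: "distributed M lborel (\<lambda>\<omega>. Z t \<omega> - c * t) (\<lambda>u. ennreal (f (u + c * t) t))" by (simp add: divide_ennreal_def)
    have "AE \<omega> in M. X t \<omega> - c * t = Z t \<omega> - c * t" using eq by eventually_elim simp
    then have "distr M lborel (\<lambda>\<omega>. X t \<omega> - c * t) = distr M lborel (\<lambda>\<omega>. Z t \<omega> - c * t)"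
      by (intro distr_cong_AE refl) measurable
    then show "distributed M lborel (\<lambda>\<omega>. X t \<omega> - c * t) (\<lambda>u. ennreal (if 0 < t then f (u + c * t) t else 0))"
      using d t unfolding distributed_def by simp
  next
    show "AE t in lborel. 0 < t \<longrightarrow> (\<forall>u. lower_right_density M (\<lambda>t \<omega>. X t \<omega> - c * t) u t < \<infinity> \<longrightarrow>
       ereal (if 0 < t then f (u + c * t) t else 0) = lower_right_density M (\<lambda>t \<omega>. X t \<omega> - c * t) u t)"
      using V unfolding pointwise_version_def
    proof eventually_elim
      case (elim t)
      show ?case
      proof (intro impI allI)
        fix u assume "0 < t" "lower_right_density M (\<lambda>t \<omega>. X t \<omega> - c * t) u t < \<infinity>"
        then show "ereal (if 0 < t then f (u + c * t) t else 0) = lower_right_density M (\<lambda>t \<omega>. X t \<omega> - c * t) u t"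
          using elim lrd[of t u] by simp
      qed
    qed
  qed
qed

section \<open>From extended nonnegative integrals to the real-valued formulas\<close>

lemma integral_enn2real:
  assumes [measurable]: "G \<in> borel_measurable M" and fin: "(\<integral>\<^sup>+x. G x \<partial>M) \<noteq> \<infinity>"
  shows "(\<integral>x. enn2real (G x) \<partial>M) = enn2real (\<integral>\<^sup>+x. G x \<partial>M)"
proof -
  have "(\<integral>x. enn2real (G x) \<partial>M) = enn2real (\<integral>\<^sup>+x. ennreal (enn2real (G x)) \<partial>M)"
    by (intro integral_eq_nn_integral) auto
  also have "(\<integral>\<^sup>+x. ennreal (enn2real (G x)) \<partial>M) = (\<integral>\<^sup>+x. G x \<partial>M)"
  proof (rule nn_integral_cong_AE)
    have "AE x in M. G x \<noteq> \<infinity>" using fin by (intro nn_integral_noteq_infinite) auto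
    then show "AE x in M. ennreal (enn2real (G x)) = G x"
      by eventually_elim (simp add: ennreal_enn2real_if)
  qed
  finally show ?thesis .
qed

context spectrally_positive_levy begin

lemma sup_event:
  assumes S: "0 < S"
  shows "{\<omega> \<in> space M. \<exists>t\<in>{0..S}. X t \<omega> > z} = {\<omega> \<in> space M. z < path_sup (path \<omega>) 0 S}"
    and "{\<omega> \<in> space M. \<exists>t\<in>{0..S}. X t \<omega> > z} \<in> sets M"
proof -
  show e: "{\<omega> \<in> space M. \<exists>t\<in>{0..S}. X t \<omega> > z} = {\<omega> \<in> space M. z < path_sup (path \<omega>) 0 S}"
    using path_sup_gt_iff[OF regular_path order_refl less_imp_le[OF S]] by blast
  have [measurable]: "(\<lambda>\<omega>. path_sup (path \<omega>) 0 S) \<in> borel_measurable M" using S by (intro path_sup_meas) auto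
  show "{\<omega> \<in> space M. \<exists>t\<in>{0..S}. X t \<omega> > z} \<in> sets M" unfolding e by measurable
qed

lemma sup_prob_antimono:
  assumes S: "0 < S" and "z \<le> z'"
  shows "measure M {\<omega> \<in> space M. \<exists>t\<in>{0..S}. X t \<omega> > z'} \<le> measure M {\<omega> \<in> space M. \<exists>t\<in>{0..S}. X t \<omega> > z}"
proof (rule finite_measure_mono)
  show "{\<omega> \<in> space M. \<exists>t\<in>{0..S}. X t \<omega> > z'} \<subseteq> {\<omega> \<in> space M. \<exists>t\<in>{0..S}. X t \<omega> > z}"
    unfolding sup_event(1)[OF S] using assms(2) by auto
qed (rule sup_event(2)[OF S])

lemma sup_prob_measurable [measurable]:
  assumes S: "0 < S"
  shows "(\<lambda>z. measure M {\<omega> \<in> space M. \<exists>t\<in>{0..S}. X t \<omega> > z}) \<in> borel_measurable borel"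
proof -
  have "mono (\<lambda>z. - measure M {\<omega> \<in> space M. \<exists>t\<in>{0..S}. X t \<omega> > z})"
    using sup_prob_antimono[OF S] by (auto simp: mono_def)
  then have "(\<lambda>z. - measure M {\<omega> \<in> space M. \<exists>t\<in>{0..S}. X t \<omega> > z}) \<in> borel_measurable borel"
    by (rule borel_measurable_mono)
  then show ?thesis by simp
qed

text \<open>Because the inequality is strict, the events of exceeding \<open>\<sigma> n\<close>
  increase to that of exceeding \<open>z\<close>; continuity from below does the rest.\<close>

lemma sup_prob_right_continuous:
  assumes S: "0 < S"
  shows "((\<lambda>z. measure M {\<omega> \<in> space M. \<exists>t\<in>{0..S}. X t \<omega> > z}) \<longlongrightarrow>
    measure M {\<omega> \<in> space M. \<exists>t\<in>{0..S}. X t \<omega> > z}) (at_right z)"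
proof (rule tendsto_at_right_sequentially[of z "z + 1"])
  fix \<sigma> :: "nat \<Rightarrow> real" assume \<sigma>: "\<And>n. z < \<sigma> n" "decseq \<sigma>" "\<sigma> \<longlonglongrightarrow> z"
  define A where "A n = {\<omega> \<in> space M. \<sigma> n < path_sup (path \<omega>) 0 S}" for n
  have "incseq A"
  proof (rule incseq_SucI)
    fix n
    have "\<sigma> (Suc n) \<le> \<sigma> n" using \<sigma>(2) by (rule decseq_SucD)
    then show "A n \<subseteq> A (Suc n)" by (auto simp: A_def)
  qed
  moreover have "range A \<subseteq> sets M"
    using sup_event(2)[OF S] unfolding sup_event(1)[OF S] A_def by blast
  ultimately have "(\<lambda>n. measure M (A n)) \<longlonglongrightarrow> measure M (\<Union>n. A n)"
    by (intro finite_Lim_measure_incseq)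
  also have "(\<Union>n. A n) = {\<omega> \<in> space M. z < path_sup (path \<omega>) 0 S}"
  proof (intro set_eqI iffI)
    fix \<omega> assume "\<omega> \<in> {\<omega> \<in> space M. z < path_sup (path \<omega>) 0 S}"
    then have t: "\<omega> \<in> space M" "z < path_sup (path \<omega>) 0 S" by auto
    have "\<forall>\<^sub>F n in sequentially. \<sigma> n < path_sup (path \<omega>) 0 S" by (rule order_tendstoD(2)[OF \<sigma>(3) t(2)])
    then obtain n where "\<sigma> n < path_sup (path \<omega>) 0 S" by (auto simp: eventually_sequentially)
    then show "\<omega> \<in> (\<Union>n. A n)" using t by (auto simp: A_def)
  next
    fix \<omega> assume "\<omega> \<in> (\<Union>n. A n)"
    then obtain n where "\<omega> \<in> space M" "\<sigma> n < path_sup (path \<omega>) 0 S" by (auto simp: A_def)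
    then show "\<omega> \<in> {\<omega> \<in> space M. z < path_sup (path \<omega>) 0 S}" using \<sigma>(1)[of n] by simp
  qed
  finally show "(\<lambda>n. measure M {\<omega> \<in> space M. \<exists>t\<in>{0..S}. X t \<omega> > \<sigma> n}) \<longlonglongrightarrow>
    measure M {\<omega> \<in> space M. \<exists>t\<in>{0..S}. X t \<omega> > z}" unfolding sup_event(1)[OF S] A_def .
qed simp

end

context spectrally_positive_levy_density begin

text \<open>Almost surely a path that exceeds \<open>u\<close> by time \<open>S\<close> either ends
  above \<open>u\<close> or has come back below it; the second case has probability
  \<open>crossing_weight\<close> with \<open>\<phi> = 1\<close>. The minus sign of the formula stems
  from \<open>min 0 w = - max 0 (- w)\<close>.\<close>

lemma crossing_formula_eq:
  assumes S: "0 < S" and u: "0 \<le> u"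
  shows "measure M {\<omega> \<in> space M. \<exists>t\<in>{0..S}. X t \<omega> > u} = crossing_formula M X p 0 S u"
proof -
  have [measurable]: "X S \<in> borel_measurable M" using S by (intro meas) auto
  have [measurable]: "(\<lambda>\<omega>. path_sup (path \<omega>) 0 S) \<in> borel_measurable M" using S by (intro path_sup_meas) auto
  have [measurable]: "{\<omega> \<in> space M. X S \<omega> < u \<and> u < path_sup (path \<omega>) 0 S} \<in> sets M"
    "{\<omega> \<in> space M. X S \<omega> > u} \<in> sets M" by measurable
  have cr: "crossing_weight (\<lambda>_. 1) S u = emeasure M {\<omega> \<in> space M. X S \<omega> < u \<and> u < path_sup (path \<omega>) 0 S}"
  proof -
    have "crossing_weight (\<lambda>_. 1) S u = (\<integral>\<^sup>+\<omega>. indicator {\<omega> \<in> space M. X S \<omega> < u \<and> u < path_sup (path \<omega>) 0 S} \<omega> \<partial>M)"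
      unfolding crossing_weight_def by (intro nn_integral_cong) (simp add: indicator_def)
    then show ?thesis by simp
  qed
  have "measure M {\<omega> \<in> space M. \<exists>t\<in>{0..S}. X t \<omega> > u} =
    measure M ({\<omega> \<in> space M. X S \<omega> > u} \<union> {\<omega> \<in> space M. X S \<omega> < u \<and> u < path_sup (path \<omega>) 0 S})"
  proof (rule measure_eq_AE)
    show "AE \<omega> in M. (\<omega> \<in> {\<omega> \<in> space M. \<exists>t\<in>{0..S}. X t \<omega> > u}) =
      (\<omega> \<in> {\<omega> \<in> space M. X S \<omega> > u} \<union> {\<omega> \<in> space M. X S \<omega> < u \<and> u < path_sup (path \<omega>) 0 S})"
      using AE_X_neq[OF S, of u] AE_space
    proof eventually_elim
      case (elim \<omega>)
      have "X S \<omega> \<le> path_sup (path \<omega>) 0 S" using S by (intro path_sup_upper[OF regular_path] elim) auto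
      then show ?case unfolding sup_event(1)[OF S] using elim by auto
    qed
  qed (use sup_event(2)[OF S] in auto)
  also have "\<dots> = measure M {\<omega> \<in> space M. X S \<omega> > u} + enn2real (crossing_weight (\<lambda>_. 1) S u)"
    by (subst finite_measure_Union) (auto simp: cr measure_def)
  also have "crossing_weight (\<lambda>_. 1) S u = (\<integral>\<^sup>+s. descent_rate (\<lambda>_. 1) (S - s) * ennreal (p u s) * indicator {0<..<S} s \<partial>lborel)"
    by (rule crossing_weight_density[OF S _ _ _ _ u]) auto
  also have "enn2real \<dots> = (\<integral>s. enn2real (descent_rate (\<lambda>_. 1) (S - s) * ennreal (p u s) * indicator {0<..<S} s) \<partial>lborel)"
  proof (rule integral_enn2real[symmetric])
    have "crossing_weight (\<lambda>_. 1) S u \<le> 1" by (rule crossing_weight_le_1) simp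
    then show "(\<integral>\<^sup>+s. descent_rate (\<lambda>_. 1) (S - s) * ennreal (p u s) * indicator {0<..<S} s \<partial>lborel) \<noteq> \<infinity>"
      using crossing_weight_density[OF S _ _ _ _ u, of "\<lambda>_. 1"] by (auto simp: top_unique)
  qed measurable
  also have "\<dots> = - (LBINT s:{0<..<S}. (\<integral>\<omega>. min 0 (X (S - s) \<omega> - 0 * (S - s)) \<partial>M) / (S - s) * p (u + 0 * s) s)"
    unfolding set_lebesgue_integral_def integral_minus[symmetric]
  proof (intro Bochner_Integration.integral_cong refl)
    fix s :: real
    show "enn2real (descent_rate (\<lambda>_. 1) (S - s) * ennreal (p u s) * indicator {0<..<S} s) =
       - (indicator {0<..<S} s *\<^sub>R ((\<integral>\<omega>. min 0 (X (S - s) \<omega> - 0 * (S - s)) \<partial>M) / (S - s) * p (u + 0 * s) s))"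
    proof (cases "s \<in> {0<..<S}")
      case True
      then have s: "0 < S - s" by auto
      have [measurable]: "X (S - s) \<in> borel_measurable M" using s by (intro meas) auto
      have "(\<integral>\<omega>. min 0 (X (S - s) \<omega>) \<partial>M) = (\<integral>\<omega>. - max 0 (- X (S - s) \<omega>) \<partial>M)"
        by (intro Bochner_Integration.integral_cong) auto
      also have "\<dots> = - (\<integral>\<omega>. max 0 (- X (S - s) \<omega>) \<partial>M)" by (rule integral_minus)
      \<comment> \<open>An infinite mean would cause no mismatch: the Bochner integral and
        \<open>enn2real\<close> both default to 0.\<close>
      also have "(\<integral>\<omega>. max 0 (- X (S - s) \<omega>) \<partial>M) = enn2real (\<integral>\<^sup>+\<omega>. ennreal (max 0 (- X (S - s) \<omega>)) \<partial>M)"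
        by (rule integral_eq_nn_integral) auto
      finally have 1: "(\<integral>\<omega>. min 0 (X (S - s) \<omega>) \<partial>M) = - enn2real (\<integral>\<^sup>+\<omega>. ennreal (max 0 (- X (S - s) \<omega>)) \<partial>M)" .
      have e: "ennreal (max 0 w) * ennreal (1 / (S - s)) = ennreal (max 0 w / (S - s))" for w
        using s by (subst ennreal_mult[symmetric]) auto
      have "descent_rate (\<lambda>_. 1) (S - s) = (\<integral>\<^sup>+\<omega>. ennreal (max 0 (- X (S - s) \<omega>)) * ennreal (1 / (S - s)) \<partial>M)"
        unfolding descent_rate_def e using s by simp
      also have "\<dots> = (\<integral>\<^sup>+\<omega>. ennreal (max 0 (- X (S - s) \<omega>)) \<partial>M) * ennreal (1 / (S - s))"
        by (rule nn_integral_multc) measurable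
      finally show ?thesis using True s p_nonneg by (simp add: 1 enn2real_mult)
    qed simp
  qed
  finally show ?thesis by (simp add: crossing_formula_def)
qed

end

subsection \<open>Two boundaries\<close>

text \<open>By right-continuity, strict inequalities that hold at some \<open>t < T\<close> also
  hold at a later rational time, so countably many times decide the event. The endpoint
  \<open>T\<close> has no later time in the interval and is added separately.\<close>

lemma ruin_event_sets:
  fixes Z :: "real \<Rightarrow> 'a \<Rightarrow> real"
  assumes Zm: "\<And>t. 0 \<le> t \<Longrightarrow> Z t \<in> borel_measurable M"
    and rc: "\<And>\<omega> t. \<omega> \<in> space M \<Longrightarrow> 0 \<le> t \<Longrightarrow> ((\<lambda>s. Z s \<omega>) \<longlongrightarrow> Z t \<omega>) (at_right t)" and T: "0 < T"
  shows "{\<omega> \<in> space M. \<exists>t\<in>{0..T}. Z t \<omega> - c1 * t > x \<and> Z t \<omega> - c2 * t > y} \<in> sets M"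
proof -
  define Q where "Q = (\<rat> \<inter> {0..T}) \<union> {T}"
  have "{\<omega> \<in> space M. \<exists>t\<in>{0..T}. Z t \<omega> - c1 * t > x \<and> Z t \<omega> - c2 * t > y} =
     (\<Union>t\<in>Q. {\<omega> \<in> space M. Z t \<omega> - c1 * t > x \<and> Z t \<omega> - c2 * t > y})"
  proof (intro set_eqI iffI)
    fix \<omega> assume "\<omega> \<in> {\<omega> \<in> space M. \<exists>t\<in>{0..T}. Z t \<omega> - c1 * t > x \<and> Z t \<omega> - c2 * t > y}"
    then obtain t where t: "\<omega> \<in> space M" "0 \<le> t" "t \<le> T" "Z t \<omega> - c1 * t > x" "Z t \<omega> - c2 * t > y" by auto
    show "\<omega> \<in> (\<Union>t\<in>Q. {\<omega> \<in> space M. Z t \<omega> - c1 * t > x \<and> Z t \<omega> - c2 * t > y})"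
    proof (cases "t = T")
      case True
      then show ?thesis using t by (auto simp: Q_def)
    next
      case False
      have l: "((\<lambda>s. Z s \<omega> - c * s) \<longlongrightarrow> Z t \<omega> - c * t) (at_right t)" for c
        using rc[OF t(1,2)] by (intro tendsto_intros)
      have "\<forall>\<^sub>F s in at_right t. x < Z s \<omega> - c1 * s \<and> y < Z s \<omega> - c2 * s"
        using order_tendstoD(1)[OF l t(4)] order_tendstoD(1)[OF l t(5)] by (rule eventually_conj)
      then obtain d where d: "t < d" "\<And>s. t < s \<Longrightarrow> s < d \<Longrightarrow> x < Z s \<omega> - c1 * s \<and> y < Z s \<omega> - c2 * s"
        unfolding eventually_at_right_field by blast
      obtain q where q: "q \<in> \<rat>" "t < q" "q < min d T"
        using Rats_dense_in_real[of t "min d T"] d(1) t False by auto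
      then show ?thesis using d(2)[of q] t by (auto simp: Q_def intro!: bexI[of _ q])
    qed
  next
    fix \<omega> assume "\<omega> \<in> (\<Union>t\<in>Q. {\<omega> \<in> space M. Z t \<omega> - c1 * t > x \<and> Z t \<omega> - c2 * t > y})"
    then show "\<omega> \<in> {\<omega> \<in> space M. \<exists>t\<in>{0..T}. Z t \<omega> - c1 * t > x \<and> Z t \<omega> - c2 * t > y}"
      using T by (auto simp: Q_def)
  qed
  also have "\<dots> \<in> sets M"
  proof (rule sets.countable_UN'')
    show "countable Q" unfolding Q_def by (intro countable_Un countable_Int1 countable_rat) auto
    fix t assume "t \<in> Q"
    then have [measurable]: "Z t \<in> borel_measurable M" using T by (intro Zm) (auto simp: Q_def)
    show "{\<omega> \<in> space M. Z t \<omega> - c1 * t > x \<and> Z t \<omega> - c2 * t > y} \<in> sets M" by measurable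
  qed
  finally show ?thesis .
qed

lemma crossing_formula_drift:
  assumes eq: "AE \<omega> in M. \<forall>t. X t \<omega> = Z t \<omega>"
    and Zm: "\<And>t. 0 \<le> t \<Longrightarrow> Z t \<in> borel_measurable M" and Xm: "\<And>t. 0 \<le> t \<Longrightarrow> X t \<in> borel_measurable M"
    and S: "0 < S"
  shows "crossing_formula M (\<lambda>t \<omega>. X t \<omega> - c * t) (\<lambda>u t. if 0 < t then f (u + c * t) t else 0) 0 S u
    = crossing_formula M Z f c S u"
proof -
  have [measurable]: "X S \<in> borel_measurable M" "Z S \<in> borel_measurable M" using S by (auto intro!: Xm Zm)
  have 1: "measure M {\<omega> \<in> space M. X S \<omega> - c * S - 0 * S > u} = measure M {\<omega> \<in> space M. Z S \<omega> - c * S > u}"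
  proof (rule measure_eq_AE)
    show "AE \<omega> in M. (\<omega> \<in> {\<omega> \<in> space M. X S \<omega> - c * S - 0 * S > u}) = (\<omega> \<in> {\<omega> \<in> space M. Z S \<omega> - c * S > u})"
      using eq by eventually_elim simp
  qed measurable
  have 2: "(LBINT s:{0<..<S}. (\<integral>\<omega>. min 0 (X (S - s) \<omega> - c * (S - s) - 0 * (S - s)) \<partial>M) / (S - s) *
        (if 0 < s then f (u + 0 * s + c * s) s else 0)) =
     (LBINT s:{0<..<S}. (\<integral>\<omega>. min 0 (Z (S - s) \<omega> - c * (S - s)) \<partial>M) / (S - s) * f (u + c * s) s)"
  proof (rule set_lebesgue_integral_cong)
    show "\<forall>s. s \<in> {0<..<S} \<longrightarrow> (\<integral>\<omega>. min 0 (X (S - s) \<omega> - c * (S - s) - 0 * (S - s)) \<partial>M) / (S - s) *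
        (if 0 < s then f (u + 0 * s + c * s) s else 0) = (\<integral>\<omega>. min 0 (Z (S - s) \<omega> - c * (S - s)) \<partial>M) / (S - s) * f (u + c * s) s"
    proof (intro allI impI)
      fix s assume s: "s \<in> {0<..<S}"
      then have [measurable]: "X (S - s) \<in> borel_measurable M" "Z (S - s) \<in> borel_measurable M"
        by (auto intro!: Xm Zm)
      have "(\<integral>\<omega>. min 0 (X (S - s) \<omega> - c * (S - s) - 0 * (S - s)) \<partial>M) = (\<integral>\<omega>. min 0 (Z (S - s) \<omega> - c * (S - s)) \<partial>M)"
      proof (rule integral_cong_AE)
        show "AE \<omega> in M. min 0 (X (S - s) \<omega> - c * (S - s) - 0 * (S - s)) = min 0 (Z (S - s) \<omega> - c * (S - s))"
          using eq by eventually_elim simp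
      qed measurable
      then show "(\<integral>\<omega>. min 0 (X (S - s) \<omega> - c * (S - s) - 0 * (S - s)) \<partial>M) / (S - s) *
        (if 0 < s then f (u + 0 * s + c * s) s else 0) = (\<integral>\<omega>. min 0 (Z (S - s) \<omega> - c * (S - s)) \<partial>M) / (S - s) * f (u + c * s) s"
        using s by simp
    qed
  qed simp
  show ?thesis unfolding crossing_formula_def 1 2 ..
qed

lemma nn_integral_reflect:
  assumes [measurable]: "g \<in> borel_measurable borel"
  shows "(\<integral>\<^sup>+a. g a \<partial>lborel) = (\<integral>\<^sup>+z. g (y - z :: real) \<partial>lborel)"
  using nn_integral_real_affine[OF assms, of "-1" y] by simp

context spectrally_positive_levy_density begin

lemma descent_rate_density:
  assumes t: "0 < t" and [measurable]: "\<phi> \<in> borel_measurable borel"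
  shows "descent_rate \<phi> t = (\<integral>\<^sup>+z. ennreal (p (- z) t) * (ennreal (max 0 z / t) * ennreal (\<phi> z)) \<partial>lborel)"
proof -
  have "descent_rate \<phi> t = (\<integral>\<^sup>+\<omega>. (\<lambda>a. ennreal (max 0 (- a) / t) * ennreal (\<phi> (- a))) (X t \<omega>) \<partial>M)"
    using t by (simp add: descent_rate_def)
  also have "\<dots> = (\<integral>\<^sup>+a. ennreal (p a t) * (ennreal (max 0 (- a) / t) * ennreal (\<phi> (- a))) \<partial>lborel)"
    by (rule nn_integral_X[OF t]) measurable
  also have "\<dots> = (\<integral>\<^sup>+z. ennreal (p (0 - z) t) * (ennreal (max 0 (- (0 - z)) / t) * ennreal (\<phi> (- (0 - z)))) \<partial>lborel)"
    by (rule nn_integral_reflect) measurable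
  finally show ?thesis by simp
qed

text \<open>The density of \<open>X (T - s)\<close> is inserted into \<open>descent_rate\<close> and
  the integrals are exchanged; \<open>z\<close> is the depth at time \<open>T\<close> below the
  level \<open>u\<close>.\<close>

lemma crossing_weight_kernel:
  assumes T: "0 < T" and [measurable]: "\<phi> \<in> borel_measurable borel" and phi: "\<And>z. 0 \<le> \<phi> z" "\<And>z. \<phi> z \<le> 1"
    and rc: "\<And>z. 0 \<le> z \<Longrightarrow> (\<phi> \<longlongrightarrow> \<phi> z) (at_right z)" and u: "0 \<le> u"
  shows "enn2real (crossing_weight \<phi> T u) =
    (LBINT z:{0<..}. z * \<phi> z * (LBINT s:{0<..<T}. p u s / (T - s) * p (- z) (T - s)))"
proof -
  define K where "K z s = ennreal (p u s / (T - s) * p (- z) (T - s)) * indicator {0<..<T} s" for z s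
  define W where "W z = ennreal (z * \<phi> z) * indicator {0<..} z" for z :: real
  have Km [measurable]: "(\<lambda>q. K (fst q) (snd q)) \<in> borel_measurable (lborel \<Otimes>\<^sub>M lborel)"
    unfolding K_def by measurable
  have Kz [measurable]: "K z \<in> borel_measurable lborel" for z unfolding K_def by measurable
  have [measurable]: "W \<in> borel_measurable borel" unfolding W_def by measurable
  define G where "G z = W z * (\<integral>\<^sup>+s. K z s \<partial>lborel)" for z
  have Gm: "G \<in> borel_measurable lborel" unfolding G_def by measurable
  have "crossing_weight \<phi> T u = (\<integral>\<^sup>+s. descent_rate \<phi> (T - s) * ennreal (p u s) * indicator {0<..<T} s \<partial>lborel)"
    by (rule crossing_weight_density[OF T _ phi rc u]) measurable
  also have "\<dots> = (\<integral>\<^sup>+s. \<integral>\<^sup>+z. W z * K z s \<partial>lborel \<partial>lborel)"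
  proof (intro nn_integral_cong)
    fix s
    show "descent_rate \<phi> (T - s) * ennreal (p u s) * indicator {0<..<T} s = (\<integral>\<^sup>+z. W z * K z s \<partial>lborel)"
    proof (cases "s \<in> {0<..<T}")
      case True
      then have s: "0 < T - s" by auto
      have "descent_rate \<phi> (T - s) * ennreal (p u s) = (\<integral>\<^sup>+z. ennreal (p (- z) (T - s)) * (ennreal (max 0 z / (T - s)) * ennreal (\<phi> z)) * ennreal (p u s) \<partial>lborel)"
        unfolding descent_rate_density[OF s assms(2)] by (rule nn_integral_multc[symmetric]) measurable
      also have "\<dots> = (\<integral>\<^sup>+z. W z * K z s \<partial>lborel)"
      proof (intro nn_integral_cong)
        fix z
        show "ennreal (p (- z) (T - s)) * (ennreal (max 0 z / (T - s)) * ennreal (\<phi> z)) * ennreal (p u s) = W z * K z s"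
        proof (cases "0 < z")
          case z: True
          have "p (- z) (T - s) * (z / (T - s) * \<phi> z) * p u s = z * \<phi> z * (p u s / (T - s) * p (- z) (T - s))" by simp
          then show ?thesis unfolding W_def K_def using True z s phi(1) p_nonneg by (simp flip: ennreal_mult)
        qed (simp add: W_def)
      qed
      finally show ?thesis using True by simp
    qed (simp add: K_def)
  qed
  also have "\<dots> = (\<integral>\<^sup>+z. \<integral>\<^sup>+s. W z * K z s \<partial>lborel \<partial>lborel)"
    by (rule lborel_pair.Fubini') measurable
  also have "\<dots> = (\<integral>\<^sup>+z. G z \<partial>lborel)"
    unfolding G_def by (intro nn_integral_cong nn_integral_cmult) measurable
  finally have c: "crossing_weight \<phi> T u = (\<integral>\<^sup>+z. G z \<partial>lborel)" .
  have "crossing_weight \<phi> T u \<le> 1" by (rule crossing_weight_le_1) (rule phi)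
  then have "(\<integral>\<^sup>+z. G z \<partial>lborel) \<noteq> \<infinity>" unfolding c by (auto simp: top_unique)
  from integral_enn2real[OF Gm this]
  have "enn2real (crossing_weight \<phi> T u) = (\<integral>z. enn2real (G z) \<partial>lborel)" unfolding c ..
  also have "\<dots> = (LBINT z:{0<..}. z * \<phi> z * (LBINT s:{0<..<T}. p u s / (T - s) * p (- z) (T - s)))"
    unfolding set_lebesgue_integral_def
  proof (intro Bochner_Integration.integral_cong refl)
    fix z :: real
    \<comment> \<open>If the inner integral is infinite for some \<open>z\<close>, the default value
      0 is again common to the Bochner integral and \<open>enn2real\<close>.\<close>
    have "(\<integral>s. indicator {0<..<T} s *\<^sub>R (p u s / (T - s) * p (- z) (T - s)) \<partial>lborel)
      = enn2real (\<integral>\<^sup>+s. ennreal (indicator {0<..<T} s *\<^sub>R (p u s / (T - s) * p (- z) (T - s))) \<partial>lborel)"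
      by (rule integral_eq_nn_integral) (use p_nonneg in \<open>auto simp: indicator_def\<close>)
    also have "\<dots> = enn2real (\<integral>\<^sup>+s. K z s \<partial>lborel)"
      by (auto simp: K_def indicator_def intro!: arg_cong[of _ _ enn2real] nn_integral_cong)
    finally show "enn2real (G z) = indicator {0<..} z *\<^sub>R (z * \<phi> z *
       (\<integral>s. indicator {0<..<T} s *\<^sub>R (p u s / (T - s) * p (- z) (T - s)) \<partial>lborel))"
      using phi(1) by (cases "0 < z") (auto simp: G_def W_def enn2real_mult)
  qed
  finally show ?thesis .
qed

text \<open>A path that has not exceeded \<open>y\<close> by time \<xi> does so afterwards, relative
  to the second boundary, with probability \<open>\<phi> (y - X \<xi>)\<close>. Dropping the
  condition on the past gives an integral over the law of \<open>X \<xi>\<close> below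
  \<open>y\<close>. It counts in excess the paths that exceeded \<open>y\<close> and came back, and
  their contribution \<open>crossing_weight \<phi> \<xi> y\<close> is the term subtracted.\<close>

lemma two_boundary_probability:
  fixes \<delta> y :: real
  assumes xi: "0 < \<xi>" and S: "0 < S" and y: "0 \<le> y"
  defines "\<phi> \<equiv> \<lambda>z. measure M {\<omega> \<in> space M. \<exists>t\<in>{0..S}. X t \<omega> - \<delta> * t > z}"
  shows "measure M {\<omega> \<in> space M. (\<exists>t\<in>{0..\<xi>}. X t \<omega> > y) \<or> (\<exists>r\<in>{0..S}. X (\<xi> + r) \<omega> - X \<xi> \<omega> - \<delta> * r > y - X \<xi> \<omega>)}
    = measure M {\<omega> \<in> space M. \<exists>t\<in>{0..\<xi>}. X t \<omega> > y} + (LBINT z:{0<..}. \<phi> z * p (y - z) \<xi>)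
      - (LBINT z:{0<..}. z * \<phi> z * (LBINT s:{0<..<\<xi>}. p y s / (\<xi> - s) * p (- z) (\<xi> - s)))"
proof -
  interpret D: spectrally_positive_levy M "\<lambda>t \<omega>. X t \<omega> - \<delta> * t" by (rule spectrally_positive_levy_drift) unfold_locales
  have phim [measurable]: "\<phi> \<in> borel_measurable borel" unfolding \<phi>_def by (rule D.sup_prob_measurable[OF S])
  have phi01: "0 \<le> \<phi> z" "\<phi> z \<le> 1" for z unfolding \<phi>_def by (auto simp: prob_le_1)
  have phirc: "(\<phi> \<longlongrightarrow> \<phi> z) (at_right z)" for z unfolding \<phi>_def by (rule D.sup_prob_right_continuous[OF S])
  have phiem: "ennreal (\<phi> z) = emeasure M {\<omega> \<in> space M. z < path_sup (\<lambda>r. X r \<omega> - \<delta> * r) 0 S}" for z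
    unfolding \<phi>_def D.sup_event(1)[OF S] emeasure_eq_measure ..
  have [measurable]: "X \<xi> \<in> borel_measurable M" using xi by (intro meas) auto
  have [measurable]: "(\<lambda>\<omega>. path_sup (path \<omega>) 0 \<xi>) \<in> borel_measurable M" using xi by (intro path_sup_meas) auto
  define fut where "fut \<omega> = path_sup (\<lambda>r. X (\<xi> + r) \<omega> - X \<xi> \<omega> - \<delta> * r) 0 S" for \<omega>
  have nf: "no_neg_jump_path (\<lambda>r. X (\<xi> + r) \<omega> - X \<xi> \<omega> - \<delta> * r)" if "\<omega> \<in> space M" for \<omega>
    using xi by (intro no_neg_jump_path_drift no_neg_jump_path_shift regular_path that) auto
  have [measurable]: "fut \<in> borel_measurable M"
    unfolding fut_def using xi S by (intro path_sup_meas_gen nf borel_measurable_diff meas) auto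
  have [measurable]: "(\<lambda>\<omega>. path_sup (\<lambda>r. X r \<omega> - \<delta> * r) 0 S) \<in> borel_measurable M"
    using S by (intro D.path_sup_meas) auto
  define A where "A = {\<omega> \<in> space M. y < path_sup (path \<omega>) 0 \<xi>}"
  define B where "B = {\<omega> \<in> space M. path_sup (path \<omega>) 0 \<xi> \<le> y \<and> y - X \<xi> \<omega> < fut \<omega>}"
  have [measurable]: "A \<in> sets M" "B \<in> sets M" unfolding A_def B_def by measurable
  have A: "A = {\<omega> \<in> space M. \<exists>t\<in>{0..\<xi>}. X t \<omega> > y}" unfolding A_def sup_event(1)[OF xi] ..
  have "{\<omega> \<in> space M. (\<exists>t\<in>{0..\<xi>}. X t \<omega> > y) \<or> (\<exists>r\<in>{0..S}. X (\<xi> + r) \<omega> - X \<xi> \<omega> - \<delta> * r > y - X \<xi> \<omega>)} = A \<union> B"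
  proof (intro set_eqI)
    fix \<omega>
    show "\<omega> \<in> {\<omega> \<in> space M. (\<exists>t\<in>{0..\<xi>}. X t \<omega> > y) \<or> (\<exists>r\<in>{0..S}. X (\<xi> + r) \<omega> - X \<xi> \<omega> - \<delta> * r > y - X \<xi> \<omega>)} \<longleftrightarrow> \<omega> \<in> A \<union> B"
      using path_sup_gt_iff[OF regular_path order_refl less_imp_le[OF xi], of \<omega> y]
        path_sup_gt_iff[OF nf order_refl less_imp_le[OF S], of \<omega> "y - X \<xi> \<omega>"]
      unfolding A_def B_def fut_def by auto
  qed
  moreover have "measure M (A \<union> B) = measure M A + measure M B"
    by (rule finite_measure_Union) (auto simp: A_def B_def)
  moreover have "measure M B = (LBINT z:{0<..}. \<phi> z * p (y - z) \<xi>) - enn2real (crossing_weight \<phi> \<xi> y)"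
  proof -
    define H where "H q = (if snd (fst q) \<le> y \<and> y - fst (fst q) < snd (snd q) then 1 else 0 :: ennreal)"
      for q :: "(real \<times> real) \<times> (real \<times> real)"
    have [measurable]: "H \<in> borel_measurable borel" unfolding H_def by measurable
    have "emeasure M B = (\<integral>\<^sup>+\<omega>. indicator B \<omega> \<partial>M)" by simp
    also have "\<dots> = (\<integral>\<^sup>+\<omega>. H ((X \<xi> \<omega>, path_sup (path \<omega>) 0 \<xi>),
        (X (\<xi> + S) \<omega> - X \<xi> \<omega>, path_sup (\<lambda>r. X (\<xi> + r) \<omega> - X \<xi> \<omega> - \<delta> * r) 0 S)) \<partial>M)"
      by (intro nn_integral_cong) (simp add: H_def B_def fut_def indicator_def)
    also have "\<dots> = (\<integral>\<^sup>+\<omega>. \<integral>\<^sup>+\<omega>'. H ((X \<xi> \<omega>, path_sup (path \<omega>) 0 \<xi>), (X S \<omega>', path_sup (\<lambda>r. X r \<omega>' - \<delta> * r) 0 S)) \<partial>M \<partial>M)"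
      by (rule markov_nn_integral[OF xi S]) measurable
    also have "\<dots> = (\<integral>\<^sup>+\<omega>. ennreal (\<phi> (y - X \<xi> \<omega>)) * indicator {..y} (path_sup (path \<omega>) 0 \<xi>) \<partial>M)"
    proof (intro nn_integral_cong)
      fix \<omega>
      have "(\<integral>\<^sup>+\<omega>'. H ((X \<xi> \<omega>, path_sup (path \<omega>) 0 \<xi>), (X S \<omega>', path_sup (\<lambda>r. X r \<omega>' - \<delta> * r) 0 S)) \<partial>M)
        = (\<integral>\<^sup>+\<omega>'. indicator {y - X \<xi> \<omega><..} (path_sup (\<lambda>r. X r \<omega>' - \<delta> * r) 0 S) * indicator {..y} (path_sup (path \<omega>) 0 \<xi>) \<partial>M)"
        by (intro nn_integral_cong) (auto simp: H_def indicator_def)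
      also have "\<dots> = ennreal (\<phi> (y - X \<xi> \<omega>)) * indicator {..y} (path_sup (path \<omega>) 0 \<xi>)"
        by (subst nn_integral_multc) (auto simp: nn_integral_indicator_compose phiem)
      finally show "(\<integral>\<^sup>+\<omega>'. H ((X \<xi> \<omega>, path_sup (path \<omega>) 0 \<xi>), (X S \<omega>', path_sup (\<lambda>r. X r \<omega>' - \<delta> * r) 0 S)) \<partial>M) =
        ennreal (\<phi> (y - X \<xi> \<omega>)) * indicator {..y} (path_sup (path \<omega>) 0 \<xi>)" .
    qed
    finally have B: "emeasure M B = (\<integral>\<^sup>+\<omega>. ennreal (\<phi> (y - X \<xi> \<omega>)) * indicator {..y} (path_sup (path \<omega>) 0 \<xi>) \<partial>M)" .
    have cm: "(\<lambda>\<omega>. ennreal (\<phi> (y - X \<xi> \<omega>)) * indicator {X \<xi> \<omega><..<path_sup (path \<omega>) 0 \<xi>} y) \<in> borel_measurable M"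
      unfolding greaterThanLessThan_iff indicator_def by measurable
    \<comment> \<open>Subtraction of extended nonnegative numbers is truncated, so the identity is
      proved as a sum and rearranged among the reals.\<close>
    have "emeasure M B + crossing_weight \<phi> \<xi> y = (\<integral>\<^sup>+\<omega>. ennreal (\<phi> (y - X \<xi> \<omega>)) * indicator {..y} (path_sup (path \<omega>) 0 \<xi>) +
        ennreal (\<phi> (y - X \<xi> \<omega>)) * indicator {X \<xi> \<omega><..<path_sup (path \<omega>) 0 \<xi>} y \<partial>M)"
      unfolding B crossing_weight_def by (rule nn_integral_add[symmetric]) (use cm in auto)
    also have "\<dots> = (\<integral>\<^sup>+\<omega>. (\<lambda>a. ennreal (\<phi> (y - a)) * indicator {..<y} a) (X \<xi> \<omega>) \<partial>M)"
    proof (rule nn_integral_cong_AE)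
      show "AE \<omega> in M. ennreal (\<phi> (y - X \<xi> \<omega>)) * indicator {..y} (path_sup (path \<omega>) 0 \<xi>) +
        ennreal (\<phi> (y - X \<xi> \<omega>)) * indicator {X \<xi> \<omega><..<path_sup (path \<omega>) 0 \<xi>} y =
        (\<lambda>a. ennreal (\<phi> (y - a)) * indicator {..<y} a) (X \<xi> \<omega>)"
        using AE_X_neq[OF xi, of y] AE_space
      proof eventually_elim
        case (elim \<omega>)
        have "X \<xi> \<omega> \<le> path_sup (path \<omega>) 0 \<xi>" using xi by (intro path_sup_upper[OF regular_path] elim) auto
        then show ?case using elim(1) by (auto simp: indicator_def)
      qed
    qed
    also have "\<dots> = (\<integral>\<^sup>+a. ennreal (p a \<xi>) * (ennreal (\<phi> (y - a)) * indicator {..<y} a) \<partial>lborel)"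
      by (rule nn_integral_X[OF xi]) measurable
    also have "\<dots> = (\<integral>\<^sup>+z. ennreal (p (y - z) \<xi>) * (ennreal (\<phi> (y - (y - z))) * indicator {..<y} (y - z)) \<partial>lborel)"
      by (rule nn_integral_reflect) measurable
    also have "\<dots> = (\<integral>\<^sup>+z. ennreal (indicator {0<..} z *\<^sub>R (\<phi> z * p (y - z) \<xi>)) \<partial>lborel)"
      using phi01(1) p_nonneg by (intro nn_integral_cong) (auto simp: indicator_def mult.commute simp flip: ennreal_mult)
    finally have sum: "emeasure M B + crossing_weight \<phi> \<xi> y = (\<integral>\<^sup>+z. ennreal (indicator {0<..} z *\<^sub>R (\<phi> z * p (y - z) \<xi>)) \<partial>lborel)" .
    have c1: "crossing_weight \<phi> \<xi> y \<le> 1" by (rule crossing_weight_le_1) (rule phi01)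
    have "(LBINT z:{0<..}. \<phi> z * p (y - z) \<xi>) = enn2real (emeasure M B + crossing_weight \<phi> \<xi> y)"
      unfolding sum set_lebesgue_integral_def
      by (rule integral_eq_nn_integral) (use phi01 p_nonneg in \<open>auto simp: indicator_def\<close>)
    also have "\<dots> = measure M B + enn2real (crossing_weight \<phi> \<xi> y)"
      using c1 by (subst enn2real_plus) (auto simp: measure_def less_top[symmetric] top_unique intro: le_less_trans)
    finally show ?thesis by simp
  qed
  ultimately show ?thesis
    using crossing_weight_kernel[OF xi phim phi01 phirc y] by (simp add: A)
qed

end

theorem theorem3p1:
  fixes M :: "'a measure"
    and Z :: "real \<Rightarrow> 'a \<Rightarrow> real"
    and f :: "real \<Rightarrow> real \<Rightarrow> real"
    and T c1 c2 \<delta> x y :: real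
  assumes "0 < T"
    and "levy_process M Z"
    and "spectrally_positive M Z"
    and "density_family M Z f"
    and "pointwise_version M Z f"
    and "\<delta> = c1 - c2" and "0 < \<delta>"
  shows "(x \<ge> y \<and> y \<ge> 0 \<longrightarrow>
            ruin_prob M Z c1 c2 T x y = crossing_formula M Z f c1 T x) \<and>
         (0 \<le> x \<and> x < y \<and> y < x + \<delta> * T \<longrightarrow>
            (let \<xi> = (y - x) / \<delta> in
              ruin_prob M Z c1 c2 T x y =
                crossing_formula M Z f c2 \<xi> y +
                (LBINT z:{0<..}. crossing_formula M Z f c1 (T - \<xi>) z * f (y + c2 * \<xi> - z) \<xi>) -
                (LBINT z:{0<..}. z * crossing_formula M Z f c1 (T - \<xi>) z *
                   (LBINT s:{0<..<\<xi>}.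
                      f (y + c2 * s) s / (\<xi> - s) * f (c2 * (\<xi> - s) - z) (\<xi> - s))))) \<and>
         (y \<ge> x + \<delta> * T \<and> x \<ge> 0 \<longrightarrow>
            ruin_prob M Z c1 c2 T x y = crossing_formula M Z f c2 T y)"
proof -
  obtain X where X: "spectrally_positive_levy M X" and eq: "AE \<omega> in M. \<forall>t. X t \<omega> = Z t \<omega>"
    using levy_process_version[OF assms(2,3)] by blast
  interpret X: spectrally_positive_levy M X by (rule X)
  have Zm: "\<And>t. 0 \<le> t \<Longrightarrow> Z t \<in> borel_measurable M" using assms(2) by (simp add: levy_process_def)
  define P where "P c = (\<lambda>u t. if 0 < t then f (u + c * t) t else 0)" for c
  have sd: "spectrally_positive_levy_density M (\<lambda>t \<omega>. X t \<omega> - c * t) (P c)" for c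
    unfolding P_def by (rule spectrally_positive_levy_density_drift[OF X eq Zm assms(4,5)])
  have cf: "measure M {\<omega> \<in> space M. \<exists>t\<in>{0..S}. X t \<omega> - c * t > u} = crossing_formula M Z f c S u"
    if "0 < S" "0 \<le> u" for c S u
    using spectrally_positive_levy_density.crossing_formula_eq[OF sd that] crossing_formula_drift[OF eq Zm X.meas that(1)]
    by (simp add: P_def)
  have rp: "ruin_prob M Z c1 c2 T x y = measure M {\<omega> \<in> space M. \<exists>t\<in>{0..T}. X t \<omega> - c1 * t > x \<and> X t \<omega> - c2 * t > y}"
    unfolding ruin_prob_def
  proof (rule measure_eq_AE)
    show "AE \<omega> in M. (\<omega> \<in> {\<omega> \<in> space M. \<exists>t\<in>{0..T}. Z t \<omega> - c1 * t > x \<and> Z t \<omega> - c2 * t > y}) =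
       (\<omega> \<in> {\<omega> \<in> space M. \<exists>t\<in>{0..T}. X t \<omega> - c1 * t > x \<and> X t \<omega> - c2 * t > y})"
      using eq by eventually_elim simp
    show "{\<omega> \<in> space M. \<exists>t\<in>{0..T}. Z t \<omega> - c1 * t > x \<and> Z t \<omega> - c2 * t > y} \<in> sets M"
      using assms(2) by (intro ruin_event_sets Zm assms(1)) (auto simp: levy_process_def continuous_within)
    show "{\<omega> \<in> space M. \<exists>t\<in>{0..T}. X t \<omega> - c1 * t > x \<and> X t \<omega> - c2 * t > y} \<in> sets M"
      by (intro ruin_event_sets X.meas assms(1) no_neg_jump_path_right[OF X.regular_path])
  qed
  \<comment> \<open>The lines \<open>x + c1 * t\<close> and \<open>y + c2 * t\<close> differ by
    \<open>x - y + \<delta> * t\<close>; exceeding the higher of the two at \<open>t\<close> implies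
    exceeding the other.\<close>
  have imp1: "X t \<omega> - c2 * t > y" if "X t \<omega> - c1 * t > x" "y \<le> x + \<delta> * t" for t \<omega>
    using that assms(6) by (simp add: algebra_simps)
  have imp2: "X t \<omega> - c1 * t > x" if "X t \<omega> - c2 * t > y" "x + \<delta> * t \<le> y" for t \<omega>
    using that assms(6) by (simp add: algebra_simps)
  show ?thesis
  proof (intro conjI impI)
    assume xy: "x \<ge> y \<and> y \<ge> 0"
    have le: "y \<le> x + \<delta> * t" if "0 \<le> t" for t using xy assms(7) that by (smt (verit) mult_nonneg_nonneg)
    have "{\<omega> \<in> space M. \<exists>t\<in>{0..T}. X t \<omega> - c1 * t > x \<and> X t \<omega> - c2 * t > y} = {\<omega> \<in> space M. \<exists>t\<in>{0..T}. X t \<omega> - c1 * t > x}"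
    proof (intro Collect_cong conj_cong bex_cong refl)
      fix \<omega> t assume "t \<in> {0..T}"
      then show "(X t \<omega> - c1 * t > x \<and> X t \<omega> - c2 * t > y) = (X t \<omega> - c1 * t > x)"
        using imp1[of t \<omega>] le[of t] unfolding atLeastAtMost_iff by metis
    qed
    then show "ruin_prob M Z c1 c2 T x y = crossing_formula M Z f c1 T x"
      using cf[of T x c1] xy assms(1) by (simp add: rp)
  next
    assume xy: "y \<ge> x + \<delta> * T \<and> x \<ge> 0"
    have le: "x + \<delta> * t \<le> y" if "t \<le> T" for t
      using xy assms(7) mult_left_mono[OF that, of \<delta>] by linarith
    have "{\<omega> \<in> space M. \<exists>t\<in>{0..T}. X t \<omega> - c1 * t > x \<and> X t \<omega> - c2 * t > y} = {\<omega> \<in> space M. \<exists>t\<in>{0..T}. X t \<omega> - c2 * t > y}"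
    proof (intro Collect_cong conj_cong bex_cong refl)
      fix \<omega> t assume "t \<in> {0..T}"
      then show "(X t \<omega> - c1 * t > x \<and> X t \<omega> - c2 * t > y) = (X t \<omega> - c2 * t > y)"
        using imp2[of t \<omega>] le[of t] unfolding atLeastAtMost_iff by metis
    qed
    moreover have "0 \<le> y" using xy assms(1,7) by (smt (verit) mult_nonneg_nonneg)
    ultimately show "ruin_prob M Z c1 c2 T x y = crossing_formula M Z f c2 T y"
      using cf[of T y c2] assms(1) by (simp add: rp)
  next
    assume xy: "0 \<le> x \<and> x < y \<and> y < x + \<delta> * T"
    \<comment> \<open>The time at which the two lines meet: before it the line of slope
      \<open>c2\<close> is the higher one, afterwards that of slope \<open>c1\<close>.\<close>
    define \<xi> where "\<xi> = (y - x) / \<delta>"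
    have xi: "0 < \<xi>" "0 < T - \<xi>" "\<delta> * \<xi> = y - x" using xy assms(7) by (auto simp: \<xi>_def field_simps)
    interpret Y: spectrally_positive_levy_density M "\<lambda>t \<omega>. X t \<omega> - c2 * t" "P c2" by (rule sd)
    \<comment> \<open>With the drift \<open>c2\<close> removed, the line of slope \<open>c1\<close>
      becomes \<open>x + \<delta> * t\<close>, which equals \<open>y\<close> at \<xi>. The restarted
      process therefore faces the height \<open>y - (X \<xi> \<omega> - c2 * \<xi>)\<close> with
      slope \<delta>.\<close>
    have drift: "X t \<omega> - c2 * t - \<delta> * t = X t \<omega> - c1 * t" for t \<omega> unfolding assms(6) by (simp add: algebra_simps)
    have "{\<omega> \<in> space M. \<exists>t\<in>{0..T}. X t \<omega> - c1 * t > x \<and> X t \<omega> - c2 * t > y} =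
      {\<omega> \<in> space M. (\<exists>t\<in>{0..\<xi>}. X t \<omega> - c2 * t > y) \<or>
        (\<exists>r\<in>{0..T - \<xi>}. X (\<xi> + r) \<omega> - c2 * (\<xi> + r) - (X \<xi> \<omega> - c2 * \<xi>) - \<delta> * r > y - (X \<xi> \<omega> - c2 * \<xi>))}"
      (is "?E = ?E'")
    proof (intro set_eqI iffI)
      fix \<omega> assume "\<omega> \<in> ?E"
      then obtain t where t: "\<omega> \<in> space M" "0 \<le> t" "t \<le> T" "X t \<omega> - c1 * t > x" "X t \<omega> - c2 * t > y" by auto
      show "\<omega> \<in> ?E'"
      proof (cases "t \<le> \<xi>")
        case True then show ?thesis using t by auto
      next
        case False
        have "X t \<omega> - c2 * t - (X \<xi> \<omega> - c2 * \<xi>) - \<delta> * (t - \<xi>) > y - (X \<xi> \<omega> - c2 * \<xi>)"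
          using t(4) drift[of t \<omega>] xi(3) by (simp add: right_diff_distrib)
        then have "\<exists>r\<in>{0..T - \<xi>}. X (\<xi> + r) \<omega> - c2 * (\<xi> + r) - (X \<xi> \<omega> - c2 * \<xi>) - \<delta> * r > y - (X \<xi> \<omega> - c2 * \<xi>)"
          using False t(3) by (intro bexI[of _ "t - \<xi>"]) auto
        then show ?thesis using t(1) by blast
      qed
    next
      fix \<omega> assume "\<omega> \<in> ?E'"
      then have \<omega>: "\<omega> \<in> space M" and
        "(\<exists>t\<in>{0..\<xi>}. X t \<omega> - c2 * t > y) \<or>
        (\<exists>r\<in>{0..T - \<xi>}. X (\<xi> + r) \<omega> - c2 * (\<xi> + r) - (X \<xi> \<omega> - c2 * \<xi>) - \<delta> * r > y - (X \<xi> \<omega> - c2 * \<xi>))"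
        by auto
      then show "\<omega> \<in> ?E"
      proof (elim disjE bexE)
        fix t assume t: "t \<in> {0..\<xi>}" "X t \<omega> - c2 * t > y"
        have "\<delta> * t \<le> \<delta> * \<xi>" using t assms(7) by (intro mult_left_mono) auto
        then have "X t \<omega> - c1 * t > x" using xi(3) by (intro imp2 t) linarith
        then show ?thesis using \<omega> t xi by auto
      next
        fix r assume r: "r \<in> {0..T - \<xi>}" "X (\<xi> + r) \<omega> - c2 * (\<xi> + r) - (X \<xi> \<omega> - c2 * \<xi>) - \<delta> * r > y - (X \<xi> \<omega> - c2 * \<xi>)"
        have d: "\<delta> * (\<xi> + r) = y - x + \<delta> * r" using xi(3) by (simp add: distrib_left)
        have 1: "X (\<xi> + r) \<omega> - c1 * (\<xi> + r) > x" using r(2) drift[of "\<xi> + r" \<omega>] d by linarith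
        have "0 \<le> \<delta> * r" using r(1) assms(7) by simp
        then have "X (\<xi> + r) \<omega> - c2 * (\<xi> + r) > y" using d by (intro imp1 1) linarith
        then show ?thesis using \<omega> r(1) xi 1 by (auto intro!: bexI[of _ "\<xi> + r"])
      qed
    qed
    then have "ruin_prob M Z c1 c2 T x y = measure M ?E'" by (simp add: rp)
    also have "\<dots> = measure M {\<omega> \<in> space M. \<exists>t\<in>{0..\<xi>}. X t \<omega> - c2 * t > y}
       + (LBINT z:{0<..}. measure M {\<omega> \<in> space M. \<exists>t\<in>{0..T - \<xi>}. X t \<omega> - c1 * t > z} * P c2 (y - z) \<xi>)
       - (LBINT z:{0<..}. z * measure M {\<omega> \<in> space M. \<exists>t\<in>{0..T - \<xi>}. X t \<omega> - c1 * t > z} *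
           (LBINT s:{0<..<\<xi>}. P c2 y s / (\<xi> - s) * P c2 (- z) (\<xi> - s)))"
      using Y.two_boundary_probability[OF xi(1,2), of y \<delta>] xy unfolding drift by simp
    also have "measure M {\<omega> \<in> space M. \<exists>t\<in>{0..\<xi>}. X t \<omega> - c2 * t > y} = crossing_formula M Z f c2 \<xi> y"
      using xi xy by (intro cf) auto
    also have "(LBINT z:{0<..}. measure M {\<omega> \<in> space M. \<exists>t\<in>{0..T - \<xi>}. X t \<omega> - c1 * t > z} * P c2 (y - z) \<xi>)
      = (LBINT z:{0<..}. crossing_formula M Z f c1 (T - \<xi>) z * f (y + c2 * \<xi> - z) \<xi>)"
    proof (rule set_lebesgue_integral_cong)
      show "\<forall>z. z \<in> {0<..} \<longrightarrow> measure M {\<omega> \<in> space M. \<exists>t\<in>{0..T - \<xi>}. X t \<omega> - c1 * t > z} * P c2 (y - z) \<xi> =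
          crossing_formula M Z f c1 (T - \<xi>) z * f (y + c2 * \<xi> - z) \<xi>"
        using cf[OF xi(2), of _ c1] xi(1) unfolding P_def by (simp add: diff_add_eq)
    qed simp
    also have "(LBINT z:{0<..}. z * measure M {\<omega> \<in> space M. \<exists>t\<in>{0..T - \<xi>}. X t \<omega> - c1 * t > z} *
           (LBINT s:{0<..<\<xi>}. P c2 y s / (\<xi> - s) * P c2 (- z) (\<xi> - s)))
      = (LBINT z:{0<..}. z * crossing_formula M Z f c1 (T - \<xi>) z *
           (LBINT s:{0<..<\<xi>}. f (y + c2 * s) s / (\<xi> - s) * f (c2 * (\<xi> - s) - z) (\<xi> - s)))"
    proof -
      have "(LBINT s:{0<..<\<xi>}. P c2 y s / (\<xi> - s) * P c2 (- z) (\<xi> - s)) =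
         (LBINT s:{0<..<\<xi>}. f (y + c2 * s) s / (\<xi> - s) * f (c2 * (\<xi> - s) - z) (\<xi> - s))" for z
        by (rule set_lebesgue_integral_cong) (auto simp: P_def)
      then show ?thesis using xi by (intro set_lebesgue_integral_cong) (auto simp: cf)
    qed
    finally show "let \<xi> = (y - x) / \<delta> in
              ruin_prob M Z c1 c2 T x y =
                crossing_formula M Z f c2 \<xi> y +
                (LBINT z:{0<..}. crossing_formula M Z f c1 (T - \<xi>) z * f (y + c2 * \<xi> - z) \<xi>) -
                (LBINT z:{0<..}. z * crossing_formula M Z f c1 (T - \<xi>) z *
                   (LBINT s:{0<..<\<xi>}.
                      f (y + c2 * s) s / (\<xi> - s) * f (c2 * (\<xi> - s) - z) (\<xi> - s)))"
      unfolding \<xi>_def[symmetric] Let_def .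
  qed
qed

end
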